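(* Let $d\ge 1$ be an integer, and let $a<d/2-1$, $b>-1$, $c\in\mathbb{R}$. For $g>0$ put $$\pi(g;a,b,c)=(g+1)^a\left(\frac{g}{g+1}\right)^b\{\log(g+1)+1\}^c ,$$ and for $t\ge 0$ put $$m_\pi(t;a,b,c)=\int_0^\infty (g+1)^{-d/2}\exp\left(-\frac{t}{2(g+1)}\right)\pi(g;a,b,c)\,\mathrm{d}g .$$ Let $X\sim N_d(\mu,I_d)$ with $\mu\in\mathbb{R}^d$ unknown, and let $\delta_\pi$ be the (generalized) Bayes estimator of $\mu$ under quadratic loss with respect to the prior density $$\pi(\mu)=\int_0^\infty g^{-d/2}\exp\left(-\frac{\|\mu\|^2}{2g}\right)\pi(g;a,b,c)\,\mathrm{d}g,$$ that is, $\delta_\pi(x)=x+\nabla_x\log m_\pi(\|x\|^2;a,b,c)$. Then $\delta_\pi$ is admissible if $$\int_1^\infty\frac{\mathrm{d}g}{g\,\pi(g;a,b,c)}=\infty ,$$ and $\delta_\pi$ is inadmissible if this integral is finite. Moreover, the integral $\int_1^\infty \frac{\mathrm{d}g}{g\,\pi(g;a,b,c)}$ is finite if and only if $$\int_1^\infty\frac{\mathrm{d}t}{t^{d/2}\,m_\pi(t;a,b,c)}<\infty .$$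
   Context: An estimator is a measurable function $\delta:\mathbb{R}^d\to\mathbb{R}^d$. Its risk under quadratic loss is $R(\mu,\delta)=E_\mu\|\delta(X)-\mu\|^2$ with $X\sim N_d(\mu,I_d)$. The estimator $\delta$ is inadmissible if there is an estimator $\delta'$ with $R(\mu,\delta')\le R(\mu,\delta)$ for all $\mu\in\mathbb{R}^d$ and strict inequality for some $\mu$; otherwise it is admissible. The generalized Bayes estimator for a (possibly improper) prior density $\pi(\mu)$ is the posterior mean $\frac{\int \mu\,\phi(x-\mu)\pi(\mu)\,\mathrm{d}\mu}{\int\phi(x-\mu)\pi(\mu)\,\mathrm{d}\mu}$, where $\phi(z)=(2\pi)^{-d/2}\exp(-\|z\|^2/2)$. For the prior density above, the marginal $\int\phi(x-\mu)\pi(\mu)\,\mathrm{d}\mu$ equals $m_\pi(\|x\|^2;a,b,c)$, which is finite, and $$\delta_\pi(x)=\left(1-\frac{\int_0^\infty(g+1)^{-d/2-1}\exp\left(-\frac{\|x\|^2}{2(g+1)}\right)\pi(g;a,b,c)\,\mathrm{d}g}{\int_0^\infty(g+1)^{-d/2}\exp\left(-\frac{\|x\|^2}{2(g+1)}\right)\pi(g;a,b,c)\,\mathrm{d}g}\right)x .$$ *)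

theory Defs
  imports "HOL-Analysis.Analysis"
begin

definition gauss_density :: "real ^ 'n \<Rightarrow> real" where
  "gauss_density z = (2 * pi) powr (- real CARD('n) / 2) * exp (- (norm z)\<^sup>2 / 2)"

definition normal_law :: "real ^ 'n \<Rightarrow> (real ^ 'n) measure" where
  "normal_law \<mu> = density lborel (\<lambda>x. ennreal (gauss_density (x - \<mu>)))"

definition estimator :: "(real ^ 'n \<Rightarrow> real ^ 'n) \<Rightarrow> bool" where
  "estimator \<delta> \<longleftrightarrow> \<delta> \<in> borel_measurable borel"

(* The risk is extended-valued: it may be infinite for some estimators. *)
definition risk :: "real ^ 'n \<Rightarrow> (real ^ 'n \<Rightarrow> real ^ 'n) \<Rightarrow> ennreal" where
  "risk \<mu> \<delta> = (\<integral>\<^sup>+ x. ennreal ((norm (\<delta> x - \<mu>))\<^sup>2) \<partial>normal_law \<mu>)"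

definition inadmissible :: "(real ^ 'n \<Rightarrow> real ^ 'n) \<Rightarrow> bool" where
  "inadmissible \<delta> \<longleftrightarrow> estimator \<delta> \<and>
     (\<exists>\<delta>'. estimator \<delta>' \<and> (\<forall>\<mu>. risk \<mu> \<delta>' \<le> risk \<mu> \<delta>) \<and> (\<exists>\<mu>. risk \<mu> \<delta>' < risk \<mu> \<delta>))"

definition admissible :: "(real ^ 'n \<Rightarrow> real ^ 'n) \<Rightarrow> bool" where
  "admissible \<delta> \<longleftrightarrow> estimator \<delta> \<and> \<not> inadmissible \<delta>"

(* Posterior mean under the possibly improper prior with Lebesgue density p. Prior densities take
   values in ennreal, since the scale mixture prior_density below can be infinite at 0. *)
definition generalized_bayes :: "(real ^ 'n \<Rightarrow> ennreal) \<Rightarrow> real ^ 'n \<Rightarrow> real ^ 'n" where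
  "generalized_bayes p x =
     (\<integral>\<mu>. gauss_density (x - \<mu>) *\<^sub>R \<mu> \<partial>density lborel p) /\<^sub>R
     (\<integral>\<mu>. gauss_density (x - \<mu>) \<partial>density lborel p)"

definition mixing_density :: "real \<Rightarrow> real \<Rightarrow> real \<Rightarrow> real \<Rightarrow> real" where
  "mixing_density a b c g = (g + 1) powr a * (g / (g + 1)) powr b * (ln (g + 1) + 1) powr c"

definition prior_density :: "real \<Rightarrow> real \<Rightarrow> real \<Rightarrow> real ^ 'n \<Rightarrow> ennreal" where
  "prior_density a b c \<mu> =
     (\<integral>\<^sup>+ g\<in>{0<..}. ennreal (g powr (- real CARD('n) / 2) * exp (- (norm \<mu>)\<^sup>2 / (2 * g))
        * mixing_density a b c g) \<partial>lborel)"

definition marginal :: "nat \<Rightarrow> real \<Rightarrow> real \<Rightarrow> real \<Rightarrow> real \<Rightarrow> real" where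
  "marginal d a b c t =
     (LBINT g:{0<..}. (g + 1) powr (- real d / 2) * exp (- t / (2 * (g + 1)))
        * mixing_density a b c g)"

end

theory Submission
  imports Defs "HOL-Probability.Distributions"
begin

text \<open>Write \<open>m\<close> for the marginal. It is the total mass of the measure with density
  \<open>(g + 1) powr (- d / 2) * exp (- t / (2 * (g + 1))) * \<pi> g\<close> on \<open>g > 0\<close>, \<open>t = (norm x)\<^sup>2\<close>, and completing
  the square shows that \<open>\<delta>\<close> shrinks \<open>x\<close> by the mean of \<open>g / (g + 1)\<close> under this measure. Two-sided
  bounds of \<open>m t\<close> by \<open>(t + 1) powr (a - d / 2 + 1) * (ln (t + 1) + 1) powr c\<close> make the two integrals
  of the theorem comparable.

  Admissibility is Blyth's method. The mixing density is multiplied by \<open>(h n g)\<^sup>2\<close> with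
  \<open>h n g = max 0 (1 - ln (ln (g + 1) + 1) / n)\<close>. Bayes risks of the resulting proper priors are explicit
  Gaussian mixtures, and a covariance inequality bounds the excess Bayes risk of \<open>\<delta>\<close> by \<open>C / n\<close> as soon as
  \<open>\<pi> g\<close> grows at most like \<open>ln g\<close>, which the divergence of the integral forces. An estimator
  dominating \<open>\<delta>\<close> would then agree with \<open>\<delta>\<close> almost everywhere.

  For inadmissibility, Stein's identity expresses the risk difference between \<open>\<delta>\<close> and
  \<open>\<delta> x - k ((norm x)\<^sup>2) *\<^sub>R x\<close> as an integral whose integrand is nonnegative when \<open>k\<close> solves a
  Riccati-type differential inequality; a nonzero solution exists because \<open>1 / (t powr (d / 2) * m t)\<close>
  is integrable at infinity.\<close>

text \<open>The critical prior has \<open>mixing_density\<close> of order \<open>ln g\<close>: then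
  \<open>1 / (g * mixing_density a b c g)\<close> decays like \<open>1 / (g * ln g)\<close>, and its
  integral diverges only like \<open>ln (ln g)\<close>. A cutoff gentle enough for this case has to
  live on the scale of the iterated logarithm, and the same cutoff then serves every divergent
  choice of \<open>a\<close>, \<open>b\<close>, \<open>c\<close>. The obstacle is that the
  covariance bound couples two points \<open>g\<close> and \<open>g'\<close> through
  \<open>ln ((g' + 1) / (g + 1))\<close>. This logarithm is paid for by a small power \<epsilon> of
  the ratio, split into \<open>(g' + 1) powr \<epsilon>\<close> and
  \<open>(g + 1) powr - \<epsilon>\<close>. The first factor only moves \<open>a\<close> to
  \<open>a + \<epsilon>\<close>, which by the two-sided bounds costs
  \<open>(1 + t) powr \<epsilon>\<close>; after integration over \<open>x\<close> the two powers
  cancel. At the critical prior no power and no logarithm can be lost in this balance. Powers of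
  \<open>g + 1\<close> are always absorbed into the first parameter, so that the marginal, its
  derivative and the posterior moments belong to one family.\<close>

lemma power_le_fact_exp:
  fixes x :: real
  assumes "0 \<le> x"
  shows "x ^ n \<le> fact n * exp x"
proof -
  have "x ^ n /\<^sub>R fact n \<le> (\<Sum>k. x ^ k /\<^sub>R fact k)"
    using sum_le_suminf[OF summable_exp_generic[of x], of "{n}"] assms by simp
  then have "x ^ n / fact n \<le> exp x"
    unfolding exp_def real_scaleR_def divide_inverse by (subst mult.commute)
  then show ?thesis by (simp add: divide_le_eq mult.commute)
qed

abbreviation tilt :: "real \<Rightarrow> real \<Rightarrow> real" where
  "tilt t g \<equiv> exp (- t / (2 * (g + 1)))"

text \<open>Given the mixing variable \<open>g\<close> and the observation \<open>x\<close>, the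
  parameter is normal with mean \<open>w *\<^sub>R x\<close> and covariance \<open>w\<close> times
  the identity, where \<open>w = g / (g + 1)\<close>. With \<open>G0\<close> and \<open>G2\<close>
  the mass and the second moment of the Gaussian kernel, this is the expected loss of the guess
  \<eta> before normalisation.\<close>

abbreviation loss_kernel :: "real \<Rightarrow> real \<Rightarrow> 'a::real_normed_vector \<Rightarrow> 'a \<Rightarrow> real \<Rightarrow> real" where
  "loss_kernel G0 G2 \<eta> x g \<equiv> (norm (\<eta> - (g / (g + 1)) *\<^sub>R x))\<^sup>2 * G0 + g / (g + 1) * G2"

text \<open>The summand 1 outside the logarithm keeps the value at least 1 for
  \<open>g \<ge> 0\<close>, so that all real powers and quotients of it are harmless.\<close>

abbreviation slow_log :: "real \<Rightarrow> real" where
  "slow_log g \<equiv> ln (g + 1) + 1"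

abbreviation gauss_kernel :: "'a::real_normed_vector \<Rightarrow> real" where
  "gauss_kernel z \<equiv> exp (- (norm z)\<^sup>2 / 2)"

abbreviation mixing_kernel :: "real \<Rightarrow> real \<Rightarrow> real \<Rightarrow> real \<Rightarrow> real \<Rightarrow> real" where
  "mixing_kernel a b c t g \<equiv> indicator {0<..} g * (exp (- t / (2 * (g + 1))) * mixing_density a b c g)"

section \<open>Elementary bounds for powers, exponentials and slowly varying logarithms\<close>

lemma powr_exp_bounded:
  fixes p :: real
  obtains K where "K > 0" "\<And>x. x \<ge> 1 \<Longrightarrow> x powr p * exp (- x / 2) \<le> K"
proof -
  obtain n :: nat where n: "p \<le> real n" using real_arch_simple by blast
  have "x powr p * exp (- x / 2) \<le> 2 ^ n * fact n" if "x \<ge> 1" for x :: real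
  proof -
    have "2 ^ n * (x / 2) ^ n \<le> 2 ^ n * (fact n * exp (x / 2))"
      using that by (intro mult_left_mono power_le_fact_exp) auto
    then have "x ^ n \<le> 2 ^ n * fact n * exp (x / 2)" by (simp add: power_divide)
    moreover have "x powr p \<le> x ^ n"
      using powr_mono[OF n that] powr_realpow[of x n] that by linarith
    ultimately have "x powr p * exp (- x / 2) \<le> 2 ^ n * fact n * exp (x / 2) * exp (- x / 2)"
      by (intro mult_right_mono) auto
    also have "\<dots> = 2 ^ n * fact n" by (simp add: mult.assoc flip: exp_add)
    finally show ?thesis .
  qed
  then show ?thesis by (intro that[of "2 ^ n * fact n"]) auto
qed

lemma slow_log_ratio_le:
  fixes g t :: real
  assumes "0 \<le> t" "t \<le> g"
  shows "slow_log g \<le> (1 + ln ((g + 1) / (t + 1))) * slow_log t"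
proof -
  have "0 \<le> ln ((g + 1) / (t + 1)) * ln (t + 1)" using assms by (intro mult_nonneg_nonneg) auto
  moreover have "ln (g + 1) = ln ((g + 1) / (t + 1)) + ln (t + 1)" using assms by (simp add: ln_div)
  ultimately show ?thesis by (simp add: algebra_simps)
qed

text \<open>A Potter bound for the slowly varying factor of the prior: a real power of the logarithm
  changes by at most a small power of the ratio of the arguments. One constant serves both
  directions and both signs of \<open>c\<close>, which is what allows \<open>c\<close> to be an
  arbitrary real later.\<close>

lemma slow_log_powr_potter:
  fixes c \<epsilon> :: real
  assumes "\<epsilon> > 0"
  obtains C where "C > 0"
    "\<And>t g. 0 \<le> t \<Longrightarrow> t \<le> g \<Longrightarrow>
       slow_log g powr c \<le> C * ((g + 1) / (t + 1)) powr \<epsilon> * slow_log t powr c"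
    "\<And>t g. 0 \<le> g \<Longrightarrow> g \<le> t \<Longrightarrow>
       slow_log g powr c \<le> C * ((t + 1) / (g + 1)) powr \<epsilon> * slow_log t powr c"
proof -
  \<comment> \<open>Small enough that \<open>\<bar>c\<bar>\<close> copies of the exponent \<delta>
    stay below \<epsilon>; the summand \<epsilon> in the denominator covers \<open>c = 0\<close> and
    gives \<open>\<delta> \<le> 1\<close>.\<close>
  define \<delta> where "\<delta> = \<epsilon> / (\<bar>c\<bar> + \<epsilon>)"
  have \<delta>: "0 < \<delta>" "\<delta> \<le> 1" "\<delta> * \<bar>c\<bar> \<le> \<epsilon>" using assms by (auto simp: \<delta>_def field_simps)
  have key: "slow_log g powr c \<le> (1 / \<delta>) powr \<bar>c\<bar> * ((g + 1) / (t + 1)) powr \<epsilon> * slow_log t powr c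
     \<and> slow_log t powr c \<le> (1 / \<delta>) powr \<bar>c\<bar> * ((g + 1) / (t + 1)) powr \<epsilon> * slow_log g powr c"
    if "0 \<le> t" "t \<le> g" for t g :: real
  proof -
    define y where "y = (g + 1) / (t + 1)"
    define R where "R = 1 + ln y"
    define Lt where "Lt = slow_log t"
    define Lg where "Lg = slow_log g"
    have y: "y \<ge> 1" using that by (simp add: y_def)
    have R1: "R \<ge> 1" using y by (simp add: R_def)
    have L1: "Lt \<ge> 1" "Lg \<ge> Lt" using that by (auto simp: Lt_def Lg_def)
    have LR: "Lg \<le> R * Lt" using slow_log_ratio_le[OF that] by (simp add: Lg_def Lt_def R_def y_def)
    \<comment> \<open>From \<open>ln z \<le> z - 1\<close> at \<open>z = y powr \<delta>\<close>;
      the leftover \<open>\<delta> - 1\<close> is nonpositive.\<close>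
    have "R \<le> y powr \<delta> / \<delta>"
    proof -
      have "\<delta> * ln y = ln (y powr \<delta>)" using y by (simp add: ln_powr)
      also have "\<dots> \<le> y powr \<delta> - 1" using y by (intro ln_le_minus_one) auto
      finally have "\<delta> * R \<le> y powr \<delta>" using \<delta> by (simp add: R_def algebra_simps)
      then show ?thesis using \<delta> by (simp add: field_simps)
    qed
    then have "R powr \<bar>c\<bar> \<le> (y powr \<delta> / \<delta>) powr \<bar>c\<bar>" using R1 by (intro powr_mono2) auto
    also have "\<dots> = (1 / \<delta>) powr \<bar>c\<bar> * y powr (\<delta> * \<bar>c\<bar>)"
      using \<delta> y by (simp add: powr_divide powr_powr)
    also have "\<dots> \<le> (1 / \<delta>) powr \<bar>c\<bar> * y powr \<epsilon>"
      using \<delta> y by (intro mult_left_mono powr_mono) auto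
    finally have Rc: "R powr \<bar>c\<bar> \<le> (1 / \<delta>) powr \<bar>c\<bar> * y powr \<epsilon>" .
    have "Lg powr c \<le> R powr \<bar>c\<bar> * Lt powr c"
    proof (cases "c \<ge> 0")
      case True
      then have "Lg powr c \<le> (R * Lt) powr c" using LR L1 by (intro powr_mono2) auto
      also have "\<dots> = R powr \<bar>c\<bar> * Lt powr c" using True R1 L1 by (simp add: powr_mult)
      finally show ?thesis .
    next
      case False
      then have "Lg powr c \<le> 1 * Lt powr c" using L1 by (auto intro!: powr_mono2')
      also have "\<dots> \<le> R powr \<bar>c\<bar> * Lt powr c" using R1 by (intro mult_right_mono ge_one_powr_ge_zero) auto
      finally show ?thesis .
    qed
    moreover have "Lt powr c \<le> R powr \<bar>c\<bar> * Lg powr c"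
    proof (cases "c \<ge> 0")
      case False
      then have "(R * Lt) powr c \<le> Lg powr c" using LR L1 by (intro powr_mono2') auto
      then have "R powr \<bar>c\<bar> * (R * Lt) powr c \<le> R powr \<bar>c\<bar> * Lg powr c" by (intro mult_left_mono) auto
      moreover have "R powr \<bar>c\<bar> * (R * Lt) powr c = Lt powr c"
        using False R1 L1 by (simp add: powr_mult powr_minus field_simps)
      ultimately show ?thesis by simp
    next
      case True
      then have "Lt powr c \<le> 1 * Lg powr c" using L1 by (auto intro!: powr_mono2)
      also have "\<dots> \<le> R powr \<bar>c\<bar> * Lg powr c" using R1 by (intro mult_right_mono ge_one_powr_ge_zero) auto
      finally show ?thesis .
    qed
    ultimately show ?thesis
      using Rc mult_right_mono[OF Rc, of "Lt powr c"] mult_right_mono[OF Rc, of "Lg powr c"]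
      unfolding Lt_def[symmetric] Lg_def[symmetric] y_def[symmetric] by auto
  qed
  show ?thesis using that[of "(1 / \<delta>) powr \<bar>c\<bar>"] key \<delta> by auto
qed

text \<open>For negative \<open>b\<close> the factor is singular at \<open>g = 0\<close>. The
  singular part is confined to \<open>g \<le> 1\<close>, where it is integrable once
  \<open>b > -1\<close>, and the rest is bounded by a constant; the upper estimates below therefore
  never split on the sign of \<open>b\<close>.\<close>

lemma logistic_powr_le:
  fixes b g :: real
  assumes "g > 0"
  shows "(g / (g + 1)) powr b \<le> 2 powr \<bar>b\<bar> * (1 + g powr b * indicator {..1} g)"
proof (cases "b \<ge> 0")
  case True
  then have "(g / (g + 1)) powr b \<le> 1" using assms by (intro powr_le1) auto
  also have "1 \<le> 2 powr \<bar>b\<bar> * (1 + g powr b * indicator {..1} g)"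
    using mult_mono[of 1 "2 powr \<bar>b\<bar>" 1 "1 + g powr b * indicator {..1} g"]
    by (auto simp: ge_one_powr_ge_zero)
  finally show ?thesis .
next
  case False
  show ?thesis
  proof (cases "g \<le> 1")
    case True
    have "(g / (g + 1)) powr b = (g + 1) powr \<bar>b\<bar> * g powr b"
      using assms False by (simp add: powr_divide powr_minus field_simps)
    also have "\<dots> \<le> 2 powr \<bar>b\<bar> * g powr b" using True assms by (intro mult_right_mono powr_mono2) auto
    also have "\<dots> \<le> 2 powr \<bar>b\<bar> * (1 + g powr b * indicator {..1} g)" using True by (intro mult_left_mono) auto
    finally show ?thesis .
  next
    case g: False
    have "(g / (g + 1)) powr b \<le> (1/2) powr b" using False g by (intro powr_mono2') auto
    also have "\<dots> = 2 powr \<bar>b\<bar>" using False by (simp add: powr_divide powr_minus field_simps)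
    finally show ?thesis using g by simp
  qed
qed

section \<open>The mixing measure and two-sided bounds for its total mass\<close>

lemma mixing_density_nonneg [simp]: "mixing_density a b c g \<ge> 0"
  by (simp add: mixing_density_def)

lemma mixing_density_pos: "g > 0 \<Longrightarrow> mixing_density a b c g > 0"
proof -
  assume "g > 0"
  moreover from this have "slow_log g > 0" by (intro add_pos_pos ln_gt_zero) auto
  ultimately show ?thesis by (simp add: mixing_density_def)
qed

lemma mixing_density_measurable [measurable]: "mixing_density a b c \<in> borel_measurable borel"
  unfolding mixing_density_def[abs_def] by measurable

lemma powr_mult_mixing_density:
  "(g + 1) powr e * mixing_density a b c g = mixing_density (a + e) b c g"
  by (simp add: mixing_density_def powr_add mult_ac)

text \<open>Up to normalisation, the posterior law of the mixing variable when the squared norm of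
  the observation is \<open>t\<close>, provided that \<open>a\<close> is the exponent left after
  absorbing \<open>(g + 1) powr (- d / 2)\<close>. Marginals and posterior moments are integrals
  against it.\<close>

definition mixing_measure :: "real \<Rightarrow> real \<Rightarrow> real \<Rightarrow> real \<Rightarrow> real measure" where
  "mixing_measure a b c t =
     density lborel (\<lambda>g. ennreal (mixing_kernel a b c t g))"

lemma sets_mixing_measure [simp, measurable_cong]: "sets (mixing_measure a b c t) = sets borel"
  by (simp add: mixing_measure_def)

lemma space_mixing_measure [simp]: "space (mixing_measure a b c t) = UNIV"
  by (simp add: mixing_measure_def)

lemma AE_mixing_measure: "AE g in mixing_measure a b c t. g > 0"
  unfolding mixing_measure_def by (subst AE_density) (auto simp: indicator_def)

lemma nn_integral_mixing_measure:
  assumes [measurable]: "f \<in> borel_measurable borel"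
  shows "(\<integral>\<^sup>+ g. f g \<partial>mixing_measure a b c t) =
    (\<integral>\<^sup>+ g. ennreal (mixing_kernel a b c t g) * f g \<partial>lborel)"
  unfolding mixing_measure_def by (subst nn_integral_density) auto

lemma emeasure_mixing_measure:
  "emeasure (mixing_measure a b c t) UNIV =
    (\<integral>\<^sup>+ g. ennreal (mixing_kernel a b c t g) \<partial>lborel)"
  using nn_integral_mixing_measure[of "\<lambda>_. 1" a b c t] by simp

text \<open>Three regimes, each integrating to order at most \<open>(t + 1) powr (a + 1)\<close>
  apart from the logarithm. For \<open>g \<le> t\<close> the exponential beats every power of
  \<open>(t + 1) / (g + 1)\<close>; for \<open>g \<ge> t\<close> the Potter bound costs \<epsilon>
  of the decay and the tail stays integrable; the last summand carries the possible singularity at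
  \<open>g = 0\<close>.\<close>

lemma mixing_integrand_le:
  fixes a b c :: real
  assumes "a < -1"
  obtains C \<epsilon> where "C > 0" "a + \<epsilon> < -1" "0 < \<epsilon>"
    "\<And>t g. 0 \<le> t \<Longrightarrow> g > 0 \<Longrightarrow> tilt t g * mixing_density a b c g \<le>
       C * slow_log t powr c * ((t + 1) powr a * indicator {..t} g
          + (t + 1) powr - \<epsilon> * ((g + 1) powr (a + \<epsilon>) * indicator {t..} g)
          + (t + 1) powr a * (g powr b * indicator {..1} g))"
proof -
  \<comment> \<open>Half of the distance from \<open>a\<close> to \<open>-1\<close>, so that the
    tail exponent \<open>a + \<epsilon>\<close> is still below \<open>-1\<close>.\<close>
  define \<epsilon> where "\<epsilon> = (- a - 1) / 2"
  have \<epsilon>: "\<epsilon> > 0" "a + \<epsilon> < -1" using assms by (auto simp: \<epsilon>_def field_simps)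
  obtain C where C: "C > 0"
    "\<And>t g. 0 \<le> t \<Longrightarrow> t \<le> g \<Longrightarrow>
       slow_log g powr c \<le> C * ((g + 1) / (t + 1)) powr \<epsilon> * slow_log t powr c"
    "\<And>t g. 0 \<le> g \<Longrightarrow> g \<le> t \<Longrightarrow>
       slow_log g powr c \<le> C * ((t + 1) / (g + 1)) powr \<epsilon> * slow_log t powr c"
    using slow_log_powr_potter[OF \<epsilon>(1)] by metis
  obtain K where K: "K > 0" "\<And>x. x \<ge> 1 \<Longrightarrow> x powr (\<epsilon> - a) * exp (- x / 2) \<le> K"
    using powr_exp_bounded by metis
  define D where "D = C * 2 powr \<bar>b\<bar> * (exp (1/2) * K + 1)"
  have *: "tilt t g * mixing_density a b c g \<le>
       D * slow_log t powr c * ((t + 1) powr a * indicator {..t} g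
          + (t + 1) powr - \<epsilon> * ((g + 1) powr (a + \<epsilon>) * indicator {t..} g)
          + (t + 1) powr a * (g powr b * indicator {..1} g))" (is "?l \<le> _ * ?s")
    if tg: "0 \<le> t" "g > 0" for t g
  proof -
    define B where "B = g powr b * indicator {..1} g"
    have B0: "B \<ge> 0" by (simp add: B_def)
    have Lb: "(g / (g + 1)) powr b \<le> 2 powr \<bar>b\<bar> * (1 + B)"
      using logistic_powr_le[OF tg(2)] by (simp add: B_def)
    define Lc where "Lc = slow_log t powr c"
    have Lc0: "Lc \<ge> 0" by (simp add: Lc_def)
    show ?thesis
    proof (cases "g \<le> t")
      case True
      define x where "x = (t + 1) / (g + 1)"
      have x: "x \<ge> 1" using True tg by (simp add: x_def)
      \<comment> \<open>Replacing \<open>t\<close> by \<open>t + 1\<close> makes the exponential a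
        function of the ratio \<open>x\<close> alone; the price is a factor of at most
        \<open>exp (1/2)\<close>.\<close>
      have "tilt t g = exp (1 / (2 * (g + 1))) * exp (- x / 2)"
        using tg by (simp add: x_def flip: exp_add add_divide_distrib) (simp add: field_simps)
      also have "\<dots> \<le> exp (1/2) * exp (- x / 2)" using tg by (intro mult_right_mono) (auto simp: field_simps)
      finally have e: "tilt t g \<le> exp (1/2) * exp (- x / 2)" .
      have tx: "(g + 1) powr a = (t + 1) powr a * x powr (- a)"
        using tg by (simp add: x_def powr_divide powr_minus)
      have "?l = tilt t g * (g + 1) powr a * slow_log g powr c * (g / (g + 1)) powr b"
        by (simp add: mixing_density_def)
      also have "\<dots> \<le> exp (1/2) * exp (- x / 2) * (g + 1) powr a * (C * x powr \<epsilon> * Lc) * (2 powr \<bar>b\<bar> * (1 + B))"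
        using e C(3)[of g t] True tg Lb C(1) Lc0 unfolding x_def Lc_def by (intro mult_mono) auto
      also have "\<dots> = C * 2 powr \<bar>b\<bar> * exp (1/2) * (x powr (\<epsilon> - a) * exp (- x / 2)) * Lc * ((t + 1) powr a * (1 + B))"
        by (simp only: tx powr_diff powr_minus divide_inverse mult_ac)
      also have "\<dots> \<le> C * 2 powr \<bar>b\<bar> * exp (1/2) * K * Lc * ((t + 1) powr a * (1 + B))"
        using K(2)[OF x] C(1) Lc0 B0 by (intro mult_right_mono mult_left_mono) auto
      also have "\<dots> \<le> D * Lc * ((t + 1) powr a * (1 + B))"
        using K(1) C(1) Lc0 B0 by (intro mult_right_mono) (auto simp: D_def algebra_simps)
      also have "\<dots> \<le> D * Lc * ((t + 1) powr a * indicator {..t} g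
          + (t + 1) powr - \<epsilon> * ((g + 1) powr (a + \<epsilon>) * indicator {t..} g)
          + (t + 1) powr a * B)"
        using True K(1) C(1) Lc0 B0 by (intro mult_left_mono) (auto simp: algebra_simps D_def)
      finally show ?thesis by (simp add: Lc_def B_def)
    next
      case False
      have e: "tilt t g \<le> 1" using tg by simp
      have "(g + 1) powr (a + \<epsilon>) \<le> (t + 1) powr (a + \<epsilon>)"
        using \<epsilon> False tg by (intro powr_mono2') auto
      then have "(t + 1) powr - \<epsilon> * (g + 1) powr (a + \<epsilon>) \<le> (t + 1) powr - \<epsilon> * (t + 1) powr (a + \<epsilon>)"
        by (intro mult_left_mono) auto
      also have "\<dots> = (t + 1) powr a" by (simp flip: powr_add)
      finally have p: "(t + 1) powr - \<epsilon> * (g + 1) powr (a + \<epsilon>) \<le> (t + 1) powr a" .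
      have "?l = tilt t g * (g + 1) powr a * slow_log g powr c * (g / (g + 1)) powr b"
        by (simp add: mixing_density_def)
      also have "\<dots> \<le> 1 * (g + 1) powr a * (C * ((g + 1) / (t + 1)) powr \<epsilon> * Lc) * (2 powr \<bar>b\<bar> * (1 + B))"
        using e C(2)[of t g] False tg Lb C(1) Lc0 unfolding Lc_def by (intro mult_mono) auto
      also have "\<dots> = C * 2 powr \<bar>b\<bar> * Lc * ((t + 1) powr - \<epsilon> * (g + 1) powr (a + \<epsilon>) * (1 + B))"
        unfolding powr_divide[of "g + 1" "t + 1"] powr_add powr_minus by (simp add: divide_inverse mult_ac)
      also have "\<dots> \<le> D * Lc * ((t + 1) powr - \<epsilon> * (g + 1) powr (a + \<epsilon>) * (1 + B))"
        using K(1) C(1) Lc0 B0 by (intro mult_right_mono) (auto simp: D_def algebra_simps)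
      also have "\<dots> \<le> D * Lc * ((t + 1) powr a * indicator {..t} g
          + (t + 1) powr - \<epsilon> * ((g + 1) powr (a + \<epsilon>) * indicator {t..} g)
          + (t + 1) powr a * B)"
        using False K(1) C(1) Lc0 B0 mult_right_mono[OF p, of B]
        by (intro mult_left_mono) (auto simp: algebra_simps D_def)
      finally show ?thesis by (simp add: Lc_def B_def)
    qed
  qed
  have "D > 0" using C(1) K(1) by (auto simp: D_def intro!: mult_pos_pos add_pos_pos)
  then show ?thesis using \<epsilon>(2,1) * by (rule that)
qed

lemma nn_integral_shifted_powr_atLeast:
  fixes e t :: real
  assumes "e < -1" "0 \<le> t"
  shows "(\<integral>\<^sup>+ g. ennreal ((g + 1) powr e) * indicator {t..} g \<partial>lborel) = ennreal ((t + 1) powr (e + 1) / - (e + 1))"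
proof -
  have "(\<integral>\<^sup>+ g. ennreal ((g + 1) powr e) * indicator {t..} g \<partial>lborel)
      = ennreal (0 - (t + 1) powr (e + 1) / (e + 1))"
  proof (rule nn_integral_FTC_atLeast)
    fix x assume "t \<le> x"
    then show "((\<lambda>g. (g + 1) powr (e + 1) / (e + 1)) has_real_derivative (x + 1) powr e) (at x)"
      using assms by (auto intro!: derivative_eq_intros)
  next
    have "((\<lambda>g. (g + 1) powr (e + 1)) \<longlongrightarrow> 0) at_top"
      using assms by (intro tendsto_neg_powr filterlim_tendsto_add_at_top[OF _ filterlim_ident, of "\<lambda>_. 1", simplified add.commute])
        (auto simp: add.commute)
    then show "((\<lambda>g. (g + 1) powr (e + 1) / (e + 1)) \<longlongrightarrow> 0) at_top"
      by (rule tendsto_divide_zero)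
  qed auto
  also have "0 - (t + 1) powr (e + 1) / (e + 1) = (t + 1) powr (e + 1) / - (e + 1)" by (metis diff_0 minus_divide_right)
  finally show ?thesis .
qed

lemma nn_integral_powr_unit_interval:
  fixes b :: real
  assumes "b > -1"
  shows "(\<integral>\<^sup>+ g. ennreal (g powr b) * indicator {0..1} g \<partial>lborel) = ennreal (1 / (b + 1))"
  using nn_integral_has_integral_lebesgue'[OF _ has_integral_powr_from_0[OF assms, of 1]] by simp

lemma emeasure_mixing_measure_le:
  fixes a b c :: real
  assumes "a < -1" "b > -1"
  obtains C where "C > 0" "\<And>t. 0 \<le> t \<Longrightarrow> emeasure (mixing_measure a b c t) UNIV
     \<le> ennreal (C * ((t + 1) powr (a + 1) * slow_log t powr c))"
proof -
  obtain D \<epsilon> where D: "D > 0" and \<epsilon>: "a + \<epsilon> < -1" "0 < \<epsilon>" and bd: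
    "\<And>t g. 0 \<le> t \<Longrightarrow> g > 0 \<Longrightarrow> tilt t g * mixing_density a b c g \<le>
       D * slow_log t powr c * ((t + 1) powr a * indicator {..t} g
          + (t + 1) powr - \<epsilon> * ((g + 1) powr (a + \<epsilon>) * indicator {t..} g)
          + (t + 1) powr a * (g powr b * indicator {..1} g))"
    using mixing_integrand_le[OF assms(1), where b = b and c = c] by metis
  define C where "C = D * (1 + 1 / - (a + \<epsilon> + 1) + 1 / (b + 1))"
  have le: "emeasure (mixing_measure a b c t) UNIV
     \<le> ennreal (C * ((t + 1) powr (a + 1) * slow_log t powr c))" if t: "0 \<le> t" for t
  proof -
    define Lc where "Lc = slow_log t powr c"
    have Lc: "Lc \<ge> 0" by (simp add: Lc_def)
    let ?B = "\<lambda>g. ennreal (D * Lc) * (ennreal ((t + 1) powr a) * indicator {0..t} g + ennreal ((t + 1) powr - \<epsilon>) * (ennreal ((g + 1) powr (a + \<epsilon>)) * indicator {t..} g) + ennreal ((t + 1) powr a) * (ennreal (g powr b) * indicator {0..1} g))"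
    let ?S = "D * Lc * ((t + 1) powr a * t + (t + 1) powr - \<epsilon> * ((t + 1) powr (a + \<epsilon> + 1) / - (a + \<epsilon> + 1)) + (t + 1) powr a * (1 / (b + 1)))"
    have "emeasure (mixing_measure a b c t) UNIV \<le>
      (\<integral>\<^sup>+ g. (?B g) \<partial>lborel)"
      unfolding emeasure_mixing_measure
    proof (rule nn_integral_mono)
      fix g :: real
      show "ennreal (mixing_kernel a b c t g) \<le>
         (?B g)"
      proof (cases "g > 0")
        case True
        have "ennreal (tilt t g * mixing_density a b c g) \<le>
          ennreal (D * Lc * ((t + 1) powr a * indicator {..t} g
          + (t + 1) powr - \<epsilon> * ((g + 1) powr (a + \<epsilon>) * indicator {t..} g)
          + (t + 1) powr a * (g powr b * indicator {..1} g)))"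
          using bd[OF t True] by (intro ennreal_leI) (simp add: Lc_def)
        also have "\<dots> = (?B g)"
          using True D Lc by (subst ennreal_mult, simp, simp)
            (auto simp: ennreal_mult ennreal_plus indicator_def)
        finally show ?thesis using True by simp
      qed simp
    qed
    also have "\<dots> = ennreal (D * Lc) * (ennreal ((t + 1) powr a) * ennreal t
          + ennreal ((t + 1) powr - \<epsilon>) * ennreal ((t + 1) powr (a + \<epsilon> + 1) / - (a + \<epsilon> + 1))
          + ennreal ((t + 1) powr a) * ennreal (1 / (b + 1)))"
      using t by (simp add: nn_integral_add nn_integral_cmult nn_integral_shifted_powr_atLeast[OF \<epsilon>(1) t]
          nn_integral_powr_unit_interval[OF assms(2)] del: ennreal_plus)
    also have "\<dots> = ennreal (?S)"
    proof -
      have "ennreal k * (ennreal p * ennreal t + ennreal q * ennreal r + ennreal p * ennreal s) = ennreal (k * (p * t + q * r + p * s))"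
        if "0 \<le> k" "0 \<le> p" "0 \<le> q" "0 \<le> r" "0 \<le> s" for k p q r s :: real
        using that t by (simp add: ennreal_mult)
      then show ?thesis using D Lc t \<epsilon> assms(2) by (auto intro!: divide_nonneg_pos)
    qed
    also have "\<dots> \<le> ennreal (C * ((t + 1) powr (a + 1) * Lc))"
    proof (rule ennreal_leI)
      have T: "(t + 1) powr (a + 1) = (t + 1) * (t + 1) powr a" using t by (simp add: powr_add)
      have 1: "(t + 1) powr a * t \<le> (t + 1) powr (a + 1)" unfolding T by (simp add: algebra_simps)
      have 2: "(t + 1) powr - \<epsilon> * ((t + 1) powr (a + \<epsilon> + 1) / - (a + \<epsilon> + 1)) = (t + 1) powr (a + 1) * (1 / - (a + \<epsilon> + 1))"
        by (simp add: algebra_simps flip: powr_add)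
      have 3: "(t + 1) powr a * (1 / (b + 1)) \<le> (t + 1) powr (a + 1) * (1 / (b + 1))"
        using assms(2) t by (intro mult_right_mono powr_mono) auto
      have "?S
        \<le> D * Lc * ((t + 1) powr (a + 1) + (t + 1) powr (a + 1) * (1 / - (a + \<epsilon> + 1)) + (t + 1) powr (a + 1) * (1 / (b + 1)))"
        using D Lc 1 2 3 by (intro mult_left_mono) auto
      also have "\<dots> = C * ((t + 1) powr (a + 1) * Lc)" unfolding C_def by (simp only: algebra_simps)
      finally show "?S \<le> C * ((t + 1) powr (a + 1) * Lc)" .
    qed
    finally show ?thesis by (simp add: Lc_def)
  qed
  have "1 / - (a + \<epsilon> + 1) > 0" "1 / (b + 1) > 0"
    using \<epsilon> assms(2) by (auto intro!: divide_pos_pos)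
  then have "C > 0" unfolding C_def using D by (intro mult_pos_pos add_pos_pos) auto
  then show ?thesis using le by (rule that)
qed

text \<open>The window \<open>t + 1 \<le> g \<le> 2 * (t + 1)\<close> alone gives the right order.
  Its length is \<open>t + 1\<close>; on it the tilt and the factor with exponent \<open>b\<close>
  are bounded below by constants, while the power and the logarithm are at least constant multiples
  of their values at \<open>t\<close>.\<close>

lemma emeasure_mixing_measure_ge:
  fixes a b c :: real
  assumes "a < -1"
  obtains C where "C > 0" "\<And>t. 0 \<le> t \<Longrightarrow>
     ennreal (C * ((t + 1) powr (a + 1) * slow_log t powr c)) \<le> emeasure (mixing_measure a b c t) UNIV"
proof -
  obtain P where P: "P > 0" and Pot: "\<And>t g. 0 \<le> g \<Longrightarrow> g \<le> t \<Longrightarrow>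
       slow_log g powr c \<le> P * ((t + 1) / (g + 1)) powr 1 * slow_log t powr c"
    using slow_log_powr_potter[of 1 c] by (metis zero_less_one)
  \<comment> \<open>In this order the factors bound the tilt, the power (as
    \<open>g + 1 \<le> 3 * (t + 1)\<close> and \<open>a < 0\<close>), the factor with exponent
    \<open>b\<close> (as \<open>g / (g + 1)\<close> lies between 1/2 and 1), and the logarithm by
    the Potter bound with exponent 1.\<close>
  define C where "C = exp (-1/2) * 3 powr a * 2 powr - \<bar>b\<bar> * (1 / (3 * P))"
  have C: "C > 0" using P by (simp add: C_def)
  have le: "ennreal (C * ((t + 1) powr (a + 1) * slow_log t powr c)) \<le> emeasure (mixing_measure a b c t) UNIV"
    if t: "0 \<le> t" for t
  proof -
    define Lc where "Lc = slow_log t powr c"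
    have Lc: "Lc \<ge> 0" by (simp add: Lc_def)
    have pt: "C * (t + 1) powr a * Lc \<le> tilt t g * mixing_density a b c g"
      if g: "t + 1 \<le> g" "g \<le> 2 * (t + 1)" for g
    proof -
      have 1: "exp (-1/2) \<le> tilt t g" using t g by (simp add: field_simps)
      have "(3 * (t + 1)) powr a \<le> (g + 1) powr a" using assms t g by (intro powr_mono2') auto
      then have 2: "3 powr a * (t + 1) powr a \<le> (g + 1) powr a" unfolding powr_mult .
      have 3: "2 powr - \<bar>b\<bar> \<le> (g / (g + 1)) powr b"
      proof (cases "b \<ge> 0")
        case True
        have "2 powr - \<bar>b\<bar> = (1/2) powr b" using True by (simp add: powr_minus powr_divide field_simps)
        also have "\<dots> \<le> (g / (g + 1)) powr b" using True t g by (intro powr_mono2) (auto simp: field_simps)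
        finally show ?thesis .
      next
        case False
        have "2 powr - \<bar>b\<bar> \<le> 2 powr 0" by (intro powr_mono) auto
        also have "2 powr 0 = 1 powr b" by simp
        also have "\<dots> \<le> (g / (g + 1)) powr b" using False t g by (intro powr_mono2') (auto simp: field_simps)
        finally show ?thesis .
      qed
      have "Lc \<le> P * ((g + 1) / (t + 1)) powr 1 * slow_log g powr c"
        unfolding Lc_def using t g by (intro Pot) auto
      also have "\<dots> \<le> P * 3 * slow_log g powr c"
        using t g P by (intro mult_right_mono mult_left_mono) (auto simp: field_simps)
      finally have 4: "1 / (3 * P) * Lc \<le> slow_log g powr c" using P by (simp add: field_simps)
      have "C * (t + 1) powr a * Lc = exp (-1/2) * ((3 powr a * (t + 1) powr a) * 2 powr - \<bar>b\<bar> * (1 / (3 * P) * Lc))"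
        unfolding C_def by (simp only: mult_ac)
      also have "\<dots> \<le> tilt t g * ((g + 1) powr a * (g / (g + 1)) powr b * slow_log g powr c)"
        using 1 2 3 4 Lc P by (intro mult_mono) auto
      finally show ?thesis by (simp add: mixing_density_def)
    qed
    have "ennreal (C * ((t + 1) powr (a + 1) * Lc)) = ennreal (C * (t + 1) powr a * Lc) * ennreal (t + 1)"
    proof -
      have "C * ((t + 1) powr (a + 1) * Lc) = C * (t + 1) powr a * Lc * (t + 1)"
        using t by (simp add: powr_add)
      then show ?thesis using C Lc t by (simp only: ennreal_mult'')
    qed
    also have "\<dots> = (\<integral>\<^sup>+ g. ennreal (C * (t + 1) powr a * Lc) * indicator {t + 1..2 * (t + 1)} g \<partial>lborel)"
      using t by (subst nn_integral_cmult_indicator) auto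
    also have "\<dots> \<le> emeasure (mixing_measure a b c t) UNIV"
      unfolding emeasure_mixing_measure
    proof (rule nn_integral_mono)
      fix g :: real
      show "ennreal (C * (t + 1) powr a * Lc) * indicator {t + 1..2 * (t + 1)} g
         \<le> ennreal (mixing_kernel a b c t g)"
        using pt[of g] t by (auto simp: indicator_def intro!: ennreal_leI)
    qed
    finally show ?thesis by (simp add: Lc_def)
  qed
  show ?thesis using C le by (rule that)
qed

section \<open>The mass as a smooth positive function of \<open>t\<close>\<close>

definition mixing_mass :: "real \<Rightarrow> real \<Rightarrow> real \<Rightarrow> real \<Rightarrow> real" where
  "mixing_mass a b c t = measure (mixing_measure a b c t) UNIV"

text \<open>The density depends on \<open>t\<close> exponentially, with rate
  \<open>1 / (2 * (g + 1))\<close>, so a shift of \<open>t\<close> is a change of density. In other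
  words the mass is a Laplace transform in \<open>t\<close>.\<close>

lemma nn_integral_mixing_measure_shift:
  assumes [measurable]: "f \<in> borel_measurable borel"
  shows "(\<integral>\<^sup>+ g. f g \<partial>mixing_measure a b c (t + h)) =
    (\<integral>\<^sup>+ g. ennreal (tilt h g) * f g \<partial>mixing_measure a b c t)"
proof -
  have "ennreal (indicator {0<..} g * (exp (- (t + h) / (2 * (g + 1))) * mixing_density a b c g)) * f g =
    ennreal (mixing_kernel a b c t g) *
      (ennreal (tilt h g) * f g)" for g
    unfolding mult.assoc[symmetric] add_divide_distrib minus_add_distrib exp_add
    by (simp add: ennreal_mult[symmetric] mult_ac)
  then show ?thesis by (simp add: nn_integral_mixing_measure)
qed

lemma nn_integral_mixing_measure_powr:
  assumes [measurable]: "f \<in> borel_measurable borel"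
  shows "(\<integral>\<^sup>+ g. f g \<partial>mixing_measure (a + e) b c t) =
    (\<integral>\<^sup>+ g. ennreal ((g + 1) powr e) * f g \<partial>mixing_measure a b c t)"
proof -
  have "ennreal (indicator {0<..} g * (tilt t g * mixing_density (a + e) b c g)) * f g =
    ennreal (mixing_kernel a b c t g) *
      (ennreal ((g + 1) powr e) * f g)" for g
    unfolding mult.assoc[symmetric] powr_mult_mixing_density[symmetric]
    by (simp add: ennreal_mult[symmetric] mult_ac)
  then show ?thesis by (simp add: nn_integral_mixing_measure)
qed

text \<open>Negative \<open>t\<close> is included because the mass is differentiated at
  \<open>t = 0\<close>, the squared norm of the origin. There the density is at most a constant
  multiple of the one at \<open>max 0 t\<close>, since \<open>1 / (2 * (g + 1))\<close> is at most
  1.\<close>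

lemma finite_mixing_measure:
  assumes "a < -1" "b > -1"
  shows "finite_measure (mixing_measure a b c t)"
proof (rule finite_measureI)
  define s where "s = max 0 t"
  obtain C where C: "\<And>t. 0 \<le> t \<Longrightarrow> emeasure (mixing_measure a b c t) UNIV
     \<le> ennreal (C * ((t + 1) powr (a + 1) * slow_log t powr c))"
    using emeasure_mixing_measure_le[OF assms] by metis
  have "emeasure (mixing_measure a b c t) UNIV = (\<integral>\<^sup>+ g. 1 \<partial>mixing_measure a b c (s + (t - s)))" by simp
  also have "\<dots> = (\<integral>\<^sup>+ g. ennreal (exp (- (t - s) / (2 * (g + 1)))) * 1 \<partial>mixing_measure a b c s)"
    by (rule nn_integral_mixing_measure_shift) simp
  also have "\<dots> \<le> (\<integral>\<^sup>+ g. ennreal (exp (s - t)) \<partial>mixing_measure a b c s)"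
  proof (rule nn_integral_mono_AE, use AE_mixing_measure[of a b c s] in eventually_elim)
    fix g :: real assume g: "0 < g"
    have "- (t - s) / (2 * (g + 1)) \<le> s - t"
    proof -
      have "(s - t) / (2 * (g + 1)) \<le> (s - t) / 1"
        using g by (intro divide_left_mono) (auto simp: s_def)
      then show ?thesis by simp
    qed
    then show "ennreal (exp (- (t - s) / (2 * (g + 1)))) * 1 \<le> ennreal (exp (s - t))"
      by (simp add: ennreal_leI)
  qed
  also have "\<dots> < \<infinity>"
  proof -
    have "emeasure (mixing_measure a b c s) UNIV < \<infinity>"
      using C[of s] by (auto simp: s_def intro: le_less_trans)
    then show ?thesis by (auto simp: ennreal_mult_less_top)
  qed
  finally show "emeasure (mixing_measure a b c t) (space (mixing_measure a b c t)) \<noteq> \<infinity>" by simp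
qed

lemma emeasure_mixing_measure_eq:
  assumes "a < -1" "b > -1"
  shows "emeasure (mixing_measure a b c t) UNIV = ennreal (mixing_mass a b c t)"
proof -
  interpret finite_measure "mixing_measure a b c t" by (rule finite_mixing_measure) fact+
  show ?thesis by (simp add: mixing_mass_def emeasure_eq_measure)
qed

lemma mixing_mass_nonneg [simp]: "mixing_mass a b c t \<ge> 0"
  by (simp add: mixing_mass_def)

lemma mixing_mass_le:
  fixes a b c :: real
  assumes "a < -1" "b > -1"
  obtains C where "C > 0" "\<And>t. 0 \<le> t \<Longrightarrow>
    mixing_mass a b c t \<le> C * ((t + 1) powr (a + 1) * slow_log t powr c)"
proof -
  obtain C where C: "C > 0" "\<And>t. 0 \<le> t \<Longrightarrow> emeasure (mixing_measure a b c t) UNIV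
     \<le> ennreal (C * ((t + 1) powr (a + 1) * slow_log t powr c))"
    using emeasure_mixing_measure_le[OF assms] by metis
  have "mixing_mass a b c t \<le> C * ((t + 1) powr (a + 1) * slow_log t powr c)" if "0 \<le> t" for t
    using C(2)[OF that] C(1) unfolding emeasure_mixing_measure_eq[OF assms]
    by (subst (asm) ennreal_le_iff) auto
  with C(1) show ?thesis by (rule that)
qed

lemma mixing_mass_ge:
  fixes a b c :: real
  assumes "a < -1" "b > -1"
  obtains C where "C > 0" "\<And>t. 0 \<le> t \<Longrightarrow>
    C * ((t + 1) powr (a + 1) * slow_log t powr c) \<le> mixing_mass a b c t"
proof -
  obtain C where C: "C > 0" "\<And>t. 0 \<le> t \<Longrightarrow>
     ennreal (C * ((t + 1) powr (a + 1) * slow_log t powr c)) \<le> emeasure (mixing_measure a b c t) UNIV"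
    using emeasure_mixing_measure_ge[OF assms(1), of c b] by metis
  have "C * ((t + 1) powr (a + 1) * slow_log t powr c) \<le> mixing_mass a b c t" if "0 \<le> t" for t
    using C(2)[OF that] C(1) unfolding emeasure_mixing_measure_eq[OF assms]
    by (subst (asm) ennreal_le_iff) auto
  with C(1) show ?thesis by (rule that)
qed

lemma mixing_mass_shift:
  assumes "a < -1" "b > -1"
  shows "mixing_mass a b c (t + h) = (\<integral>g. tilt h g \<partial>mixing_measure a b c t)"
    and "integrable (mixing_measure a b c t) (\<lambda>g. tilt h g)"
proof -
  have eq: "(\<integral>\<^sup>+ g. ennreal (tilt h g) \<partial>mixing_measure a b c t) = ennreal (mixing_mass a b c (t + h))"
    using nn_integral_mixing_measure_shift[of "\<lambda>_. 1" a b c t h] emeasure_mixing_measure_eq[OF assms, of c "t + h"] by simp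
  show "mixing_mass a b c (t + h) = (\<integral>g. tilt h g \<partial>mixing_measure a b c t)"
    by (rule has_bochner_integral_integral_eq[OF has_bochner_integral_nn_integral[OF _ _ _ eq], symmetric]) auto
  show "integrable (mixing_measure a b c t) (\<lambda>g. tilt h g)"
    by (rule integrable.intros[OF has_bochner_integral_nn_integral[OF _ _ _ eq]]) auto
qed

lemma mixing_mass_powr:
  assumes "a + e < -1" "b > -1"
  shows "mixing_mass (a + e) b c t = (\<integral>g. (g + 1) powr e \<partial>mixing_measure a b c t)"
    and "integrable (mixing_measure a b c t) (\<lambda>g. (g + 1) powr e)"
proof -
  have eq: "(\<integral>\<^sup>+ g. ennreal ((g + 1) powr e) \<partial>mixing_measure a b c t) = ennreal (mixing_mass (a + e) b c t)"
    using nn_integral_mixing_measure_powr[of "\<lambda>_. 1" a e b c t] emeasure_mixing_measure_eq[OF assms, of c "t"] by simp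
  show "mixing_mass (a + e) b c t = (\<integral>g. (g + 1) powr e \<partial>mixing_measure a b c t)"
    by (rule has_bochner_integral_integral_eq[OF has_bochner_integral_nn_integral[OF _ _ _ eq], symmetric]) auto
  show "integrable (mixing_measure a b c t) (\<lambda>g. (g + 1) powr e)"
    by (rule integrable.intros[OF has_bochner_integral_nn_integral[OF _ _ _ eq]]) auto
qed

lemma mixing_mass_minus_one:
  assumes "a < -1" "b > -1"
  shows "mixing_mass (a - 1) b c t = (\<integral>g. 1 / (g + 1) \<partial>mixing_measure a b c t)"
    and "integrable (mixing_measure a b c t) (\<lambda>g. 1 / (g + 1))"
proof -
  have ae: "AE g in mixing_measure a b c t. (g + 1) powr - 1 = 1 / (g + 1)"
    using AE_mixing_measure by eventually_elim (simp add: powr_minus divide_inverse)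
  show "mixing_mass (a - 1) b c t = (\<integral>g. 1 / (g + 1) \<partial>mixing_measure a b c t)"
    using mixing_mass_powr(1)[of a "-1" b c t] integral_cong_AE[OF _ _ ae] assms by simp
  show "integrable (mixing_measure a b c t) (\<lambda>g. 1 / (g + 1))"
    using mixing_mass_powr(2)[of a "-1" b c t] integrable_cong_AE[OF _ _ ae] assms by simp
qed

lemma mixing_mass_minus_one_le:
  assumes "a < -1" "b > -1"
  shows "mixing_mass (a - 1) b c t \<le> mixing_mass a b c t"
proof -
  interpret finite_measure "mixing_measure a b c t" by (rule finite_mixing_measure) fact+
  have "mixing_mass (a - 1) b c t \<le> (\<integral>g. 1 \<partial>mixing_measure a b c t)"
    unfolding mixing_mass_minus_one[OF assms]
    by (intro integral_mono_AE mixing_mass_minus_one(2)[OF assms] integrable_const)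
      (rule eventually_mono[OF AE_mixing_measure], simp)
  then show ?thesis by (simp add: mixing_mass_def)
qed

lemma exp_le_one_plus_square:
  fixes z :: real
  assumes "z \<le> 1"
  shows "exp z \<le> 1 + z + z\<^sup>2"
proof (cases "z \<ge> 0")
  case True
  then show ?thesis using assms exp_bound by simp
next
  case False
  have "exp z = 1 / exp (- z)" by (simp add: exp_minus field_simps)
  also have "\<dots> \<le> 1 / (1 - z)" using False exp_ge_add_one_self[of "- z"] by (intro divide_left_mono) auto
  also have "\<dots> \<le> 1 + z + z\<^sup>2"
  proof -
    have "(1 + z + z\<^sup>2) * (1 - z) = 1 - z ^ 3" by (simp add: algebra_simps power2_eq_square power3_eq_cube)
    moreover have "z ^ 3 \<le> 0" using False by (simp add: power_le_zero_eq)
    ultimately show ?thesis using False by (simp add: divide_le_eq)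
  qed
  finally show ?thesis .
qed

text \<open>Differentiation under the integral sign with an explicit remainder: for
  \<open>z = - h / (2 * (g + 1))\<close> the error \<open>exp z - 1 - z\<close> lies between 0 and
  the square of \<open>h\<close>, uniformly in \<open>g\<close>, so the difference quotient is off
  by at most \<open>\<bar>h\<bar>\<close> times the mass. The derivative stays in the family, with
  \<open>a\<close> lowered by 1.\<close>

lemma mixing_mass_has_derivative:
  assumes "a < -1" "b > -1"
  shows "(mixing_mass a b c has_real_derivative - mixing_mass (a - 1) b c t / 2) (at t)"
proof -
  interpret finite_measure "mixing_measure a b c t" by (rule finite_mixing_measure) fact+
  define N where "N = mixing_measure a b c t"
  let ?q = "\<lambda>h. (mixing_mass a b c (t + h) - mixing_mass a b c t) / h + mixing_mass (a - 1) b c t / 2"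
  have bound: "\<bar>(?q h)\<bar>
      \<le> \<bar>h\<bar> * mixing_mass a b c t" if h: "h \<noteq> 0" "\<bar>h\<bar> \<le> 1" for h
  proof -
    let ?r = "\<lambda>g. tilt h g - 1 + h / 2 * (1 / (g + 1))"
    have int1: "integrable N (\<lambda>g. tilt h g - 1)" unfolding N_def
      by (intro Bochner_Integration.integrable_diff integrable_const mixing_mass_shift(2)[OF assms])
    have int2: "integrable N (\<lambda>g. h / 2 * (1 / (g + 1)))" unfolding N_def
      by (intro integrable_mult_right mixing_mass_minus_one(2)[OF assms])
    have int: "integrable N ?r" using int1 int2 by (rule Bochner_Integration.integrable_add)
    have "\<bar>\<integral>g. ?r g \<partial>N\<bar> \<le> (\<integral>g. h\<^sup>2 \<partial>N)"
    proof (rule order_trans[OF integral_abs_bound], rule integral_mono_AE)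
      show "integrable N (\<lambda>g. \<bar>?r g\<bar>)" using int by (rule integrable_abs)
      show "integrable N (\<lambda>g. h\<^sup>2)" unfolding N_def by (rule integrable_const)
      show "AE g in N. \<bar>?r g\<bar> \<le> h\<^sup>2"
        using AE_mixing_measure[of a b c t, folded N_def]
      proof eventually_elim
        fix g :: real assume g: "0 < g"
        define z where "z = - h / (2 * (g + 1))"
        have "\<bar>z\<bar> = \<bar>h\<bar> / (2 * (g + 1))" using g by (simp add: z_def)
        also have "\<dots> \<le> \<bar>h\<bar> / 1" using g by (intro divide_left_mono) auto
        finally have z: "\<bar>z\<bar> \<le> \<bar>h\<bar>" by simp
        have "?r g = exp z - 1 - z" using g by (simp add: z_def field_simps)
        moreover have "0 \<le> exp z - 1 - z" using exp_ge_add_one_self[of z] by linarith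
        moreover have "exp z - 1 - z \<le> z\<^sup>2" using exp_le_one_plus_square[of z] z h by linarith
        moreover have "z\<^sup>2 \<le> h\<^sup>2" using z by (simp add: abs_le_square_iff)
        ultimately show "\<bar>?r g\<bar> \<le> h\<^sup>2" by linarith
      qed
    qed
    also have "(\<integral>g. h\<^sup>2 \<partial>N) = h\<^sup>2 * mixing_mass a b c t" by (simp add: N_def mixing_mass_def)
    also have "(\<integral>g. ?r g \<partial>N) = mixing_mass a b c (t + h) - mixing_mass a b c t + h / 2 * mixing_mass (a - 1) b c t"
    proof -
      have "(\<integral>g. ?r g \<partial>N) = (\<integral>g. tilt h g - 1 \<partial>N) + (\<integral>g. h / 2 * (1 / (g + 1)) \<partial>N)"
        using int1 int2 by (rule Bochner_Integration.integral_add)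
      also have "(\<integral>g. tilt h g - 1 \<partial>N) = mixing_mass a b c (t + h) - mixing_mass a b c t"
        unfolding N_def mixing_mass_shift(1)[OF assms]
        by (subst Bochner_Integration.integral_diff[OF mixing_mass_shift(2)[OF assms] integrable_const])
          (simp add: mixing_mass_def)
      also have "(\<integral>g. h / 2 * (1 / (g + 1)) \<partial>N) = h / 2 * mixing_mass (a - 1) b c t"
        unfolding N_def mixing_mass_minus_one[OF assms] by (rule integral_mult_right_zero)
      finally show ?thesis .
    qed
    also have "\<dots> = h * (?q h)"
      using h by (simp add: field_simps)
    finally have "\<bar>h\<bar> * \<bar>(?q h)\<bar>
      \<le> \<bar>h\<bar> * (\<bar>h\<bar> * mixing_mass a b c t)" by (simp add: abs_mult power2_eq_square)
    then show ?thesis using h by simp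
  qed
  have "((\<lambda>h. (?q h)) \<longlongrightarrow> 0) (at 0)"
  proof (rule Lim_null_comparison)
    show "\<forall>\<^sub>F h in at 0. norm (?q h)
       \<le> \<bar>h\<bar> * mixing_mass a b c t"
      unfolding eventually_at using bound by (intro exI[of _ 1]) (auto simp: dist_real_def)
    show "((\<lambda>h. \<bar>h\<bar> * mixing_mass a b c t) \<longlongrightarrow> 0) (at (0::real))"
      by (auto intro!: tendsto_eq_intros)
  qed
  then have "((\<lambda>h. (mixing_mass a b c (t + h) - mixing_mass a b c t) / h) \<longlongrightarrow> - (mixing_mass (a - 1) b c t / 2)) (at 0)"
    by (auto dest: tendsto_diff[OF _ tendsto_const[of "mixing_mass (a - 1) b c t / 2"]])
  then show ?thesis by (simp add: DERIV_def)
qed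

text \<open>The density is positive on the unit interval, so a property that holds almost everywhere
  is met there. This refutes the vanishing of the mass and later, because the cutoff is positive on
  the same interval, of the cutoff mass.\<close>

lemma mixing_measure_AE_witness:
  assumes "AE g in mixing_measure a b c t. P g"
  obtains g where "0 < g" "g < 1" "P g"
proof -
  have "\<exists>g\<in>{0<..<1}. P g"
  proof (rule ccontr)
    assume none: "\<not> (\<exists>g\<in>{0<..<1}. P g)"
    have "AE g in lborel. 0 < ennreal (mixing_kernel a b c t g) \<longrightarrow> P g"
      using assms unfolding mixing_measure_def by (subst (asm) AE_density) auto
    then have "AE g in lborel. g \<notin> {0<..<1::real}"
    proof eventually_elim
      fix g :: real
      assume z: "0 < ennreal (mixing_kernel a b c t g) \<longrightarrow> P g"
      show "g \<notin> {0<..<1}"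
      proof
        assume g: "g \<in> {0<..<1}"
        then have "tilt t g * mixing_density a b c g > 0"
          by (intro mult_pos_pos mixing_density_pos) auto
        with z g none show False by simp
      qed
    qed
    then have "emeasure lborel {0<..<1::real} = 0" by (subst (asm) AE_iff_measurable[of "{0<..<1}"]) auto
    then show False by simp
  qed
  then show ?thesis using that by auto
qed

lemma mixing_mass_pos:
  assumes "a < -1" "b > -1"
  shows "mixing_mass a b c t > 0"
proof -
  have "mixing_mass a b c t \<noteq> 0"
  proof
    assume "mixing_mass a b c t = 0"
    then have "emeasure (mixing_measure a b c t) UNIV = 0" by (simp add: emeasure_mixing_measure_eq[OF assms])
    then have "AE g in mixing_measure a b c t. False" by (intro AE_I[of _ _ UNIV]) auto
    then show False by (rule mixing_measure_AE_witness)
  qed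
  then show ?thesis using mixing_mass_nonneg[of a b c t] by linarith
qed

lemma continuous_on_mixing_mass:
  assumes "a < -1" "b > -1"
  shows "continuous_on S (mixing_mass a b c)"
  using mixing_mass_has_derivative[OF assms, of c] by (meson DERIV_isCont continuous_at_imp_continuous_on)

lemma mixing_mass_measurable:
  assumes "a < -1" "b > -1"
  shows "mixing_mass a b c \<in> borel_measurable borel"
  using continuous_on_mixing_mass[OF assms] by (rule borel_measurable_continuous_onI)

lemma marginal_eq_mixing_mass:
  "marginal d a b c t = mixing_mass (a - real d / 2) b c t"
proof -
  have eq: "indicator {0<..} g *\<^sub>R ((g + 1) powr (- real d / 2) * tilt t g * mixing_density a b c g)
    = indicator {0<..} g * (tilt t g * mixing_density (a - real d / 2) b c g)" for g :: real
    using powr_mult_mixing_density[of g "- real d / 2" a b c] by (simp add: mult_ac)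
  show ?thesis
    unfolding marginal_def set_lebesgue_integral_def eq mixing_mass_def measure_def emeasure_mixing_measure
    by (rule integral_eq_nn_integral) auto
qed

section \<open>Gaussian integrals on a Euclidean space\<close>

lemma nn_integral_lborel_affine:
  fixes t :: "'a::euclidean_space" and r :: real
  assumes [measurable]: "f \<in> borel_measurable borel" and r: "r \<noteq> 0"
  shows "(\<integral>\<^sup>+x. f x \<partial>lborel) = ennreal (\<bar>r\<bar> ^ DIM('a)) * (\<integral>\<^sup>+x. f (t + r *\<^sub>R x) \<partial>lborel)"
proof -
  have "(\<integral>\<^sup>+x. f x \<partial>lborel) = (\<integral>\<^sup>+x. ennreal (\<bar>r\<bar> ^ DIM('a)) * f x \<partial>distr lborel borel (\<lambda>x. t + r *\<^sub>R x))"
    by (subst lborel_affine[OF r, of t], subst nn_integral_density) auto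
  also have "\<dots> = (\<integral>\<^sup>+x. ennreal (\<bar>r\<bar> ^ DIM('a)) * f (t + r *\<^sub>R x) \<partial>lborel)"
    by (rule nn_integral_distr) measurable
  also have "\<dots> = ennreal (\<bar>r\<bar> ^ DIM('a)) * (\<integral>\<^sup>+x. f (t + r *\<^sub>R x) \<partial>lborel)"
    by (rule nn_integral_cmult) measurable
  finally show ?thesis .
qed

lemma nn_integral_exp_neg_square_finite:
  fixes s :: real
  assumes "s > 0"
  shows "(\<integral>\<^sup>+x. ennreal (exp (- s * x\<^sup>2)) \<partial>(lborel :: real measure)) < \<infinity>"
proof -
  define \<sigma> where "\<sigma> = sqrt (1 / (2 * s))"
  have \<sigma>: "\<sigma> > 0" "\<sigma>\<^sup>2 = 1 / (2 * s)" using assms by (auto simp: \<sigma>_def)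
  have eq: "exp (- s * x\<^sup>2) = sqrt (2 * pi * \<sigma>\<^sup>2) * normal_density 0 \<sigma> x" for x
    using \<sigma> assms by (simp add: normal_density_def)
  have "integrable lborel (\<lambda>x. exp (- s * x\<^sup>2))"
    unfolding eq using \<sigma> by (intro integrable_mult_right integrable_normal_density)
  then have "(\<integral>\<^sup>+x. ennreal (norm (exp (- s * x\<^sup>2))) \<partial>lborel) < \<infinity>"
    unfolding integrable_iff_bounded by blast
  then show ?thesis by simp
qed

lemma nn_integral_gaussian_finite:
  fixes s :: real
  assumes "s > 0"
  shows "(\<integral>\<^sup>+z. ennreal (exp (- s * (norm z)\<^sup>2)) \<partial>(lborel :: ('a::euclidean_space) measure)) < \<infinity>"
proof -
  have eq: "ennreal (exp (- s * (norm z)\<^sup>2)) = (\<Prod>b\<in>Basis. ennreal (exp (- s * (inner z b)\<^sup>2)))" for z :: 'a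
  proof -
    have "(norm z)\<^sup>2 = (\<Sum>b\<in>Basis. (inner z b)\<^sup>2)"
      by (simp add: power2_norm_eq_inner) (subst euclidean_inner, simp add: power2_eq_square)
    then show ?thesis by (simp add: prod_ennreal sum_distrib_left exp_sum)
  qed
  have "(\<integral>\<^sup>+z. (\<Prod>b\<in>Basis. ennreal (exp (- s * (inner z b)\<^sup>2))) \<partial>(lborel :: 'a measure))
      = (\<Prod>b\<in>(Basis::'a set). \<integral>\<^sup>+x. ennreal (exp (- s * x\<^sup>2)) \<partial>lborel)"
    by (rule nn_integral_lborel_prod) auto
  also have "\<dots> < \<infinity>"
    using nn_integral_exp_neg_square_finite[OF assms] by (simp add: power_less_top_ennreal)
  finally show ?thesis unfolding eq .
qed

text \<open>Half of the Gaussian exponent absorbs the polynomial, through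
  \<open>v ^ k \<le> fact k * exp v\<close> with \<open>v\<close> equal to \<open>s / 2\<close>
  times the base of the power; the other half remains integrable.\<close>

lemma integrable_polynomial_gaussian:
  fixes s :: real
  assumes "s > 0"
  shows "integrable lborel (\<lambda>z::'a::euclidean_space. (1 + (norm z)\<^sup>2) ^ k * exp (- s * (norm z)\<^sup>2))"
proof (rule Bochner_Integration.integrable_bound)
  let ?K = "fact k * (2 / s) ^ k * exp (s / 2)"
  show "integrable lborel (\<lambda>z::'a. ?K * exp (- (s / 2) * (norm z)\<^sup>2))"
    using nn_integral_gaussian_finite[of "s / 2", where 'a='a] assms
    by (intro integrable_mult_right integrableI_nonneg) auto
  show "AE z in (lborel :: 'a measure). norm ((1 + (norm z)\<^sup>2) ^ k * exp (- s * (norm z)\<^sup>2)) \<le> norm (?K * exp (- (s / 2) * (norm z)\<^sup>2))"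
  proof (rule AE_I2)
    fix z :: 'a
    define y where "y = (norm z)\<^sup>2"
    have y: "y \<ge> 0" by (simp add: y_def)
    define v where "v = s / 2 * (1 + y)"
    have v: "v \<ge> 0" using y assms by (simp add: v_def)
    have "(2 / s) ^ k * v ^ k \<le> (2 / s) ^ k * (fact k * exp v)"
      using assms v by (intro mult_left_mono power_le_fact_exp) auto
    also have "(2 / s) ^ k * v ^ k = (2 / s * v) ^ k" by (rule power_mult_distrib[symmetric])
    also have "2 / s * v = 1 + y" using assms by (simp add: v_def)
    finally have "(1 + y) ^ k \<le> fact k * (2 / s) ^ k * exp v" by (simp add: mult_ac)
    then have "(1 + y) ^ k * exp (- s * y) \<le> fact k * (2 / s) ^ k * exp v * exp (- s * y)"
      by (intro mult_right_mono) auto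
    also have "\<dots> = ?K * exp (- (s / 2) * y)"
      unfolding v_def mult.assoc by (simp flip: exp_add) (simp add: field_simps)
    finally show "norm ((1 + (norm z)\<^sup>2) ^ k * exp (- s * (norm z)\<^sup>2)) \<le> norm (?K * exp (- (s / 2) * (norm z)\<^sup>2))"
      using y assms by (simp add: y_def[symmetric] abs_mult)
  qed
qed auto

text \<open>Only the sign of this constant and of the second moment matters below, so neither value
  is computed. The dimension enters through the type argument.\<close>

definition gaussian_mass :: "'a::euclidean_space itself \<Rightarrow> real" where
  "gaussian_mass _ = (\<integral>z. gauss_kernel z \<partial>(lborel :: 'a measure))"

definition gaussian_moment2 :: "'a::euclidean_space itself \<Rightarrow> real" where
  "gaussian_moment2 _ = (\<integral>z. (norm z)\<^sup>2 * gauss_kernel z \<partial>(lborel :: 'a measure))"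

lemma integrable_gaussian: "integrable lborel (\<lambda>z::'a::euclidean_space. gauss_kernel z)"
  using integrable_polynomial_gaussian[of "1/2" 0, where 'a='a] by simp

lemma integrable_gaussian_moment2:
  "integrable lborel (\<lambda>z::'a::euclidean_space. (norm z)\<^sup>2 * gauss_kernel z)"
proof -
  have "integrable lborel (\<lambda>z::'a. (1 + (norm z)\<^sup>2) * gauss_kernel z - gauss_kernel z)"
    using integrable_polynomial_gaussian[of "1/2" 1, where 'a='a]
    by (intro Bochner_Integration.integrable_diff integrable_gaussian) simp
  then show ?thesis by (simp add: algebra_simps)
qed

lemma nn_integral_gaussian:
  "(\<integral>\<^sup>+z. ennreal (gauss_kernel z) \<partial>(lborel :: ('a::euclidean_space) measure)) = ennreal (gaussian_mass TYPE('a))"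
  unfolding gaussian_mass_def by (rule nn_integral_eq_integral[OF integrable_gaussian]) auto

lemma nn_integral_gaussian_moment2:
  "(\<integral>\<^sup>+z. ennreal ((norm z)\<^sup>2 * gauss_kernel z) \<partial>(lborel :: ('a::euclidean_space) measure)) = ennreal (gaussian_moment2 TYPE('a))"
  unfolding gaussian_moment2_def by (rule nn_integral_eq_integral[OF integrable_gaussian_moment2]) auto

lemma gaussian_mass_pos: "gaussian_mass TYPE('a::euclidean_space) > 0"
proof -
  have "gaussian_mass TYPE('a) \<ge> 0" unfolding gaussian_mass_def by (rule integral_nonneg_AE) auto
  moreover have "gaussian_mass TYPE('a) \<noteq> 0"
  proof
    assume "gaussian_mass TYPE('a) = 0"
    then have "(\<integral>\<^sup>+z. ennreal (gauss_kernel z) \<partial>(lborel :: 'a measure)) = 0"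
      by (subst nn_integral_gaussian) simp
    then have "AE z in (lborel :: 'a measure). False"
      by (subst (asm) nn_integral_0_iff_AE) (auto simp: ennreal_eq_0_iff not_le)
    then have "emeasure lborel (UNIV :: 'a set) = 0" by (subst (asm) AE_iff_measurable[of UNIV]) auto
    then show False by simp
  qed
  ultimately show ?thesis by linarith
qed

lemma gaussian_moment2_nonneg: "gaussian_moment2 TYPE('a::euclidean_space) \<ge> 0"
  unfolding gaussian_moment2_def by (rule integral_nonneg_AE) auto

text \<open>The cross term integrates to zero by the symmetry \<open>z \<mapsto> - z\<close>, so the parallelogram law suffices.\<close>

lemma nn_integral_gaussian_square_distance:
  fixes v :: "'a::euclidean_space"
  assumes r: "r \<ge> 0"
  shows "(\<integral>\<^sup>+z. ennreal ((norm (v - sqrt r *\<^sub>R z))\<^sup>2 * gauss_kernel z) \<partial>lborel)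
    = ennreal ((norm v)\<^sup>2 * gaussian_mass TYPE('a) + r * gaussian_moment2 TYPE('a))" (is "?A = ennreal ?X")
proof -
  have X: "?X \<ge> 0" using r gaussian_mass_pos[where 'a='a] gaussian_moment2_nonneg[where 'a='a] by simp
  let ?f = "\<lambda>z. ennreal ((norm (v - sqrt r *\<^sub>R z))\<^sup>2 * gauss_kernel z)"
  let ?h = "\<lambda>z. ennreal ((norm (v + sqrt r *\<^sub>R z))\<^sup>2 * gauss_kernel z)"
  have "?A = (\<integral>\<^sup>+z. (?h z) \<partial>lborel)"
    by (subst nn_integral_lborel_affine[of _ "-1" 0]) auto
  then have "2 * ?A = ?A + (\<integral>\<^sup>+z. (?h z) \<partial>lborel)"
    by (simp add: mult_2)
  also have "\<dots> = (\<integral>\<^sup>+z. (?f z)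
        + (?h z) \<partial>lborel)"
    by (rule nn_integral_add[symmetric]) auto
  also have "\<dots> = (\<integral>\<^sup>+z. ennreal (2 * (norm v)\<^sup>2) * ennreal (gauss_kernel z)
        + ennreal (2 * r) * ennreal ((norm z)\<^sup>2 * gauss_kernel z) \<partial>(lborel :: 'a measure))"
  proof (rule nn_integral_cong)
    fix z :: 'a
    have "(norm (v - sqrt r *\<^sub>R z))\<^sup>2 + (norm (v + sqrt r *\<^sub>R z))\<^sup>2 = 2 * (norm v)\<^sup>2 + 2 * (norm (sqrt r *\<^sub>R z))\<^sup>2"
    proof -
      have "(norm (v - u))\<^sup>2 + (norm (v + u))\<^sup>2 = 2 * (norm v)\<^sup>2 + 2 * (norm u)\<^sup>2" for u
        by (simp add: power2_norm_eq_inner algebra_simps)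
      then show ?thesis .
    qed
    also have "(norm (sqrt r *\<^sub>R z))\<^sup>2 = (sqrt r)\<^sup>2 * (norm z)\<^sup>2"
      by (simp only: norm_scaleR power_mult_distrib power2_abs)
    also have "(sqrt r)\<^sup>2 = r" using r by (rule real_sqrt_pow2)
    finally have e: "(norm (v - sqrt r *\<^sub>R z))\<^sup>2 + (norm (v + sqrt r *\<^sub>R z))\<^sup>2 = 2 * (norm v)\<^sup>2 + 2 * r * (norm z)\<^sup>2" by simp
    have "(?f z) + (?h z)
      = ennreal (((norm (v - sqrt r *\<^sub>R z))\<^sup>2 + (norm (v + sqrt r *\<^sub>R z))\<^sup>2) * gauss_kernel z)"
      by (subst ennreal_plus[symmetric]) (auto simp: distrib_right)
    also have "\<dots> = ennreal (2 * (norm v)\<^sup>2 * gauss_kernel z + 2 * r * ((norm z)\<^sup>2 * gauss_kernel z))"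
      unfolding e by (simp only: distrib_right mult.assoc)
    also have "\<dots> = ennreal (2 * (norm v)\<^sup>2 * gauss_kernel z) + ennreal (2 * r * ((norm z)\<^sup>2 * gauss_kernel z))"
      using r by (intro ennreal_plus) auto
    also have "\<dots> = ennreal (2 * (norm v)\<^sup>2) * ennreal (gauss_kernel z)
        + ennreal (2 * r) * ennreal ((norm z)\<^sup>2 * gauss_kernel z)"
      using r by (intro arg_cong2[where f="(+)"] ennreal_mult) auto
    finally show "(?f z) + (?h z) = \<dots>" .
  qed
  also have "\<dots> = ennreal (2 * (norm v)\<^sup>2) * ennreal (gaussian_mass TYPE('a)) + ennreal (2 * r) * ennreal (gaussian_moment2 TYPE('a))"
    by (simp add: nn_integral_add nn_integral_cmult nn_integral_gaussian[simplified] nn_integral_gaussian_moment2[simplified])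
  also have "\<dots> = ennreal (2 * ?X)"
  proof -
    have "ennreal (2 * p) * ennreal q + ennreal (2 * r) * ennreal s = ennreal (2 * (p * q + r * s))"
      if "0 \<le> p" "0 \<le> q" "0 \<le> s" for p q s :: real
    proof -
      have "2 * (p * q + r * s) = 2 * p * q + 2 * r * s" by (simp add: algebra_simps)
      then show ?thesis using that r by (simp add: ennreal_mult mult.assoc)
    qed
    then show ?thesis using less_imp_le[OF gaussian_mass_pos[where 'a='a]] gaussian_moment2_nonneg[where 'a='a] by simp
  qed
  also have "\<dots> = 2 * ennreal ?X" by (simp only: ennreal_mult'[OF zero_le_numeral] ennreal_numeral)
  finally show ?thesis by (simp add: ennreal_mult_cancel_left)
qed

section \<open>Gaussian mixture priors, their posterior loss and posterior mean\<close>

text \<open>Conjugacy of the normal prior with variance \<open>g\<close>: the substitution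
  \<open>\<mu> = w *\<^sub>R x + sqrt w *\<^sub>R z\<close> with \<open>w = g / (g + 1)\<close>
  turns likelihood times prior into \<open>tilt\<close> times a standard Gaussian in
  \<open>z\<close>. The power of \<open>w\<close> is the Jacobian.\<close>

lemma nn_integral_gaussian_product:
  fixes x :: "'a::euclidean_space" and f :: "'a \<Rightarrow> ennreal"
  assumes [measurable]: "f \<in> borel_measurable borel" and g: "g > 0"
  shows "(\<integral>\<^sup>+ \<mu>. f \<mu> * ennreal (gauss_kernel (x - \<mu>) * exp (- (norm \<mu>)\<^sup>2 / (2 * g))) \<partial>lborel)
    = ennreal (tilt ((norm x)\<^sup>2) g * (g / (g + 1)) powr (DIM('a) / 2)) *
       (\<integral>\<^sup>+ z. f ((g / (g + 1)) *\<^sub>R x + sqrt (g / (g + 1)) *\<^sub>R z) * ennreal (gauss_kernel z) \<partial>lborel)"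
proof -
  define w where "w = g / (g + 1)"
  have w: "w > 0" "1 / w = 1 + 1 / g" "1 - w = 1 / (g + 1)" using g by (auto simp: w_def field_simps)
  have e: "gauss_kernel (x - (w *\<^sub>R x + sqrt w *\<^sub>R z)) * exp (- (norm (w *\<^sub>R x + sqrt w *\<^sub>R z))\<^sup>2 / (2 * g))
     = tilt ((norm x)\<^sup>2) g * gauss_kernel z" for z
  proof -
    define m where "m = w *\<^sub>R x + sqrt w *\<^sub>R z"
    have sw: "sqrt w * sqrt w = w" using w by simp
    have mm: "inner m m = w * (w * inner x x + 2 * sqrt w * inner x z + inner z z)"
    proof -
      have "inner m m = w * w * inner x x + 2 * w * sqrt w * inner x z + (sqrt w * sqrt w) * inner z z"
        by (simp add: m_def algebra_simps inner_commute)
      then show ?thesis unfolding sw by (simp add: algebra_simps)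
    qed
    have xm: "inner x m = w * inner x x + sqrt w * inner x z" by (simp add: m_def algebra_simps)
    \<comment> \<open>As \<open>1 + 1 / g = 1 / w\<close>, the cross terms in \<open>x\<close> and
      \<open>z\<close> cancel.\<close>
    have "(norm (x - m))\<^sup>2 + (norm m)\<^sup>2 / g = inner x x - 2 * inner x m + inner m m * (1 / w)"
      unfolding w(2) by (simp add: power2_norm_eq_inner algebra_simps inner_commute)
    also have "\<dots> = inner x x * (1 - w) + inner z z"
      unfolding mm xm using w(1) by (simp add: field_simps)
    also have "\<dots> = (norm x)\<^sup>2 / (g + 1) + (norm z)\<^sup>2" unfolding w(3) by (simp add: power2_norm_eq_inner)
    finally have "- (norm (x - m))\<^sup>2 / 2 + - (norm m)\<^sup>2 / (2 * g) = - (norm x)\<^sup>2 / (2 * (g + 1)) + - (norm z)\<^sup>2 / 2"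
      using g by (simp add: field_simps)
    then show ?thesis unfolding m_def[symmetric] exp_add[symmetric] by simp
  qed
  have c: "\<bar>sqrt w\<bar> ^ DIM('a) = w powr (DIM('a) / 2)"
    using w(1) by (simp add: powr_half_sqrt[symmetric] powr_realpow[symmetric] powr_powr)
  have "(\<integral>\<^sup>+ \<mu>. f \<mu> * ennreal (gauss_kernel (x - \<mu>) * exp (- (norm \<mu>)\<^sup>2 / (2 * g))) \<partial>lborel)
    = ennreal (\<bar>sqrt w\<bar> ^ DIM('a)) * (\<integral>\<^sup>+ z. f (w *\<^sub>R x + sqrt w *\<^sub>R z) *
        ennreal (gauss_kernel (x - (w *\<^sub>R x + sqrt w *\<^sub>R z)) * exp (- (norm (w *\<^sub>R x + sqrt w *\<^sub>R z))\<^sup>2 / (2 * g))) \<partial>lborel)"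
    using w(1) by (intro nn_integral_lborel_affine) auto
  also have "\<dots> = ennreal (w powr (DIM('a) / 2)) * (\<integral>\<^sup>+ z. f (w *\<^sub>R x + sqrt w *\<^sub>R z) *
        ennreal (tilt ((norm x)\<^sup>2) g * gauss_kernel z) \<partial>lborel)"
    unfolding c e ..
  also have "\<dots> = ennreal (w powr (DIM('a) / 2)) * (\<integral>\<^sup>+ z. ennreal (tilt ((norm x)\<^sup>2) g) * (f (w *\<^sub>R x + sqrt w *\<^sub>R z) *
        ennreal (gauss_kernel z)) \<partial>lborel)"
  proof -
    have "f (w *\<^sub>R x + sqrt w *\<^sub>R z) * ennreal (tilt ((norm x)\<^sup>2) g * gauss_kernel z)
      = ennreal (tilt ((norm x)\<^sup>2) g) * (f (w *\<^sub>R x + sqrt w *\<^sub>R z) * ennreal (gauss_kernel z))" for z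
      by (simp only: ennreal_mult'[OF less_imp_le[OF exp_gt_zero]] mult_ac)
    then show ?thesis by (simp only:)
  qed
  also have "\<dots> = ennreal (tilt ((norm x)\<^sup>2) g * w powr (DIM('a) / 2)) *
       (\<integral>\<^sup>+ z. f (w *\<^sub>R x + sqrt w *\<^sub>R z) * ennreal (gauss_kernel z) \<partial>lborel)"
    by (subst nn_integral_cmult) (auto simp: ennreal_mult mult_ac)
  finally show ?thesis by (simp add: w_def)
qed

text \<open>The weight is a parameter so that the Bayes computations are done once: the constant 1
  gives the prior of the theorem, the squared cutoff gives the approximating priors. Values are in
  \<open>ennreal\<close> because the density may be infinite at the origin.\<close>

definition weighted_prior :: "real \<Rightarrow> real \<Rightarrow> real \<Rightarrow> (real \<Rightarrow> real) \<Rightarrow> real ^ 'n \<Rightarrow> ennreal" where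
  "weighted_prior a b c W \<mu> =
     (\<integral>\<^sup>+ g. ennreal (indicator {0<..} g * (g powr (- real CARD('n) / 2) * exp (- (norm \<mu>)\<^sup>2 / (2 * g))
        * mixing_density a b c g)) * ennreal (W g) \<partial>lborel)"

lemma weighted_prior_one: "weighted_prior a b c (\<lambda>_. 1) = prior_density a b c"
  unfolding weighted_prior_def prior_density_def
  by (intro ext nn_integral_cong) (auto simp: indicator_def)

lemma weighted_prior_measurable [measurable]:
  assumes [measurable]: "W \<in> borel_measurable borel"
  shows "weighted_prior a b c W \<in> borel_measurable borel"
proof -
  have "(\<lambda>\<mu>::real^'n. \<integral>\<^sup>+ g. ennreal (indicator {0<..} g * (g powr (- real CARD('n) / 2) * exp (- (norm \<mu>)\<^sup>2 / (2 * g))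
        * mixing_density a b c g)) * ennreal (W g) \<partial>lborel) \<in> borel_measurable borel"
    by measurable
  then show ?thesis unfolding weighted_prior_def[abs_def] .
qed

text \<open>Tonelli exchanges the mixture with the integral over the parameter, and conjugacy
  evaluates the inner integral. With nonnegative \<open>f\<close> no integrability has to be known
  in advance.\<close>

lemma nn_integral_weighted_prior:
  fixes x :: "real ^ 'n" and f :: "real ^ 'n \<Rightarrow> ennreal"
  assumes f[measurable]: "f \<in> borel_measurable borel" and [measurable]: "W \<in> borel_measurable borel"
  shows "(\<integral>\<^sup>+ \<mu>. weighted_prior a b c W \<mu> * (f \<mu> * ennreal (gauss_kernel (x - \<mu>))) \<partial>lborel)
    = (\<integral>\<^sup>+ g. ennreal (W g) * (\<integral>\<^sup>+ z. f ((g / (g + 1)) *\<^sub>R x + sqrt (g / (g + 1)) *\<^sub>R z)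
          * ennreal (gauss_kernel z) \<partial>lborel) \<partial>mixing_measure (a - real CARD('n) / 2) b c ((norm x)\<^sup>2))"
proof -
  define k where "k g = indicator {0<..} g * (g powr (- real CARD('n) / 2) * mixing_density a b c g)" for g :: real
  have [measurable]: "k \<in> borel_measurable borel" unfolding k_def[abs_def] by measurable
  have k0: "k g \<ge> 0" for g by (simp add: k_def)
  let ?F = "\<lambda>g \<mu>. ennreal (W g) * ennreal (k g) * (f \<mu> * ennreal (gauss_kernel (x - \<mu>) * exp (- (norm \<mu>)\<^sup>2 / (2 * g))))"
  let ?J = "\<lambda>g. (\<integral>\<^sup>+ z. f ((g / (g + 1)) *\<^sub>R x + sqrt (g / (g + 1)) *\<^sub>R z) * ennreal (gauss_kernel z) \<partial>lborel)"
  have "(\<integral>\<^sup>+ \<mu>. weighted_prior a b c W \<mu> * (f \<mu> * ennreal (gauss_kernel (x - \<mu>))) \<partial>lborel)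
    = (\<integral>\<^sup>+ \<mu>. (\<integral>\<^sup>+ g. (?F g \<mu>) \<partial>lborel) \<partial>lborel)"
  proof (rule nn_integral_cong)
    fix \<mu> :: "real ^ 'n"
    have "ennreal (indicator {0<..} g * (g powr (- real CARD('n) / 2) * exp (- (norm \<mu>)\<^sup>2 / (2 * g))
        * mixing_density a b c g)) = ennreal (k g) * ennreal (exp (- (norm \<mu>)\<^sup>2 / (2 * g)))" for g
      unfolding k_def by (subst ennreal_mult[symmetric]) (auto simp: mult_ac)
    then show "weighted_prior a b c W \<mu> * (f \<mu> * ennreal (gauss_kernel (x - \<mu>)))
      = (\<integral>\<^sup>+ g. (?F g \<mu>) \<partial>lborel)"
      unfolding weighted_prior_def
      by (subst nn_integral_multc[symmetric]) (auto simp: ennreal_mult mult_ac intro!: nn_integral_cong)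
  qed
  also have "\<dots> = (\<integral>\<^sup>+ g. (\<integral>\<^sup>+ \<mu>. (?F g \<mu>) \<partial>lborel) \<partial>lborel)"
    by (rule lborel_pair.Fubini') measurable
  also have "\<dots> = (\<integral>\<^sup>+ g. ennreal (mixing_kernel (a - real CARD('n) / 2) b c ((norm x)\<^sup>2) g)
      * (ennreal (W g) * (?J g)) \<partial>lborel)"
  proof (rule nn_integral_cong)
    fix g :: real
    define J where "J = (?J g)"
    show "(\<integral>\<^sup>+ \<mu>. (?F g \<mu>) \<partial>lborel)
      = ennreal (mixing_kernel (a - real CARD('n) / 2) b c ((norm x)\<^sup>2) g)
      * (ennreal (W g) * (?J g))"
    proof (cases "g > 0")
      case True
      have q: "k g * (tilt ((norm x)\<^sup>2) g * (g / (g + 1)) powr (DIM(real ^ 'n) / 2))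
         = tilt ((norm x)\<^sup>2) g * mixing_density (a - real CARD('n) / 2) b c g"
      proof -
        \<comment> \<open>The prior normalisation and the Jacobian combine to
          \<open>(g + 1) powr (- d / 2)\<close>, which is the origin of the parameter
          \<open>a - d / 2\<close>.\<close>
        have "g powr (- real CARD('n) / 2) * (g / (g + 1)) powr (real CARD('n) / 2) = (g + 1) powr (- real CARD('n) / 2)"
          using True by (simp add: powr_divide powr_minus field_simps)
        then have "g powr (- real CARD('n) / 2) * mixing_density a b c g * (g / (g + 1)) powr (real CARD('n) / 2)
           = (g + 1) powr (- real CARD('n) / 2) * mixing_density a b c g" by (simp add: mult_ac)
        also have "\<dots> = mixing_density (a - real CARD('n) / 2) b c g"
          using powr_mult_mixing_density[of g "- real CARD('n) / 2"] by simp
        finally show ?thesis using True by (simp add: k_def mult_ac)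
      qed
      have "(\<integral>\<^sup>+ \<mu>. (?F g \<mu>) \<partial>lborel)
        = ennreal (W g) * ennreal (k g) * (ennreal (tilt ((norm x)\<^sup>2) g * (g / (g + 1)) powr (DIM(real ^ 'n) / 2)) * J)"
        unfolding J_def nn_integral_gaussian_product[OF f True, symmetric]
        by (rule nn_integral_cmult) measurable
      also have "\<dots> = ennreal (k g * (tilt ((norm x)\<^sup>2) g * (g / (g + 1)) powr (DIM(real ^ 'n) / 2))) * (ennreal (W g) * J)"
        by (simp only: ennreal_mult'[OF k0] mult_ac)
      finally show ?thesis unfolding q using True by (simp add: J_def)
    qed (simp add: k_def)
  qed
  also have "\<dots> = (\<integral>\<^sup>+ g. ennreal (W g) * (?J g) \<partial>mixing_measure (a - real CARD('n) / 2) b c ((norm x)\<^sup>2))"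
    by (subst nn_integral_mixing_measure) auto
  finally show ?thesis .
qed

lemma nn_integral_weighted_prior_mass:
  fixes x :: "real ^ 'n"
  assumes [measurable]: "W \<in> borel_measurable borel"
  shows "(\<integral>\<^sup>+ \<mu>. weighted_prior a b c W \<mu> * ennreal (gauss_kernel (x - \<mu>)) \<partial>lborel)
    = ennreal (gaussian_mass TYPE(real ^ 'n)) *
      (\<integral>\<^sup>+ g. ennreal (W g) \<partial>mixing_measure (a - real CARD('n) / 2) b c ((norm x)\<^sup>2))"
  using nn_integral_weighted_prior[of "\<lambda>_. 1" W a b c x]
  by (simp add: nn_integral_gaussian[simplified] nn_integral_cmult mult.commute)

lemma nn_integral_weighted_prior_loss:
  fixes x \<eta> :: "real ^ 'n"
  assumes [measurable]: "W \<in> borel_measurable borel"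
  shows "(\<integral>\<^sup>+ \<mu>. weighted_prior a b c W \<mu> * ennreal ((norm (\<eta> - \<mu>))\<^sup>2 * gauss_kernel (x - \<mu>)) \<partial>lborel)
    = (\<integral>\<^sup>+ g. ennreal (W g) * ennreal (loss_kernel (gaussian_mass TYPE(real ^ 'n)) (gaussian_moment2 TYPE(real ^ 'n)) \<eta> x g) \<partial>mixing_measure (a - real CARD('n) / 2) b c ((norm x)\<^sup>2))"
proof -
  let ?J = "\<lambda>g. (\<integral>\<^sup>+ z. ennreal ((norm (\<eta> - ((g / (g + 1)) *\<^sub>R x + sqrt (g / (g + 1)) *\<^sub>R z)))\<^sup>2) * ennreal (gauss_kernel z) \<partial>lborel)"
  have "(\<integral>\<^sup>+ \<mu>. weighted_prior a b c W \<mu> * ennreal ((norm (\<eta> - \<mu>))\<^sup>2 * gauss_kernel (x - \<mu>)) \<partial>lborel)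
    = (\<integral>\<^sup>+ \<mu>. weighted_prior a b c W \<mu> * (ennreal ((norm (\<eta> - \<mu>))\<^sup>2) * ennreal (gauss_kernel (x - \<mu>))) \<partial>lborel)"
    by (simp add: ennreal_mult)
  also have "\<dots> = (\<integral>\<^sup>+ g. ennreal (W g) * (?J g) \<partial>mixing_measure (a - real CARD('n) / 2) b c ((norm x)\<^sup>2))"
    by (rule nn_integral_weighted_prior) auto
  also have "\<dots> = (\<integral>\<^sup>+ g. ennreal (W g) * ennreal (loss_kernel (gaussian_mass TYPE(real ^ 'n)) (gaussian_moment2 TYPE(real ^ 'n)) \<eta> x g) \<partial>mixing_measure (a - real CARD('n) / 2) b c ((norm x)\<^sup>2))"
  proof (rule nn_integral_cong_AE, use AE_mixing_measure in eventually_elim)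
    fix g :: real assume g: "0 < g"
    have "(?J g)
       = (\<integral>\<^sup>+ z. ennreal ((norm ((\<eta> - (g / (g + 1)) *\<^sub>R x) - sqrt (g / (g + 1)) *\<^sub>R z))\<^sup>2
          * gauss_kernel z) \<partial>lborel)"
      by (simp only: ennreal_mult[OF zero_le_power2 less_imp_le[OF exp_gt_zero]] diff_diff_add)
    also have "\<dots> = ennreal (loss_kernel (gaussian_mass TYPE(real ^ 'n)) (gaussian_moment2 TYPE(real ^ 'n)) \<eta> x g)"
      using g by (intro nn_integral_gaussian_square_distance) auto
    finally show "ennreal (W g) * (?J g) = ennreal (W g) * \<dots>" by simp
  qed
  finally show ?thesis .
qed

lemma integral_posterior_weight:
  assumes "b > -1" "a < -1"
  shows "integrable (mixing_measure a b c t) (\<lambda>g. g / (g + 1))"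
    and "(\<integral>g. g / (g + 1) \<partial>mixing_measure a b c t) = mixing_mass a b c t - mixing_mass (a - 1) b c t"
proof -
  interpret finite_measure "mixing_measure a b c t" by (rule finite_mixing_measure) fact+
  have ae: "AE g in mixing_measure a b c t. 1 - 1 / (g + 1) = g / (g + 1)"
    by (rule eventually_mono[OF AE_mixing_measure]) (simp add: field_simps)
  have i: "integrable (mixing_measure a b c t) (\<lambda>g. 1 - 1 / (g + 1))"
    by (intro Bochner_Integration.integrable_diff integrable_const mixing_mass_minus_one(2)) fact+
  then show "integrable (mixing_measure a b c t) (\<lambda>g. g / (g + 1))"
    by (subst (asm) integrable_cong_AE[OF _ _ ae]) auto
  have "(\<integral>g. g / (g + 1) \<partial>mixing_measure a b c t) = (\<integral>g. 1 - 1 / (g + 1) \<partial>mixing_measure a b c t)"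
    by (rule integral_cong_AE[OF _ _ ae, symmetric]) auto
  also have "\<dots> = mixing_mass a b c t - mixing_mass (a - 1) b c t"
    using assms by (subst Bochner_Integration.integral_diff[OF integrable_const mixing_mass_minus_one(2)])
      (auto simp: mixing_mass_minus_one(1) mixing_mass_def[of a])
  finally show "(\<integral>g. g / (g + 1) \<partial>mixing_measure a b c t) = mixing_mass a b c t - mixing_mass (a - 1) b c t" .
qed

text \<open>The numerator is a vector-valued integral, to which the formulas for nonnegative
  integrands do not apply directly. The posterior loss \<open>Q \<eta>\<close> is nonnegative and
  computable, and polarisation recovers the numerator \<open>V\<close> from it:
  \<open>Q \<eta> - Q (- \<eta>)\<close> is \<open>-4\<close> times the inner product of \<eta> and
  \<open>V\<close>.\<close>

lemma generalized_bayes_prior_density: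
  fixes x :: "real ^ 'n" and a b c :: real
  defines "A \<equiv> a - real CARD('n) / 2"
  assumes a: "a < real CARD('n) / 2 - 1" and b: "b > -1"
  shows "generalized_bayes (prior_density a b c) x =
    (1 - mixing_mass (A - 1) b c ((norm x)\<^sup>2) / mixing_mass A b c ((norm x)\<^sup>2)) *\<^sub>R x"
proof -
  have A: "A < -1" using a by (simp add: A_def)
  define N where "N = mixing_measure A b c ((norm x)\<^sup>2)"
  define p where "p = (prior_density a b c :: real ^ 'n \<Rightarrow> ennreal)"
  define M where "M = density lborel p"
  define e where "e \<mu> = gauss_kernel (x - \<mu>)" for \<mu>
  define G0 where "G0 = gaussian_mass TYPE(real ^ 'n)"
  define G2 where "G2 = gaussian_moment2 TYPE(real ^ 'n)"
  define m where "m = mixing_mass A b c ((norm x)\<^sup>2)"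
  define I1 where "I1 = (\<integral>g. g / (g + 1) \<partial>N)"
  define I2 where "I2 = (\<integral>g. (g / (g + 1))\<^sup>2 \<partial>N)"
  have G: "G0 > 0" "G2 \<ge> 0" unfolding G0_def G2_def by (rule gaussian_mass_pos gaussian_moment2_nonneg)+
  have m: "m > 0" unfolding m_def using A b by (rule mixing_mass_pos)
  interpret N: finite_measure N unfolding N_def using A b by (rule finite_mixing_measure)
  have N[measurable_cong]: "sets N = sets borel" by (simp add: N_def)
  have aeN: "AE g in N. g > 0" unfolding N_def by (rule AE_mixing_measure)
  have p: "p = weighted_prior a b c (\<lambda>_. 1)" by (simp add: p_def weighted_prior_one)
  have pm[measurable]: "p \<in> borel_measurable borel" unfolding p by measurable
  have sM[measurable_cong]: "sets M = sets borel" by (simp add: M_def)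
  have em[measurable]: "e \<in> borel_measurable borel" unfolding e_def[abs_def] by measurable
  have e0: "e \<mu> \<ge> 0" for \<mu> by (simp add: e_def)
  have iI1: "integrable N (\<lambda>g. g / (g + 1))" unfolding N_def using b A by (rule integral_posterior_weight)
  have iI2: "integrable N (\<lambda>g. (g / (g + 1))\<^sup>2)"
    by (rule Bochner_Integration.integrable_bound[OF N.integrable_const[of "1 :: real"]])
      (auto intro!: eventually_mono[OF aeN] simp: power_le_one)
  have mN: "(\<integral>g. 1 \<partial>N) = m" by (simp add: N_def m_def mixing_mass_def)
  have int1: "has_bochner_integral M e (G0 * m)"
  proof (rule has_bochner_integral_nn_integral)
    have "(\<integral>\<^sup>+ \<mu>. ennreal (e \<mu>) \<partial>M) = (\<integral>\<^sup>+ \<mu>. p \<mu> * ennreal (e \<mu>) \<partial>lborel)"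
      unfolding M_def by (subst nn_integral_density) auto
    also have "\<dots> = ennreal G0 * emeasure N UNIV"
      unfolding p e_def G0_def N_def A_def by (subst nn_integral_weighted_prior_mass) auto
    also have "emeasure N UNIV = ennreal m" unfolding N_def m_def using A b by (rule emeasure_mixing_measure_eq)
    finally show "(\<integral>\<^sup>+ \<mu>. ennreal (e \<mu>) \<partial>M) = ennreal (G0 * m)" using G m by (simp add: ennreal_mult)
  qed (use G m e0 in auto)
  define Q where "Q \<eta> = G0 * ((norm \<eta>)\<^sup>2 * m - 2 * inner \<eta> x * I1 + (norm x)\<^sup>2 * I2) + G2 * I1" for \<eta>
  have int2: "has_bochner_integral M (\<lambda>\<mu>. (norm (\<eta> - \<mu>))\<^sup>2 * e \<mu>) (Q \<eta>)" for \<eta>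
  proof -
    let ?f = "\<lambda>g. loss_kernel G0 G2 \<eta> x g"
    have fe: "?f g = G0 * (norm \<eta>)\<^sup>2 - 2 * G0 * inner \<eta> x * (g / (g + 1)) + G0 * (norm x)\<^sup>2 * (g / (g + 1))\<^sup>2 + G2 * (g / (g + 1))" for g
    proof -
      have "(norm (\<eta> - w *\<^sub>R x))\<^sup>2 = (norm \<eta>)\<^sup>2 - 2 * inner \<eta> x * w + (norm x)\<^sup>2 * w\<^sup>2" for w
        unfolding power2_norm_eq_inner by (simp add: algebra_simps inner_commute power2_eq_square)
      note sq = this[of "g / (g + 1)"]
      show ?thesis unfolding sq by (simp only: algebra_simps)
    qed
    have f0: "AE g in N. 0 \<le> ?f g" using aeN by eventually_elim (use G in auto)
    have "has_bochner_integral N (\<lambda>g. G0 * (norm \<eta>)\<^sup>2 - 2 * G0 * inner \<eta> x * (g / (g + 1)) + G0 * (norm x)\<^sup>2 * (g / (g + 1))\<^sup>2 + G2 * (g / (g + 1)))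
       (G0 * (norm \<eta>)\<^sup>2 * m - 2 * G0 * inner \<eta> x * I1 + G0 * (norm x)\<^sup>2 * I2 + G2 * I1)"
    proof (intro has_bochner_integral_add has_bochner_integral_diff has_bochner_integral_mult_right)
      have "has_bochner_integral N (\<lambda>g. G0 * (norm \<eta>)\<^sup>2 * 1) (G0 * (norm \<eta>)\<^sup>2 * m)"
        unfolding mN[symmetric] by (intro has_bochner_integral_mult_right has_bochner_integral_integrable N.integrable_const)
      then show "has_bochner_integral N (\<lambda>g. G0 * (norm \<eta>)\<^sup>2) (G0 * (norm \<eta>)\<^sup>2 * m)" by simp
    qed (unfold I1_def I2_def, auto intro!: has_bochner_integral_integrable iI1 iI2)
    also have "(G0 * (norm \<eta>)\<^sup>2 * m - 2 * G0 * inner \<eta> x * I1 + G0 * (norm x)\<^sup>2 * I2 + G2 * I1) = Q \<eta>"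
      by (simp add: Q_def algebra_simps)
    finally have hb: "has_bochner_integral N ?f (Q \<eta>)" unfolding fe .
    have fi: "integrable N ?f" "integral\<^sup>L N ?f = Q \<eta>"
      using hb unfolding has_bochner_integral_iff by blast+
    have Q0: "Q \<eta> \<ge> 0" unfolding fi(2)[symmetric] using f0 by (rule integral_nonneg_AE)
    have nnN: "(\<integral>\<^sup>+ g. ennreal (?f g) \<partial>N) = ennreal (Q \<eta>)"
      unfolding fi(2)[symmetric] using fi(1) f0 by (rule nn_integral_eq_integral)
    show ?thesis
    proof (rule has_bochner_integral_nn_integral)
      have "(\<integral>\<^sup>+ \<mu>. ennreal ((norm (\<eta> - \<mu>))\<^sup>2 * e \<mu>) \<partial>M) = (\<integral>\<^sup>+ \<mu>. p \<mu> * ennreal ((norm (\<eta> - \<mu>))\<^sup>2 * e \<mu>) \<partial>lborel)"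
        unfolding M_def by (subst nn_integral_density) auto
      also have "\<dots> = (\<integral>\<^sup>+ g. ennreal (?f g) \<partial>N)"
        unfolding p e_def G0_def G2_def N_def A_def by (subst nn_integral_weighted_prior_loss) auto
      finally show "(\<integral>\<^sup>+ \<mu>. ennreal ((norm (\<eta> - \<mu>))\<^sup>2 * e \<mu>) \<partial>M) = ennreal (Q \<eta>)" unfolding nnN .
    qed (use Q0 e0 in auto)
  qed
  \<comment> \<open>The integrand is dominated by the sum of the weight and the loss integrand at
    \<open>\<eta> = 0\<close>, because a norm is at most one plus its square.\<close>
  have iV: "integrable M (\<lambda>\<mu>. e \<mu> *\<^sub>R \<mu>)"
  proof (rule Bochner_Integration.integrable_bound)
    show "integrable M (\<lambda>\<mu>. e \<mu> + (norm (0 - \<mu>))\<^sup>2 * e \<mu>)"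
      using int1 int2[of 0] by (auto simp: has_bochner_integral_iff)
    show "AE \<mu> in M. norm (e \<mu> *\<^sub>R \<mu>) \<le> norm (e \<mu> + (norm (0 - \<mu>))\<^sup>2 * e \<mu>)"
    proof (rule AE_I2)
      fix \<mu> :: "real ^ 'n"
      have "2 * norm \<mu> * 1 \<le> (norm \<mu>)\<^sup>2 + 1\<^sup>2" by (rule sum_squares_bound)
      then have "norm \<mu> \<le> 1 + (norm \<mu>)\<^sup>2" using zero_le_power2[of "norm \<mu>"] unfolding power_one by linarith
      then have "e \<mu> * norm \<mu> \<le> e \<mu> * (1 + (norm \<mu>)\<^sup>2)" using e0 by (rule mult_left_mono)
      then show "norm (e \<mu> *\<^sub>R \<mu>) \<le> norm (e \<mu> + (norm (0 - \<mu>))\<^sup>2 * e \<mu>)"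
        using e0[of \<mu>] by (simp add: algebra_simps)
    qed
  qed auto
  define V where "V = (\<integral>\<mu>. e \<mu> *\<^sub>R \<mu> \<partial>M)"
  have "inner \<eta> V = inner \<eta> ((G0 * I1) *\<^sub>R x)" for \<eta>
  proof -
    have h1: "has_bochner_integral M (\<lambda>\<mu>. (norm (\<eta> - \<mu>))\<^sup>2 * e \<mu> - (norm (- \<eta> - \<mu>))\<^sup>2 * e \<mu>) (Q \<eta> - Q (- \<eta>))"
      by (intro has_bochner_integral_diff int2)
    have eq: "(norm (\<eta> - \<mu>))\<^sup>2 * e \<mu> - (norm (- \<eta> - \<mu>))\<^sup>2 * e \<mu> = -4 * inner \<eta> (e \<mu> *\<^sub>R \<mu>)" for \<mu>
      by (simp add: power2_norm_eq_inner algebra_simps inner_commute)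
    have h2: "has_bochner_integral M (\<lambda>\<mu>. -4 * inner \<eta> (e \<mu> *\<^sub>R \<mu>)) (-4 * inner \<eta> V)"
      unfolding V_def by (intro has_bochner_integral_mult_right has_bochner_integral_inner_right has_bochner_integral_integrable iV)
    have "Q \<eta> - Q (- \<eta>) = -4 * inner \<eta> V"
      using h1 h2 unfolding eq by (rule has_bochner_integral_eq)
    moreover have "Q \<eta> - Q (- \<eta>) = -4 * inner \<eta> ((G0 * I1) *\<^sub>R x)"
      by (simp add: Q_def algebra_simps)
    ultimately show ?thesis by simp
  qed
  then have V: "V = (G0 * I1) *\<^sub>R x" 
    by - (rule vector_eq_ldot[THEN iffD1], rule allI)
  define \<kappa> where "\<kappa> = (2 * pi) powr (- real CARD('n) / 2)"
  have \<kappa>: "\<kappa> > 0" by (simp add: \<kappa>_def)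
  have ge: "gauss_density (x - \<mu>) = \<kappa> * e \<mu>" for \<mu> by (simp add: gauss_density_def \<kappa>_def e_def)
  have d1: "(\<integral>\<mu>. gauss_density (x - \<mu>) \<partial>M) = \<kappa> * (G0 * m)"
    unfolding ge using int1 by (simp add: has_bochner_integral_iff)
  have d2: "(\<integral>\<mu>. gauss_density (x - \<mu>) *\<^sub>R \<mu> \<partial>M) = \<kappa> *\<^sub>R V"
    unfolding ge V_def scaleR_scaleR[symmetric] by (rule integral_scaleR_right)
  have "inverse (\<kappa> * (G0 * m)) * (\<kappa> * (G0 * I1)) = I1 / m"
    using \<kappa> G m by (simp add: field_simps)
  then have sc: "inverse (\<kappa> * (G0 * m)) *\<^sub>R \<kappa> *\<^sub>R (G0 * I1) *\<^sub>R x = (I1 / m) *\<^sub>R x"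
    by (metis scaleR_scaleR)
  have "generalized_bayes p x = (\<integral>\<mu>. gauss_density (x - \<mu>) *\<^sub>R \<mu> \<partial>M) /\<^sub>R (\<integral>\<mu>. gauss_density (x - \<mu>) \<partial>M)"
    unfolding M_def by (rule generalized_bayes_def)
  also have "\<dots> = (I1 / m) *\<^sub>R x"
    unfolding d1 d2 V by (rule sc)
  also have "I1 = m - mixing_mass (A - 1) b c ((norm x)\<^sup>2)"
    unfolding I1_def m_def N_def using b A by (rule integral_posterior_weight)
  finally have "generalized_bayes p x = ((m - mixing_mass (A - 1) b c ((norm x)\<^sup>2)) / m) *\<^sub>R x" .
  moreover have "(m - mixing_mass (A - 1) b c ((norm x)\<^sup>2)) / m = 1 - mixing_mass (A - 1) b c ((norm x)\<^sup>2) / m"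
    using m by (simp add: diff_divide_distrib)
  ultimately show ?thesis by (simp only: p_def m_def)
qed

lemma gderiv_norm_square: "GDERIV (\<lambda>y. (norm y)\<^sup>2) x :> 2 *\<^sub>R x"
  unfolding gderiv_def power2_norm_eq_inner
  by (auto intro!: derivative_eq_intros simp: inner_commute)

text \<open>The factor 1/2 in the derivative of the mass cancels the 2 in the gradient of the
  squared norm.\<close>

lemma gderiv_ln_mixing_mass:
  assumes "a < -1" "b > -1"
  shows "GDERIV (\<lambda>y. ln (mixing_mass a b c ((norm y)\<^sup>2))) x :>
    (- mixing_mass (a - 1) b c ((norm x)\<^sup>2) / mixing_mass a b c ((norm x)\<^sup>2)) *\<^sub>R x"
proof -
  let ?m = "mixing_mass a b c ((norm x)\<^sup>2)" and ?m1 = "mixing_mass (a - 1) b c ((norm x)\<^sup>2)"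
  have "((\<lambda>t. ln (mixing_mass a b c t)) has_real_derivative (- ?m1 / 2) / ?m) (at ((norm x)\<^sup>2))"
    using mixing_mass_has_derivative[OF assms, of c "(norm x)\<^sup>2"] mixing_mass_pos[OF assms, of c "(norm x)\<^sup>2"]
    by (auto intro!: derivative_eq_intros)
  from GDERIV_DERIV_compose[OF gderiv_norm_square this]
  show ?thesis by (rule GDERIV_subst) simp
qed

section \<open>Equivalence of the two integral conditions\<close>

lemma half_powr_bounds:
  fixes r e :: real
  assumes "1 / 2 \<le> r" "r \<le> 1"
  shows "2 powr - \<bar>e\<bar> \<le> r powr e" "r powr e \<le> 2 powr \<bar>e\<bar>"
proof -
  have h: "(1/2) powr e = 2 powr - e" for e :: real by (simp add: powr_minus powr_divide inverse_eq_divide)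
  have "2 powr - \<bar>e\<bar> \<le> r powr e \<and> r powr e \<le> 2 powr \<bar>e\<bar>"
  proof (cases "e \<ge> 0")
    case True
    have "(1/2) powr e \<le> r powr e" using True assms by (intro powr_mono2) auto
    moreover have "r powr e \<le> 1" using True assms by (intro powr_le1) auto
    moreover have "1 \<le> 2 powr \<bar>e\<bar>" by (rule ge_one_powr_ge_zero) auto
    ultimately show ?thesis using True by (auto simp: h)
  next
    case False
    have "r powr e \<le> (1/2) powr e" using False assms by (intro powr_mono2') auto
    moreover have "1 powr e \<le> r powr e" using False assms by (intro powr_mono2') auto
    moreover have "2 powr - \<bar>e\<bar> \<le> 2 powr 0" by (intro powr_mono) auto
    ultimately show ?thesis using False by (auto simp: h)
  qed
  then show "2 powr - \<bar>e\<bar> \<le> r powr e" "r powr e \<le> 2 powr \<bar>e\<bar>" by auto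
qed

text \<open>By the two-sided bounds the mass at \<open>g\<close> has order
  \<open>(g + 1) powr (a - D + 1)\<close> times the logarithm. Multiplied by
  \<open>g powr D\<close>, this differs from \<open>g * mixing_density a b c g\<close> only by a
  power of \<open>g / (g + 1)\<close>, which lies between 1/2 and 1 for
  \<open>g \<ge> 1\<close>.\<close>

lemma mixing_density_marginal_comparable:
  fixes a b c D :: real
  assumes "a - D < -1" "b > -1"
  obtains C where "C > 0"
    "\<And>g. g \<ge> 1 \<Longrightarrow> 1 / (g * mixing_density a b c g) \<le> C * (1 / (g powr D * mixing_mass (a - D) b c g))"
    "\<And>g. g \<ge> 1 \<Longrightarrow> 1 / (g powr D * mixing_mass (a - D) b c g) \<le> C * (1 / (g * mixing_density a b c g))"
proof -
  obtain C1 where C1: "C1 > 0" "\<And>t. 0 \<le> t \<Longrightarrow>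
    C1 * ((t + 1) powr (a - D + 1) * slow_log t powr c) \<le> mixing_mass (a - D) b c t"
    using mixing_mass_ge[OF assms] by metis
  obtain C2 where C2: "C2 > 0" "\<And>t. 0 \<le> t \<Longrightarrow>
    mixing_mass (a - D) b c t \<le> C2 * ((t + 1) powr (a - D + 1) * slow_log t powr c)"
    using mixing_mass_le[OF assms] by metis
  \<comment> \<open>The exponent for which \<open>g powr D * s = (g / (g + 1)) powr e * (g *
    mixing_density a b c g)\<close> is an identity, with \<open>s\<close> as defined below.\<close>
  define e where "e = D - b - 1"
  define C where "C = max (C2 * 2 powr \<bar>e\<bar>) (2 powr \<bar>e\<bar> / C1)"
  have C: "C > 0" using C2(1) by (simp add: C_def less_max_iff_disj)
  have main: "1 / (g * mixing_density a b c g) \<le> C * (1 / (g powr D * mixing_mass (a - D) b c g))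
     \<and> 1 / (g powr D * mixing_mass (a - D) b c g) \<le> C * (1 / (g * mixing_density a b c g))" if g: "g \<ge> 1" for g
  proof -
    define r where "r = (g / (g + 1)) powr e"
    define u where "u = g * mixing_density a b c g"
    define v where "v = g powr D * mixing_mass (a - D) b c g"
    define s where "s = (g + 1) powr (a - D + 1) * slow_log g powr c"
    have u: "u > 0" using g mixing_density_pos[of g a b c] by (simp add: u_def)
    have v: "v > 0" using g mixing_mass_pos[OF assms, of c g] by (simp add: v_def)
    have r: "2 powr - \<bar>e\<bar> \<le> r" "r \<le> 2 powr \<bar>e\<bar>"
      unfolding r_def using g by (auto intro!: half_powr_bounds simp: field_simps)
    have su: "g powr D * s = r * u"
    proof -
      have gp: "g powr D = g powr e * g powr b * g" "(g + 1) powr (a - D + 1) * ((g + 1) powr e * (g + 1) powr b) = (g + 1) powr a"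
        using g by (auto simp: e_def simp flip: powr_add) (simp add: powr_add powr_diff)
      have "r * u = g powr e / (g + 1) powr e * (g * ((g + 1) powr a * (g powr b / (g + 1) powr b) * slow_log g powr c))"
        by (simp add: r_def u_def mixing_density_def powr_divide)
      also have "\<dots> = g powr D * s"
        unfolding gp(1) s_def gp(2)[symmetric] using g by (simp add: field_simps)
      finally show ?thesis ..
    qed
    have "C1 * (r * u) \<le> v"
      unfolding su[symmetric] v_def using mult_left_mono[OF C1(2)[of g], of "g powr D"] g by (simp add: s_def mult_ac)
    moreover have "C1 * (2 powr - \<bar>e\<bar> * u) \<le> C1 * (r * u)" using r u C1(1) by (intro mult_left_mono mult_right_mono) auto
    ultimately have lo: "C1 * 2 powr - \<bar>e\<bar> * u \<le> v" by simp
    have "v \<le> C2 * (r * u)"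
      unfolding su[symmetric] v_def using mult_left_mono[OF C2(2)[of g], of "g powr D"] g by (simp add: s_def mult_ac)
    moreover have "C2 * (r * u) \<le> C2 * (2 powr \<bar>e\<bar> * u)" using r u C2(1) by (intro mult_left_mono mult_right_mono) auto
    ultimately have "v \<le> C2 * 2 powr \<bar>e\<bar> * u" by simp
    also have "C2 * 2 powr \<bar>e\<bar> * u \<le> C * u" using u by (intro mult_right_mono) (auto simp: C_def)
    finally have 1: "1 / u \<le> C * (1 / v)" using u v C by (simp add: field_simps)
    have "u \<le> 2 powr \<bar>e\<bar> / C1 * v" using lo C1(1) by (simp add: powr_minus field_simps)
    also have "\<dots> \<le> C * v" using v by (intro mult_right_mono) (auto simp: C_def)
    finally have 2: "1 / v \<le> C * (1 / u)" using u v by (simp add: field_simps)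
    show ?thesis using 1 2 by (simp add: u_def v_def)
  qed
  show ?thesis using C main by (intro that[of C]) blast+
qed

lemma nn_integral_finite_if_dominated:
  fixes f h :: "real \<Rightarrow> real"
  assumes [measurable]: "f \<in> borel_measurable borel" and C: "C > 0"
    and le: "\<And>g. g \<ge> 1 \<Longrightarrow> h g \<le> C * f g"
    and fin: "(\<integral>\<^sup>+ g\<in>{1..}. ennreal (f g) \<partial>lborel) < \<infinity>"
  shows "(\<integral>\<^sup>+ g\<in>{1..}. ennreal (h g) \<partial>lborel) < \<infinity>"
proof -
  have "(\<integral>\<^sup>+ g\<in>{1..}. ennreal (h g) \<partial>lborel) \<le> (\<integral>\<^sup>+ g. ennreal C * (ennreal (f g) * indicator {1..} g) \<partial>lborel)"
    using le C by (intro nn_integral_mono) (auto simp: indicator_def ennreal_mult'[symmetric] intro!: ennreal_leI)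
  also have "\<dots> = ennreal C * (\<integral>\<^sup>+ g\<in>{1..}. ennreal (f g) \<partial>lborel)"
    by (rule nn_integral_cmult) measurable
  also have "\<dots> < \<infinity>" using fin by (simp add: ennreal_mult_less_top)
  finally show ?thesis .
qed

lemma mixing_integral_finite_iff_marginal:
  fixes a b c D :: real
  assumes "a - D < -1" "b > -1"
  shows "(\<integral>\<^sup>+ g\<in>{1..}. ennreal (1 / (g * mixing_density a b c g)) \<partial>lborel) < \<infinity> \<longleftrightarrow>
    (\<integral>\<^sup>+ t\<in>{1..}. ennreal (1 / (t powr D * mixing_mass (a - D) b c t)) \<partial>lborel) < \<infinity>"
proof -
  have [measurable]: "mixing_mass (a - D) b c \<in> borel_measurable borel"
    using assms by (rule mixing_mass_measurable)
  obtain C where C: "C > 0"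
    "\<And>g. g \<ge> 1 \<Longrightarrow> 1 / (g * mixing_density a b c g) \<le> C * (1 / (g powr D * mixing_mass (a - D) b c g))"
    "\<And>g. g \<ge> 1 \<Longrightarrow> 1 / (g powr D * mixing_mass (a - D) b c g) \<le> C * (1 / (g * mixing_density a b c g))"
    using mixing_density_marginal_comparable[OF assms] by metis
  show ?thesis
    using nn_integral_finite_if_dominated[OF _ C(1,2)] nn_integral_finite_if_dominated[OF _ C(1,3)] by auto
qed

section \<open>The covariance inequality and the iterated-logarithm cutoff\<close>

lemma has_bochner_integral_mono_AE:
  fixes f g :: "'a \<Rightarrow> real"
  assumes "has_bochner_integral M f I" "has_bochner_integral M g J" "AE x in M. f x \<le> g x"
  shows "I \<le> J"
  using assms integral_mono_AE unfolding has_bochner_integral_iff by metis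

text \<open>The choice \<open>s = D / (2 * q)\<close> turns the family of linear bounds back into a
  quadratic one, as in the usual proof of the Cauchy--Schwarz inequality.\<close>

lemma square_le_of_trade_off:
  fixes D p q :: real
  assumes "D \<ge> 0" "q > 0" and le: "\<And>s. s > 0 \<Longrightarrow> D \<le> p / s + s * q" and "p \<ge> 0"
  shows "D\<^sup>2 \<le> 4 * p * q"
proof (cases "D = 0")
  case False
  then have D: "D > 0" using assms by simp
  have "D \<le> p / (D / (2 * q)) + D / (2 * q) * q" using D assms(2) by (intro le) auto
  also have "\<dots> = 2 * p * q / D + D / 2" using D assms(2) by (simp add: field_simps)
  finally have "D / 2 * (2 * D) \<le> 2 * p * q / D * (2 * D)" using D by (intro mult_right_mono) auto
  then show ?thesis using D by (simp add: power2_eq_square)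
qed (use assms in simp)

text \<open>The left-hand side is the square of half the double integral of
  \<open>(\<phi> g - \<phi> g') * ((h g)\<^sup>2 - (h g')\<^sup>2)\<close>; factoring the second difference and applying
  the Cauchy--Schwarz inequality, in the form of a trade-off parameter, gives the bound.\<close>

lemma (in finite_measure) weighted_covariance_bound:
  fixes \<phi> h \<Theta> \<Lambda> :: "'a \<Rightarrow> real"
  assumes int: "integrable M \<phi>" "integrable M (\<lambda>g. \<phi> g * (h g)\<^sup>2)" "integrable M (\<lambda>g. (h g)\<^sup>2)"
      "integrable M \<Theta>" "integrable M \<Lambda>"
    and pair: "AE g' in M. AE g in M. (\<phi> g - \<phi> g')\<^sup>2 * (h g - h g')\<^sup>2 \<le> \<Theta> g * \<Lambda> g' + \<Theta> g' * \<Lambda> g"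
    and nn: "AE g in M. 0 \<le> \<Theta> g" "AE g in M. 0 \<le> \<Lambda> g"
    and pos: "measure M (space M) > 0" "(\<integral>g. (h g)\<^sup>2 \<partial>M) > 0"
  shows "(measure M (space M) * (\<integral>g. \<phi> g * (h g)\<^sup>2 \<partial>M) - (\<integral>g. \<phi> g \<partial>M) * (\<integral>g. (h g)\<^sup>2 \<partial>M))\<^sup>2
    \<le> 2 * ((\<integral>g. \<Theta> g \<partial>M) * (\<integral>g. \<Lambda> g \<partial>M)) * (measure M (space M) * (\<integral>g. (h g)\<^sup>2 \<partial>M))"
proof -
  define m where "m = measure M (space M)"
  define P where "P = (\<integral>g. \<phi> g * (h g)\<^sup>2 \<partial>M)"
  define F where "F = (\<integral>g. \<phi> g \<partial>M)"
  define H where "H = (\<integral>g. (h g)\<^sup>2 \<partial>M)"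
  define T where "T = (\<integral>g. \<Theta> g \<partial>M)"
  define L where "L = (\<integral>g. \<Lambda> g \<partial>M)"
  have hb: "has_bochner_integral M \<phi> F" "has_bochner_integral M (\<lambda>g. \<phi> g * (h g)\<^sup>2) P"
    "has_bochner_integral M (\<lambda>g. (h g)\<^sup>2) H" "has_bochner_integral M \<Theta> T" "has_bochner_integral M \<Lambda> L"
    unfolding F_def P_def H_def T_def L_def using int by (auto intro: has_bochner_integral_integrable)
  have hc: "has_bochner_integral M (\<lambda>_. k) (k * m)" for k :: real
    by (simp add: has_bochner_integral_iff m_def)
  have T0: "T \<ge> 0" "L \<ge> 0" unfolding T_def L_def using nn by (auto intro: integral_nonneg_AE)
  \<comment> \<open>The sign \<sigma> supplies both halves of the absolute value, and
    \<open>s\<close> is the trade-off parameter.\<close>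
  have key: "\<sigma> * (m * P - F * H) \<le> (T * L / 2) / s + s * (m * H)"
    if s: "s > 0" and \<sigma>: "\<sigma> = 1 \<or> \<sigma> = -1" for s \<sigma> :: real
  proof -
    \<comment> \<open>With \<open>X\<close> and \<open>Y\<close> as below, \<open>X * Y\<close> is
      at most the square of \<open>X\<close> over \<open>2 * s\<close> plus \<open>s / 2\<close>
      times the square of \<open>Y\<close>, and the square of \<open>k + k'\<close> is at most twice
      the sum of the squares.\<close>
    have pt: "\<sigma> * ((p - p') * (k\<^sup>2 - k'\<^sup>2)) \<le> B / (2 * s) + s * (k\<^sup>2 + k'\<^sup>2)"
      if B: "(p - p')\<^sup>2 * (k - k')\<^sup>2 \<le> B" for p p' k k' B :: real
    proof -
      define X where "X = \<sigma> * (p - p') * (k - k')"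
      define Y where "Y = k + k'"
      have "X\<^sup>2 \<le> B" using B \<sigma> by (auto simp: X_def power_mult_distrib)
      moreover have "Y\<^sup>2 \<le> 2 * (k\<^sup>2 + k'\<^sup>2)" 
        using zero_le_power2[of "k - k'"] by (simp add: Y_def power2_eq_square algebra_simps)
      moreover have "X * Y \<le> X\<^sup>2 / (2 * s) + s * Y\<^sup>2 / 2"
      proof -
        have "0 \<le> (X - s * Y)\<^sup>2 / (2 * s)" using s by simp
        also have "\<dots> = X\<^sup>2 / (2 * s) + s * Y\<^sup>2 / 2 - X * Y"
          using s by (simp add: power2_eq_square field_simps)
        finally show ?thesis by simp
      qed
      moreover have "X\<^sup>2 / (2 * s) \<le> B / (2 * s)" using \<open>X\<^sup>2 \<le> B\<close> s by (intro divide_right_mono) auto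
      moreover have "s * Y\<^sup>2 / 2 \<le> s * (k\<^sup>2 + k'\<^sup>2)"
        using mult_left_mono[OF \<open>Y\<^sup>2 \<le> 2 * (k\<^sup>2 + k'\<^sup>2)\<close>, of s] s by simp
      moreover have "X * Y = \<sigma> * ((p - p') * (k\<^sup>2 - k'\<^sup>2))" by (simp add: X_def Y_def power2_eq_square algebra_simps)
      ultimately show ?thesis by linarith
    qed
    \<comment> \<open>Integration over \<open>g\<close> with \<open>g'\<close> fixed, then over
      \<open>g'\<close>: two single integrals stand in for the double integral, matching the
      iterated form of the hypothesis \<open>pair\<close>.\<close>
    have "AE g' in M. \<sigma> * P - \<sigma> * \<phi> g' * H - \<sigma> * (h g')\<^sup>2 * F + \<sigma> * (\<phi> g' * (h g')\<^sup>2) * m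
       \<le> \<Lambda> g' / (2 * s) * T + \<Theta> g' / (2 * s) * L + s * H + s * (h g')\<^sup>2 * m"
      using pair
    proof eventually_elim
      fix g' assume ae: "AE g in M. (\<phi> g - \<phi> g')\<^sup>2 * (h g - h g')\<^sup>2 \<le> \<Theta> g * \<Lambda> g' + \<Theta> g' * \<Lambda> g"
      show "\<sigma> * P - \<sigma> * \<phi> g' * H - \<sigma> * (h g')\<^sup>2 * F + \<sigma> * (\<phi> g' * (h g')\<^sup>2) * m
       \<le> \<Lambda> g' / (2 * s) * T + \<Theta> g' / (2 * s) * L + s * H + s * (h g')\<^sup>2 * m"
      proof (rule has_bochner_integral_mono_AE)
        show "has_bochner_integral M (\<lambda>g. \<sigma> * (\<phi> g * (h g)\<^sup>2) - \<sigma> * \<phi> g' * (h g)\<^sup>2 - \<sigma> * (h g')\<^sup>2 * \<phi> g + \<sigma> * (\<phi> g' * (h g')\<^sup>2))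
          (\<sigma> * P - \<sigma> * \<phi> g' * H - \<sigma> * (h g')\<^sup>2 * F + \<sigma> * (\<phi> g' * (h g')\<^sup>2) * m)"
          by (intro has_bochner_integral_add has_bochner_integral_diff has_bochner_integral_mult_right hb hc)
        show "has_bochner_integral M (\<lambda>g. \<Lambda> g' / (2 * s) * \<Theta> g + \<Theta> g' / (2 * s) * \<Lambda> g + s * (h g)\<^sup>2 + s * (h g')\<^sup>2)
          (\<Lambda> g' / (2 * s) * T + \<Theta> g' / (2 * s) * L + s * H + s * (h g')\<^sup>2 * m)"
          by (intro has_bochner_integral_add has_bochner_integral_diff has_bochner_integral_mult_right hb hc)
        show "AE g in M. \<sigma> * (\<phi> g * (h g)\<^sup>2) - \<sigma> * \<phi> g' * (h g)\<^sup>2 - \<sigma> * (h g')\<^sup>2 * \<phi> g + \<sigma> * (\<phi> g' * (h g')\<^sup>2)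
          \<le> \<Lambda> g' / (2 * s) * \<Theta> g + \<Theta> g' / (2 * s) * \<Lambda> g + s * (h g)\<^sup>2 + s * (h g')\<^sup>2"
          using ae
        proof eventually_elim
          fix g assume "(\<phi> g - \<phi> g')\<^sup>2 * (h g - h g')\<^sup>2 \<le> \<Theta> g * \<Lambda> g' + \<Theta> g' * \<Lambda> g"
          from pt[OF this] show "\<sigma> * (\<phi> g * (h g)\<^sup>2) - \<sigma> * \<phi> g' * (h g)\<^sup>2 - \<sigma> * (h g')\<^sup>2 * \<phi> g + \<sigma> * (\<phi> g' * (h g')\<^sup>2)
            \<le> \<Lambda> g' / (2 * s) * \<Theta> g + \<Theta> g' / (2 * s) * \<Lambda> g + s * (h g)\<^sup>2 + s * (h g')\<^sup>2"
            by (simp add: algebra_simps add_divide_distrib)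
        qed
      qed
    qed
    then have "\<sigma> * P * m - \<sigma> * H * F - \<sigma> * F * H + \<sigma> * m * P
       \<le> T / (2 * s) * L + L / (2 * s) * T + s * H * m + s * m * H"
    proof (rule has_bochner_integral_mono_AE[rotated 2])
      have "has_bochner_integral M (\<lambda>g'. \<sigma> * P - \<sigma> * H * \<phi> g' - \<sigma> * F * (h g')\<^sup>2 + \<sigma> * m * (\<phi> g' * (h g')\<^sup>2))
        (\<sigma> * P * m - \<sigma> * H * F - \<sigma> * F * H + \<sigma> * m * P)"
        by (intro has_bochner_integral_add has_bochner_integral_diff has_bochner_integral_mult_right hb hc)
      then show "has_bochner_integral M (\<lambda>g'. \<sigma> * P - \<sigma> * \<phi> g' * H - \<sigma> * (h g')\<^sup>2 * F + \<sigma> * (\<phi> g' * (h g')\<^sup>2) * m)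
        (\<sigma> * P * m - \<sigma> * H * F - \<sigma> * F * H + \<sigma> * m * P)" by (simp add: mult_ac)
      have "has_bochner_integral M (\<lambda>g'. T / (2 * s) * \<Lambda> g' + L / (2 * s) * \<Theta> g' + s * H + s * m * (h g')\<^sup>2)
        (T / (2 * s) * L + L / (2 * s) * T + s * H * m + s * m * H)"
        by (intro has_bochner_integral_add has_bochner_integral_diff has_bochner_integral_mult_right hb hc)
      then show "has_bochner_integral M (\<lambda>g'. \<Lambda> g' / (2 * s) * T + \<Theta> g' / (2 * s) * L + s * H + s * (h g')\<^sup>2 * m)
        (T / (2 * s) * L + L / (2 * s) * T + s * H * m + s * m * H)" by (simp add: mult_ac)
    qed
    then have "2 * (\<sigma> * (m * P - F * H)) \<le> 2 * ((T * L / 2) / s + s * (m * H))"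
      by (simp add: algebra_simps)
    then show ?thesis by (rule mult_left_le_imp_le) simp
  qed
  have "\<bar>m * P - F * H\<bar>\<^sup>2 \<le> 4 * (T * L / 2) * (m * H)"
  proof (rule square_le_of_trade_off)
    show "0 < m * H" using pos by (simp add: m_def H_def)
    fix s :: real assume "s > 0"
    from key[OF this, of 1] key[OF this, of "-1"]
    show "\<bar>m * P - F * H\<bar> \<le> (T * L / 2) / s + s * (m * H)" by (auto simp: abs_if)
  qed (use T0 in auto)
  then show ?thesis by (simp add: m_def P_def F_def H_def T_def L_def mult_ac)
qed

text \<open>The cutoff is chosen so that the integral of \<open>1 / ((g + 1) * slow_log g)\<close> over
  \<open>iterated_log g < n\<close> is only \<open>n\<close>, while its squared slope contributes \<open>1 / n\<^sup>2\<close>.\<close>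

definition iterated_log :: "real \<Rightarrow> real" where
  "iterated_log g = ln (slow_log g)"

definition log_cutoff :: "real \<Rightarrow> real \<Rightarrow> real" where
  "log_cutoff n g = max 0 (1 - iterated_log g / n)"

lemma iterated_log_measurable [measurable]: "iterated_log \<in> borel_measurable borel"
  unfolding iterated_log_def[abs_def] by measurable

lemma log_cutoff_measurable [measurable]: "log_cutoff n \<in> borel_measurable borel"
  unfolding log_cutoff_def[abs_def] by measurable

lemma iterated_log_nonneg: "0 \<le> g \<Longrightarrow> 0 \<le> iterated_log g"
  by (simp add: iterated_log_def)

lemma iterated_log_mono: "0 \<le> g \<Longrightarrow> g \<le> g' \<Longrightarrow> iterated_log g \<le> iterated_log g'"
  unfolding iterated_log_def by (intro ln_mono add_right_mono add_nonneg_pos ln_ge_zero) auto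

lemma log_cutoff_bounds: "0 \<le> log_cutoff n g" "0 \<le> g \<Longrightarrow> n > 0 \<Longrightarrow> log_cutoff n g \<le> 1"
  using iterated_log_nonneg[of g] by (auto simp: log_cutoff_def)

lemma log_cutoff_mono:
  assumes "0 \<le> g" "0 < n" "n \<le> n'"
  shows "log_cutoff n g \<le> log_cutoff n' g"
proof -
  have "iterated_log g / n' \<le> iterated_log g / n"
    using assms iterated_log_nonneg[of g] by (intro divide_left_mono) auto
  then show ?thesis by (simp add: log_cutoff_def)
qed

lemma log_cutoff_eq_0: "n > 0 \<Longrightarrow> n \<le> iterated_log g \<Longrightarrow> log_cutoff n g = 0"
  by (simp add: log_cutoff_def)

text \<open>As a function of \<open>ln (g + 1)\<close> the iterated logarithm has slope
  \<open>1 / slow_log g\<close>. The slope decreases, so its value at the left end bounds the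
  increment.\<close>

lemma iterated_log_diff_le:
  assumes "0 \<le> g" "g \<le> g'"
  shows "iterated_log g' - iterated_log g \<le> ln ((g' + 1) / (g + 1)) / slow_log g"
proof -
  define l where "l = slow_log g"
  define l' where "l' = slow_log g'"
  have l: "l \<ge> 1" "l' \<ge> l" using assms by (auto simp: l_def l'_def)
  have "iterated_log g' - iterated_log g = ln (l' / l)"
    using l by (simp add: iterated_log_def l_def[symmetric] l'_def[symmetric] ln_div)
  also have "\<dots> \<le> l' / l - 1" using l by (intro ln_le_minus_one) auto
  also have "\<dots> = (l' - l) / l" using l by (simp add: field_simps)
  also have "l' - l = ln ((g' + 1) / (g + 1))" using assms by (simp add: l_def l'_def ln_div)
  finally show ?thesis by (simp add: l_def)
qed

text \<open>The constant comes from squaring \<open>ln z \<le> z\<close> at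
  \<open>z = y powr (\<epsilon> / 2)\<close>.\<close>

lemma ln_square_le_powr:
  fixes y \<epsilon> :: real
  assumes "y \<ge> 1" "\<epsilon> > 0"
  shows "(ln y)\<^sup>2 \<le> 4 / \<epsilon>\<^sup>2 * y powr \<epsilon>"
proof -
  have "\<epsilon> / 2 * ln y = ln (y powr (\<epsilon> / 2))" using assms by (simp add: ln_powr)
  also have "\<dots> \<le> y powr (\<epsilon> / 2)" using ln_le_minus_one[of "y powr (\<epsilon> / 2)"] assms by simp
  finally have "ln y \<le> 2 / \<epsilon> * y powr (\<epsilon> / 2)" using assms by (simp add: field_simps)
  then have "(ln y)\<^sup>2 \<le> (2 / \<epsilon> * y powr (\<epsilon> / 2))\<^sup>2" using assms by (intro power_mono) auto
  also have "\<dots> = 4 / \<epsilon>\<^sup>2 * y powr \<epsilon>"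
    using assms by (simp add: power_mult_distrib power_divide powr_power)
  finally show ?thesis .
qed

text \<open>Plays the role of \<Theta> in the covariance inequality; its partner \<Lambda> is
  \<open>(g + 1) powr \<epsilon>\<close>. At the smaller of two points it collects
  \<open>(g + 1) powr - 2\<close> from the square of \<open>1 / (g + 1)\<close>, the squared slope
  of the cutoff \<open>1 / (n * slow_log g)\<close>, and
  \<open>4 / \<epsilon>\<^sup>2 * (g + 1) powr - \<epsilon>\<close> from trading a squared logarithm
  for a power. The indicator is there because both cutoffs vanish once the smaller point has left
  the range.\<close>

definition cutoff_energy :: "real \<Rightarrow> real \<Rightarrow> real \<Rightarrow> real" where
  "cutoff_energy \<epsilon> n g = 4 / \<epsilon>\<^sup>2 / n\<^sup>2 * (g + 1) powr (- 2 - \<epsilon>) * (1 / (slow_log g)\<^sup>2)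
     * indicator {g. iterated_log g < n} g"

lemma cutoff_energy_nonneg [simp]: "0 \<le> cutoff_energy \<epsilon> n g"
  by (simp add: cutoff_energy_def)

lemma cutoff_energy_measurable [measurable]: "cutoff_energy \<epsilon> n \<in> borel_measurable borel"
  unfolding cutoff_energy_def[abs_def] by measurable

text \<open>Only the smaller point matters: either it lies beyond the range and both cutoffs vanish,
  or both differences are controlled by data at that point and by the ratio of the two. The
  symmetric right-hand side removes the need to order the points.\<close>

lemma log_cutoff_pair_bound:
  assumes "0 < g" "0 < g'" "0 < \<epsilon>" "0 < n"
  shows "(1 / (g + 1) - 1 / (g' + 1))\<^sup>2 * (log_cutoff n g - log_cutoff n g')\<^sup>2
    \<le> cutoff_energy \<epsilon> n g * (g' + 1) powr \<epsilon> + cutoff_energy \<epsilon> n g' * (g + 1) powr \<epsilon>"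
proof -
  have main: "(1 / (g + 1) - 1 / (g' + 1))\<^sup>2 * (log_cutoff n g - log_cutoff n g')\<^sup>2
    \<le> cutoff_energy \<epsilon> n g * (g' + 1) powr \<epsilon>" if g: "0 < g" "g \<le> g'" for g g'
  proof (cases "iterated_log g < n")
    case False
    then have "log_cutoff n g = 0" "log_cutoff n g' = 0"
      using iterated_log_mono[of g g'] g assms(4) by (auto intro!: log_cutoff_eq_0)
    then show ?thesis by simp
  next
    case True
    define l where "l = slow_log g"
    have l: "l \<ge> 1" using g by (simp add: l_def)
    define y where "y = (g' + 1) / (g + 1)"
    have y: "y \<ge> 1" using g by (simp add: y_def)
    have "\<bar>log_cutoff n g - log_cutoff n g'\<bar> \<le> (iterated_log g' - iterated_log g) / n"
    proof -
      have "iterated_log g / n \<le> iterated_log g' / n"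
        using iterated_log_mono[of g g'] g assms(4) by (intro divide_right_mono) auto
      then show ?thesis by (auto simp: log_cutoff_def diff_divide_distrib)
    qed
    also have "\<dots> \<le> ln y / l / n"
      unfolding y_def l_def using g assms(4) by (intro divide_right_mono iterated_log_diff_le) auto
    finally have "\<bar>log_cutoff n g - log_cutoff n g'\<bar>\<^sup>2 \<le> (ln y / l / n)\<^sup>2" by (intro power_mono) auto
    also have "\<dots> = (ln y)\<^sup>2 * (1 / l\<^sup>2 / n\<^sup>2)" by (simp add: power_divide power_mult_distrib)
    also have "\<dots> \<le> 4 / \<epsilon>\<^sup>2 * y powr \<epsilon> * (1 / l\<^sup>2 / n\<^sup>2)"
      using ln_square_le_powr[OF y assms(3)] by (intro mult_right_mono) auto
    finally have h: "(log_cutoff n g - log_cutoff n g')\<^sup>2 \<le> 4 / \<epsilon>\<^sup>2 * y powr \<epsilon> * (1 / l\<^sup>2 / n\<^sup>2)" by simp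
    have "0 \<le> 1 / (g + 1) - 1 / (g' + 1)" "1 / (g + 1) - 1 / (g' + 1) \<le> 1 / (g + 1)"
      using g by (auto simp: frac_le)
    then have "(1 / (g + 1) - 1 / (g' + 1))\<^sup>2 \<le> (1 / (g + 1))\<^sup>2" by (intro power_mono)
    also have "\<dots> = (g + 1) powr - 2" using g by (simp add: powr_minus power_divide inverse_eq_divide)
    finally have "(1 / (g + 1) - 1 / (g' + 1))\<^sup>2 * (log_cutoff n g - log_cutoff n g')\<^sup>2
      \<le> (g + 1) powr - 2 * (4 / \<epsilon>\<^sup>2 * y powr \<epsilon> * (1 / l\<^sup>2 / n\<^sup>2))"
      using h by (intro mult_mono) auto
    also have "\<dots> = cutoff_energy \<epsilon> n g * (g' + 1) powr \<epsilon>"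
    proof -
      have "(g + 1) powr (- 2 - \<epsilon>) * (g' + 1) powr \<epsilon> = (g + 1) powr - 2 * y powr \<epsilon>"
        by (simp add: y_def powr_divide powr_diff)
      moreover have "cutoff_energy \<epsilon> n g * (g' + 1) powr \<epsilon>
        = 4 / \<epsilon>\<^sup>2 / n\<^sup>2 * (1 / l\<^sup>2) * ((g + 1) powr (- 2 - \<epsilon>) * (g' + 1) powr \<epsilon>)"
        using True by (simp add: cutoff_energy_def l_def)
      ultimately show ?thesis by (simp add: mult_ac)
    qed
    finally show ?thesis .
  qed
  show ?thesis
  proof (cases "g \<le> g'")
    case True
    from main[OF assms(1) True] show ?thesis
      using cutoff_energy_nonneg[of \<epsilon> n g'] by (simp add: add_increasing2)
  next
    case False
    then have "(1 / (g' + 1) - 1 / (g + 1))\<^sup>2 * (log_cutoff n g' - log_cutoff n g)\<^sup>2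
      \<le> cutoff_energy \<epsilon> n g' * (g + 1) powr \<epsilon>" using assms(2) by (intro main) auto
    then show ?thesis
      using cutoff_energy_nonneg[of \<epsilon> n g] by (simp add: power2_commute add_increasing)
  qed
qed

lemma iterated_log_less_imp_le:
  assumes "iterated_log g < n" "0 \<le> n"
  shows "g \<le> exp (exp n - 1) - 1"
proof (rule ccontr)
  define G where "G = exp (exp n - 1) - 1"
  assume "\<not> g \<le> exp (exp n - 1) - 1"
  then have "G < g" by (simp add: G_def)
  moreover have "G \<ge> 0" using assms by (simp add: G_def)
  moreover have "iterated_log G = n" by (simp add: iterated_log_def G_def)
  ultimately show False using iterated_log_mono[of G g] assms by simp
qed

lemma nn_integral_log_density_le:
  assumes "n > 0"
  shows "(\<integral>\<^sup>+ g. ennreal (1 / ((g + 1) * slow_log g)) * indicator {g. 0 \<le> g \<and> iterated_log g < n} g \<partial>lborel) \<le> ennreal n"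
proof -
  define G where "G = exp (exp n - 1) - 1"
  have G: "G \<ge> 0" using assms by (simp add: G_def)
  have iG: "iterated_log G = n" using assms by (simp add: iterated_log_def G_def)
  have sub: "g \<in> {0..G}" if "0 \<le> g" "iterated_log g < n" for g
    using that iterated_log_less_imp_le[of g n] assms by (simp add: G_def)
  have "(\<integral>\<^sup>+ g. ennreal (1 / ((g + 1) * slow_log g)) * indicator {g. 0 \<le> g \<and> iterated_log g < n} g \<partial>lborel)
     \<le> (\<integral>\<^sup>+ g. ennreal (1 / ((g + 1) * slow_log g)) * indicator {0..G} g \<partial>lborel)"
    using sub by (intro nn_integral_mono mult_left_mono) (auto simp: indicator_def)
  also have "\<dots> = ennreal (iterated_log G - iterated_log 0)"
  proof (rule nn_integral_has_integral_lebesgue')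
    show "((\<lambda>g. 1 / ((g + 1) * slow_log g)) has_integral iterated_log G - iterated_log 0) {0..G}"
    proof (rule fundamental_theorem_of_calculus[OF G])
      fix x assume x: "x \<in> {0..G}"
      then have "0 < slow_log x" by (intro add_nonneg_pos) auto
      then have "(iterated_log has_real_derivative 1 / ((x + 1) * slow_log x)) (at x within {0..G})"
        unfolding iterated_log_def[abs_def] using x
        by (auto intro!: derivative_eq_intros simp: field_simps)
      then show "(iterated_log has_vector_derivative 1 / ((x + 1) * slow_log x)) (at x within {0..G})"
        by (simp add: has_real_derivative_iff_has_vector_derivative)
    qed
  qed auto
  also have "\<dots> = ennreal n" by (simp add: iG) (simp add: iterated_log_def)
  finally show ?thesis .
qed

text \<open>By contraposition: faster growth makes the integral converge. The sign of
  \<open>a\<close> decides, and for \<open>a = 0\<close> the threshold is \<open>c = 1\<close>,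
  because \<open>1 / (g * slow_log g powr c)\<close> is integrable at infinity exactly for
  \<open>c > 1\<close>. The factor with exponent \<open>b\<close> stays in the bound since it may be
  unbounded near \<open>g = 0\<close>.\<close>

lemma mixing_density_growth:
  fixes a b c :: real
  assumes div: "(\<integral>\<^sup>+ g\<in>{1..}. ennreal (1 / (g * mixing_density a b c g)) \<partial>lborel) = \<infinity>"
  obtains K where "K > 0" "\<And>g. g > 0 \<Longrightarrow> mixing_density a b c g \<le> K * ((g / (g + 1)) powr b * slow_log g)"
proof -
  \<comment> \<open>Up to bounded factors on \<open>g \<ge> 1\<close> the dominated function is
    \<open>1 / (g * mixing_density a b c g)\<close>, so an integrable majorant contradicts the
    divergence.\<close>
  have dom: False if "C > 0" "f \<in> borel_measurable borel"
      "(\<integral>\<^sup>+ g\<in>{1..}. ennreal (f g) \<partial>lborel) < \<infinity>"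
      "\<And>g. g \<ge> 1 \<Longrightarrow> (g + 1) powr (- 1 - a) * slow_log g powr (- c) \<le> C * f g" for C f
  proof -
    note dominated = that(4)
    have "1 / (g * mixing_density a b c g) \<le> 2 * 2 powr \<bar>b\<bar> * C * f g" if g: "g \<ge> 1" for g
    proof -
      define r where "r = (g / (g + 1)) powr b"
      have r: "2 powr - \<bar>b\<bar> \<le> r" unfolding r_def using g by (intro half_powr_bounds) (auto simp: field_simps)
      have r0: "r > 0" using g by (simp add: r_def)
      have "1 / r \<le> 1 / 2 powr - \<bar>b\<bar>" using r r0 by (intro divide_left_mono mult_pos_pos) auto
      then have r': "1 / r \<le> 2 powr \<bar>b\<bar>" by (simp add: powr_minus divide_inverse)
      have g': "1 / g \<le> 2 * (1 / (g + 1))" using g by (simp add: field_simps)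
      have "1 / (g * mixing_density a b c g) = 1 / g * (1 / r) * ((g + 1) powr - a * slow_log g powr - c)"
        by (simp add: mixing_density_def r_def powr_minus divide_inverse)
      also have "\<dots> \<le> 2 * (1 / (g + 1)) * 2 powr \<bar>b\<bar> * ((g + 1) powr - a * slow_log g powr - c)"
        using g r0 by (intro mult_right_mono mult_mono g' r') auto
      also have "\<dots> = 2 * 2 powr \<bar>b\<bar> * ((g + 1) powr (- 1 - a) * slow_log g powr (- c))"
      proof -
        have "(g + 1) powr (- 1 - a) = 1 / (g + 1) * (g + 1) powr - a"
          using g by (simp add: powr_diff powr_minus divide_inverse)
        then show ?thesis by simp
      qed
      also have "\<dots> \<le> 2 * 2 powr \<bar>b\<bar> * (C * f g)" using g by (intro mult_left_mono dominated) auto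
      finally show ?thesis by (simp add: mult_ac)
    qed
    from nn_integral_finite_if_dominated[OF that(2) _ this that(3)] that(1) div show False by simp
  qed
  have step: "\<exists>K>0. \<forall>g>0. (g + 1) powr a * slow_log g powr c \<le> K * slow_log g"
  proof -
    consider "a < 0" | "a = 0" "c \<le> 1" | "a > 0" | "a = 0" "c > 1" by linarith
    then show ?thesis
    proof cases
      case 1
      obtain C where C: "C > 0" "\<And>t g. 0 \<le> t \<Longrightarrow> t \<le> g \<Longrightarrow>
         slow_log g powr (c - 1) \<le> C * ((g + 1) / (t + 1)) powr (- a) * slow_log t powr (c - 1)"
        using slow_log_powr_potter[of "- a" "c - 1"] 1 by (metis neg_0_less_iff_less)
      have "(g + 1) powr a * slow_log g powr c \<le> C * slow_log g" if g: "g > 0" for g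
      proof -
        define l where "l = slow_log g"
        have l: "l > 0" using g by (auto simp: l_def intro!: add_pos_pos)
        have "l powr (c - 1) \<le> C * (g + 1) powr (- a)" using C(2)[of 0 g] g by (simp add: l_def)
        then have "(g + 1) powr a * l powr (c - 1) * l \<le> (g + 1) powr a * (C * (g + 1) powr (- a)) * l"
          using l by (intro mult_right_mono mult_left_mono) auto
        also have "(g + 1) powr a * (C * (g + 1) powr (- a)) * l = C * l"
          using g by (simp add: powr_minus)
        also have "(g + 1) powr a * l powr (c - 1) * l = (g + 1) powr a * l powr c"
          using l by (simp add: powr_diff)
        finally show ?thesis by (simp only: l_def)
      qed
      then show ?thesis using C(1) by blast
    next
      case 2
      have "(g + 1) powr a * slow_log g powr c \<le> 1 * slow_log g" if g: "g > 0" for g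
      proof -
        have l: "slow_log g \<ge> 1" using g by simp
        then have "slow_log g powr c \<le> slow_log g powr 1" using 2 by (intro powr_mono) auto
        then show ?thesis using l 2 g by simp
      qed
      then show ?thesis by (intro exI[of _ 1]) auto
    next
      case 3
      \<comment> \<open>Half of the decay exponent absorbs the logarithm, and
        \<open>- 1 - a / 2\<close> is still an integrable exponent.\<close>
      obtain C where C: "C > 0" "\<And>t g. 0 \<le> t \<Longrightarrow> t \<le> g \<Longrightarrow>
         slow_log g powr (- c) \<le> C * ((g + 1) / (t + 1)) powr (a / 2) * slow_log t powr (- c)"
        using slow_log_powr_potter[of "a / 2" "- c"] 3 by (metis half_gt_zero)
      have False
      proof (rule dom[of C "\<lambda>g. (g + 1) powr (- 1 - a / 2)"])
        show "(\<integral>\<^sup>+ g\<in>{1..}. ennreal ((g + 1) powr (- 1 - a / 2)) \<partial>lborel) < \<infinity>"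
          using 3 nn_integral_shifted_powr_atLeast[of "- 1 - a / 2" 1] by simp
        fix g :: real assume g: "1 \<le> g"
        have "slow_log g powr (- c) \<le> C * (g + 1) powr (a / 2)" using C(2)[of 0 g] g by simp
        then have "(g + 1) powr (- 1 - a) * slow_log g powr (- c) \<le> (g + 1) powr (- 1 - a) * (C * (g + 1) powr (a / 2))"
          by (intro mult_left_mono) auto
        also have "\<dots> = C * ((g + 1) powr (- 1 - a) * (g + 1) powr (a / 2))" by simp
        also have "(g + 1) powr (- 1 - a) * (g + 1) powr (a / 2) = (g + 1) powr (- 1 - a / 2)"
        proof -
          have e: "- 1 - a + a / 2 = - 1 - a / 2" by simp
          show ?thesis by (simp only: powr_add[symmetric] e)
        qed
        finally show "(g + 1) powr (- 1 - a) * slow_log g powr (- c) \<le> C * (g + 1) powr (- 1 - a / 2)" .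
      qed (use C(1) in auto)
      then show ?thesis ..
    next
      case 4
      have False
      proof (rule dom[of 1 "\<lambda>g. slow_log g powr (- c) / (g + 1)"])
        have "(\<integral>\<^sup>+ g\<in>{1..}. ennreal (slow_log g powr (- c) / (g + 1)) \<partial>lborel)
          = ennreal (0 - slow_log 1 powr (1 - c) / (1 - c))"
        proof (rule nn_integral_FTC_atLeast[where F = "\<lambda>g. slow_log g powr (1 - c) / (1 - c)"])
          fix x :: real assume x: "1 \<le> x"
          have l: "((\<lambda>g. slow_log g) has_real_derivative 1 / (x + 1)) (at x)"
            using x by (auto intro!: derivative_eq_intros)
          have "0 < slow_log x" using x by (intro add_nonneg_pos) auto
          from DERIV_cdivide[OF DERIV_fun_powr[OF l this, of "1 - c"], of "1 - c"]
          show "((\<lambda>g. slow_log g powr (1 - c) / (1 - c)) has_real_derivative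
              slow_log x powr (- c) / (x + 1)) (at x)"
            using 4 by simp
        next
          have "filterlim (\<lambda>g::real. slow_log g) at_top at_top" by real_asymp
          then have "((\<lambda>g. slow_log g powr (1 - c)) \<longlongrightarrow> 0) at_top"
            using 4 by (intro tendsto_neg_powr) auto
          then show "((\<lambda>g. slow_log g powr (1 - c) / (1 - c)) \<longlongrightarrow> 0) at_top"
            by (rule tendsto_divide_zero)
        qed auto
        also have "\<dots> < \<infinity>" by simp
        finally show "(\<integral>\<^sup>+ g\<in>{1..}. ennreal (slow_log g powr (- c) / (g + 1)) \<partial>lborel) < \<infinity>" .
      next
        fix g :: real assume "1 \<le> g"
        then show "(g + 1) powr (- 1 - a) * slow_log g powr (- c) \<le> 1 * (slow_log g powr (- c) / (g + 1))"
          using 4 by (simp add: powr_minus divide_inverse)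
      qed auto
      then show ?thesis ..
    qed
  qed
  then obtain K where K: "K > 0" "\<And>g. g > 0 \<Longrightarrow> (g + 1) powr a * slow_log g powr c \<le> K * slow_log g" by blast
  have "mixing_density a b c g \<le> K * ((g / (g + 1)) powr b * slow_log g)" if "g > 0" for g
    using mult_right_mono[OF K(2)[OF that], of "(g / (g + 1)) powr b"] by (simp add: mixing_density_def mult_ac)
  with K(1) show ?thesis by (rule that)
qed

section \<open>The cutoff priors and their Bayes estimators\<close>

definition cutoff_mass :: "real \<Rightarrow> real \<Rightarrow> real \<Rightarrow> real \<Rightarrow> real \<Rightarrow> real" where
  "cutoff_mass a b c n t = (\<integral>g. (log_cutoff n g)\<^sup>2 \<partial>mixing_measure a b c t)"

definition cutoff_moment :: "real \<Rightarrow> real \<Rightarrow> real \<Rightarrow> real \<Rightarrow> real \<Rightarrow> real" where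
  "cutoff_moment a b c n t = (\<integral>g. 1 / (g + 1) * (log_cutoff n g)\<^sup>2 \<partial>mixing_measure a b c t)"

lemma integral_mixing_measure_measurable:
  fixes f :: "real \<Rightarrow> real"
  assumes [measurable]: "f \<in> borel_measurable borel"
  shows "(\<lambda>t. \<integral>g. f g \<partial>mixing_measure a b c t) \<in> borel_measurable borel"
proof -
  have "(\<integral>g. f g \<partial>mixing_measure a b c t) =
    (\<integral>g. (mixing_kernel a b c t g) * f g \<partial>lborel)" for t
    unfolding mixing_measure_def by (subst integral_density) auto
  moreover have "(\<lambda>t. \<integral>g. (mixing_kernel a b c t g) * f g \<partial>lborel)
     \<in> borel_measurable borel"
    by measurable
  ultimately show ?thesis by simp
qed

lemma cutoff_mass_measurable [measurable]: "cutoff_mass a b c n \<in> borel_measurable borel"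
  unfolding cutoff_mass_def[abs_def] by (rule integral_mixing_measure_measurable) measurable

lemma cutoff_moment_measurable [measurable]: "cutoff_moment a b c n \<in> borel_measurable borel"
  unfolding cutoff_moment_def[abs_def] by (rule integral_mixing_measure_measurable) measurable

lemma integrable_mixing_measure_bounded:
  assumes "a < -1" "b > -1" "f \<in> borel_measurable borel" "\<And>g. g > 0 \<Longrightarrow> \<bar>f g\<bar> \<le> (B::real)"
  shows "integrable (mixing_measure a b c t) f"
proof -
  interpret finite_measure "mixing_measure a b c t" by (rule finite_mixing_measure) fact+
  show ?thesis
    by (rule integrable_const_bound[of _ B]) (use assms in \<open>auto intro!: eventually_mono[OF AE_mixing_measure]\<close>)
qed

lemma log_cutoff_square_le_one: "0 < g \<Longrightarrow> n > 0 \<Longrightarrow> (log_cutoff n g)\<^sup>2 \<le> 1"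
  using log_cutoff_bounds(1)[of n g] log_cutoff_bounds(2)[of g n] by (simp add: power_le_one)

lemma cutoff_mass_nonneg: "cutoff_mass a b c n t \<ge> 0"
  unfolding cutoff_mass_def by (rule integral_nonneg_AE) auto

text \<open>Bounds the weights of all \<open>n \<ge> 1\<close> below by the single weight for
  \<open>n = 1\<close>, which stays fixed while \<open>n\<close> tends to infinity in Blyth's
  argument.\<close>

lemma cutoff_mass_mono:
  assumes "a < -1" "b > -1" "0 < n" "n \<le> n'"
  shows "cutoff_mass a b c n t \<le> cutoff_mass a b c n' t"
  unfolding cutoff_mass_def
proof (rule integral_mono_AE)
  show "integrable (mixing_measure a b c t) (\<lambda>g. (log_cutoff n g)\<^sup>2)"
    "integrable (mixing_measure a b c t) (\<lambda>g. (log_cutoff n' g)\<^sup>2)"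
    using assms log_cutoff_square_le_one by (auto intro!: integrable_mixing_measure_bounded[where B=1])
  show "AE g in mixing_measure a b c t. (log_cutoff n g)\<^sup>2 \<le> (log_cutoff n' g)\<^sup>2"
    by (rule eventually_mono[OF AE_mixing_measure])
      (use assms in \<open>auto intro!: power_mono log_cutoff_mono log_cutoff_bounds\<close>)
qed

text \<open>For \<open>0 < g < 1\<close> one has \<open>iterated_log g \<le> g < 1 \<le> n\<close>,
  so the cutoff is positive there, and the mixing measure charges this interval.\<close>

lemma cutoff_mass_pos:
  assumes ab: "a < -1" "b > -1" and n: "n \<ge> 1"
  shows "cutoff_mass a b c n t > 0"
proof -
  have i: "integrable (mixing_measure a b c t) (\<lambda>g. (log_cutoff n g)\<^sup>2)"
    using assms log_cutoff_square_le_one by (auto intro!: integrable_mixing_measure_bounded[where B=1])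
  have "cutoff_mass a b c n t \<noteq> 0"
  proof
    assume "cutoff_mass a b c n t = 0"
    then have "AE g in mixing_measure a b c t. (log_cutoff n g)\<^sup>2 = 0"
      unfolding cutoff_mass_def using i by (subst (asm) integral_nonneg_eq_0_iff_AE) auto
    then obtain g where g: "0 < g" "g < 1" "(log_cutoff n g)\<^sup>2 = 0" by (rule mixing_measure_AE_witness)
    then have "n \<le> iterated_log g" using n by (auto simp: log_cutoff_def max_def field_simps split: if_splits)
    moreover have "iterated_log g < 1"
    proof -
      have "0 < ln (g + 1)" using g by simp
      then have "ln (slow_log g) \<le> ln (g + 1)" using ln_le_minus_one[of "slow_log g"] by simp
      moreover have "ln (g + 1) \<le> g" using g ln_le_minus_one[of "g + 1"] by simp
      ultimately show ?thesis using g by (simp add: iterated_log_def)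
    qed
    ultimately show False using n by simp
  qed
  then show ?thesis using cutoff_mass_nonneg[of a b c n t] by linarith
qed

definition shrinkage :: "real \<Rightarrow> real \<Rightarrow> real \<Rightarrow> 'a::euclidean_space \<Rightarrow> 'a" where
  "shrinkage a b c x = (1 - mixing_mass (a - 1) b c ((norm x)\<^sup>2) / mixing_mass a b c ((norm x)\<^sup>2)) *\<^sub>R x"

text \<open>The posterior mean when the prior carries the weight
  \<open>(log_cutoff n g)\<^sup>2\<close>. Its optimality is expressed by
  \<open>posterior_loss_decomposition\<close>.\<close>

definition cutoff_shrinkage :: "real \<Rightarrow> real \<Rightarrow> real \<Rightarrow> real \<Rightarrow> 'a::euclidean_space \<Rightarrow> 'a" where
  "cutoff_shrinkage a b c n x = (1 - cutoff_moment a b c n ((norm x)\<^sup>2) / cutoff_mass a b c n ((norm x)\<^sup>2)) *\<^sub>R x"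

lemma shrinkage_measurable:
  assumes "a < -1" "b > -1"
  shows "shrinkage a b c \<in> borel_measurable (borel :: 'a::euclidean_space measure)"
proof -
  have [measurable]: "mixing_mass a b c \<in> borel_measurable borel" "mixing_mass (a - 1) b c \<in> borel_measurable borel"
    using assms by (auto intro: mixing_mass_measurable)
  show ?thesis unfolding shrinkage_def[abs_def] by measurable
qed

lemma cutoff_shrinkage_measurable [measurable]:
  "cutoff_shrinkage a b c n \<in> borel_measurable (borel :: 'a::euclidean_space measure)"
  unfolding cutoff_shrinkage_def[abs_def] by measurable

text \<open>The two shrinkage factors differ by \<open>(m * P - F * H) / (m * H)\<close>, a
  normalised covariance of \<open>1 / (g + 1)\<close> and the squared cutoff, to which the
  covariance inequality applies. The weight \<open>H\<close> on the left cancels the remaining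
  denominator, so the estimate does not deteriorate where the cutoff mass is small.\<close>

lemma cutoff_shrinkage_difference:
  fixes x :: "'a::euclidean_space"
  assumes ab: "a < -1" "b > -1" and n: "n \<ge> 1" and \<epsilon>: "0 < \<epsilon>" "a + \<epsilon> < -1"
  shows "cutoff_mass a b c n ((norm x)\<^sup>2) * (norm (shrinkage a b c x - cutoff_shrinkage a b c n x))\<^sup>2
    \<le> 2 * (norm x)\<^sup>2 * (mixing_mass (a + \<epsilon>) b c ((norm x)\<^sup>2) / mixing_mass a b c ((norm x)\<^sup>2))
       * (\<integral>g. cutoff_energy \<epsilon> n g \<partial>mixing_measure a b c ((norm x)\<^sup>2))"
proof -
  define t where "t = (norm x)\<^sup>2"
  define N where "N = mixing_measure a b c t"
  interpret N: finite_measure N unfolding N_def using ab by (rule finite_mixing_measure)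
  define m where "m = mixing_mass a b c t"
  define F where "F = mixing_mass (a - 1) b c t"
  define H where "H = cutoff_mass a b c n t"
  define P where "P = cutoff_moment a b c n t"
  define T where "T = (\<integral>g. cutoff_energy \<epsilon> n g \<partial>N)"
  define L where "L = mixing_mass (a + \<epsilon>) b c t"
  have aeN: "AE g in N. g > 0" unfolding N_def by (rule AE_mixing_measure)
  have m: "m > 0" unfolding m_def using ab by (rule mixing_mass_pos)
  have H: "H > 0" unfolding H_def using ab n by (rule cutoff_mass_pos)
  have ms: "measure N (space N) = m" by (simp add: N_def m_def mixing_mass_def)
  have "(measure N (space N) * (\<integral>g. 1 / (g + 1) * (log_cutoff n g)\<^sup>2 \<partial>N) - (\<integral>g. 1 / (g + 1) \<partial>N) * (\<integral>g. (log_cutoff n g)\<^sup>2 \<partial>N))\<^sup>2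
    \<le> 2 * ((\<integral>g. cutoff_energy \<epsilon> n g \<partial>N) * (\<integral>g. (g + 1) powr \<epsilon> \<partial>N)) * (measure N (space N) * (\<integral>g. (log_cutoff n g)\<^sup>2 \<partial>N))"
  proof (rule N.weighted_covariance_bound)
    show "integrable N (\<lambda>g. 1 / (g + 1))" unfolding N_def using ab by (rule mixing_mass_minus_one(2))
    show "integrable N (\<lambda>g. (g + 1) powr \<epsilon>)" unfolding N_def using \<epsilon>(2) ab(2) by (rule mixing_mass_powr(2))
    have le: "1 / (g + 1) * (log_cutoff n g)\<^sup>2 \<le> 1" "(log_cutoff n g)\<^sup>2 \<le> 1" if "0 < g" for g
      using that n log_cutoff_square_le_one[of g n] by (auto intro!: mult_le_one simp: divide_le_eq)
    show "integrable N (\<lambda>g. 1 / (g + 1) * (log_cutoff n g)\<^sup>2)"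
      unfolding N_def using ab le by (intro integrable_mixing_measure_bounded[where B=1]) (auto simp: abs_mult)
    show "integrable N (\<lambda>g. (log_cutoff n g)\<^sup>2)"
      unfolding N_def using ab le by (intro integrable_mixing_measure_bounded[where B=1]) auto
    show "integrable N (cutoff_energy \<epsilon> n)"
      unfolding N_def
    proof (rule integrable_mixing_measure_bounded[OF ab, where B="4 / \<epsilon>\<^sup>2 / n\<^sup>2"])
      fix g :: real assume g: "0 < g"
      have "(g + 1) powr (- 2 - \<epsilon>) \<le> 1" using g \<epsilon>(1) powr_mono[of "- 2 - \<epsilon>" 0 "g + 1"] by simp
      moreover have "1 / (slow_log g)\<^sup>2 \<le> 1"
      proof -
        have "1 \<le> (slow_log g)\<^sup>2" using g by (intro one_le_power) auto
        then show ?thesis by (simp add: divide_le_eq)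
      qed
      ultimately have "(g + 1) powr (- 2 - \<epsilon>) * (1 / (slow_log g)\<^sup>2) * indicator {g. iterated_log g < n} g \<le> 1"
        by (intro mult_le_one mult_nonneg_nonneg) (auto simp: indicator_def)
      then have "4 / \<epsilon>\<^sup>2 / n\<^sup>2 * ((g + 1) powr (- 2 - \<epsilon>) * (1 / (slow_log g)\<^sup>2) * indicator {g. iterated_log g < n} g) \<le> 4 / \<epsilon>\<^sup>2 / n\<^sup>2 * 1"
        by (intro mult_left_mono) auto
      then show "\<bar>cutoff_energy \<epsilon> n g\<bar> \<le> 4 / \<epsilon>\<^sup>2 / n\<^sup>2"
        using cutoff_energy_nonneg[of \<epsilon> n g] by (simp add: cutoff_energy_def mult.assoc)
    qed measurable
    show "AE g' in N. AE g in N. (1 / (g + 1) - 1 / (g' + 1))\<^sup>2 * (log_cutoff n g - log_cutoff n g')\<^sup>2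
       \<le> cutoff_energy \<epsilon> n g * (g' + 1) powr \<epsilon> + cutoff_energy \<epsilon> n g' * (g + 1) powr \<epsilon>"
      using aeN
    proof eventually_elim
      fix g' :: real assume g': "0 < g'"
      show "AE g in N. (1 / (g + 1) - 1 / (g' + 1))\<^sup>2 * (log_cutoff n g - log_cutoff n g')\<^sup>2
       \<le> cutoff_energy \<epsilon> n g * (g' + 1) powr \<epsilon> + cutoff_energy \<epsilon> n g' * (g + 1) powr \<epsilon>"
        using aeN by eventually_elim (use g' \<epsilon> n in \<open>intro log_cutoff_pair_bound; simp\<close>)
    qed
    show "0 < measure N (space N)" using m by (simp add: ms)
    show "0 < (\<integral>g. (log_cutoff n g)\<^sup>2 \<partial>N)" using H by (simp add: H_def cutoff_mass_def N_def)
  qed auto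
  then have key: "(m * P - F * H)\<^sup>2 \<le> 2 * (T * L) * (m * H)"
    unfolding ms
    unfolding N_def mixing_mass_minus_one(1)[OF ab, symmetric] mixing_mass_powr(1)[OF \<epsilon>(2) ab(2), symmetric]
      cutoff_mass_def[symmetric] cutoff_moment_def[symmetric]
    by (simp add: T_def N_def F_def H_def P_def L_def)
  have "shrinkage a b c x - cutoff_shrinkage a b c n x = ((m * P - F * H) / (m * H)) *\<^sub>R x"
  proof -
    have "(1 - F / m) - (1 - P / H) = (m * P - F * H) / (m * H)" using m H by (simp add: field_simps)
    then show ?thesis
      unfolding shrinkage_def cutoff_shrinkage_def t_def[symmetric] m_def[symmetric] F_def[symmetric] P_def[symmetric] H_def[symmetric]
        scaleR_diff_left[symmetric] by simp
  qed
  then have "H * (norm (shrinkage a b c x - cutoff_shrinkage a b c n x))\<^sup>2 = H * (((m * P - F * H) / (m * H))\<^sup>2 * t)"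
    by (simp add: power_mult_distrib t_def power_divide)
  also have "\<dots> = t * (m * P - F * H)\<^sup>2 / (m * (m * H))"
    using m H by (simp add: power_divide power2_eq_square field_simps)
  also have "\<dots> \<le> t * (2 * (T * L) * (m * H)) / (m * (m * H))"
    using key m H by (intro divide_right_mono mult_left_mono) (auto simp: t_def)
  also have "\<dots> = 2 * t * (L / m) * T" using m H by (simp add: field_simps)
  finally show ?thesis by (simp add: t_def H_def L_def m_def T_def N_def)
qed

section \<open>Bayes risks and admissibility by Blyth's method\<close>

lemma risk_eq_nn_integral:
  fixes \<eta> :: "real ^ 'n \<Rightarrow> real ^ 'n"
  assumes [measurable]: "\<eta> \<in> borel_measurable borel"
  shows "risk \<mu> \<eta> = ennreal ((2 * pi) powr (- real CARD('n) / 2)) *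
    (\<integral>\<^sup>+ x. ennreal ((norm (\<eta> x - \<mu>))\<^sup>2 * gauss_kernel (x - \<mu>)) \<partial>lborel)"
proof -
  have [measurable]: "(\<lambda>x. gauss_density (x - \<mu>)) \<in> borel_measurable borel"
    unfolding gauss_density_def[abs_def] by measurable
  have "risk \<mu> \<eta> = (\<integral>\<^sup>+ x. ennreal (gauss_density (x - \<mu>)) * ennreal ((norm (\<eta> x - \<mu>))\<^sup>2) \<partial>lborel)"
    unfolding risk_def normal_law_def by (subst nn_integral_density) auto
  also have "\<dots> = (\<integral>\<^sup>+ x. ennreal ((2 * pi) powr (- real CARD('n) / 2)) *
      ennreal ((norm (\<eta> x - \<mu>))\<^sup>2 * gauss_kernel (x - \<mu>)) \<partial>lborel)"
    by (intro nn_integral_cong) (simp add: gauss_density_def ennreal_mult[symmetric] mult_ac)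
  also have "\<dots> = ennreal ((2 * pi) powr (- real CARD('n) / 2)) *
    (\<integral>\<^sup>+ x. ennreal ((norm (\<eta> x - \<mu>))\<^sup>2 * gauss_kernel (x - \<mu>)) \<partial>lborel)"
    by (rule nn_integral_cmult) measurable
  finally show ?thesis .
qed

text \<open>Tonelli turns the risk averaged over the prior into the unnormalised posterior loss
  integrated over observations; in \<open>ennreal\<close> this covers estimators of infinite risk as
  well.\<close>

lemma bayes_risk_eq:
  fixes \<eta> :: "real ^ 'n \<Rightarrow> real ^ 'n"
  assumes \<eta>[measurable]: "\<eta> \<in> borel_measurable borel" and W[measurable]: "W \<in> borel_measurable borel"
  shows "(\<integral>\<^sup>+ \<mu>. weighted_prior a b c W \<mu> * risk \<mu> \<eta> \<partial>lborel) = ennreal ((2 * pi) powr (- real CARD('n) / 2)) *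
    (\<integral>\<^sup>+ x. (\<integral>\<^sup>+ g. ennreal (W g) * ennreal (loss_kernel (gaussian_mass TYPE(real ^ 'n)) (gaussian_moment2 TYPE(real ^ 'n)) (\<eta> x) x g) \<partial>mixing_measure (a - real CARD('n) / 2) b c ((norm x)\<^sup>2)) \<partial>lborel)"
proof -
  define \<kappa> where "\<kappa> = ennreal ((2 * pi) powr (- real CARD('n) / 2))"
  let ?F = "\<lambda>\<mu> x. weighted_prior a b c W \<mu> * ennreal ((norm (\<eta> x - \<mu>))\<^sup>2 * gauss_kernel (x - \<mu>))"
  have [measurable]: "weighted_prior a b c W \<in> borel_measurable borel" using W by (rule weighted_prior_measurable)
  have "(\<integral>\<^sup>+ \<mu>. weighted_prior a b c W \<mu> * risk \<mu> \<eta> \<partial>lborel)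
    = (\<integral>\<^sup>+ \<mu>. \<kappa> * (\<integral>\<^sup>+ x. (?F \<mu> x) \<partial>lborel) \<partial>lborel)"
    unfolding risk_eq_nn_integral[OF \<eta>] \<kappa>_def[symmetric]
    by (intro nn_integral_cong, subst nn_integral_cmult) (auto simp: mult_ac)
  also have "\<dots> = \<kappa> * (\<integral>\<^sup>+ \<mu>. (\<integral>\<^sup>+ x. (?F \<mu> x) \<partial>lborel) \<partial>lborel)"
    by (rule nn_integral_cmult) measurable
  also have "(\<integral>\<^sup>+ \<mu>. (\<integral>\<^sup>+ x. (?F \<mu> x) \<partial>lborel) \<partial>lborel)
    = (\<integral>\<^sup>+ x. (\<integral>\<^sup>+ \<mu>. (?F \<mu> x) \<partial>lborel) \<partial>lborel)"
    by (rule lborel_pair.Fubini') measurable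
  finally show ?thesis unfolding nn_integral_weighted_prior_loss[OF W] \<kappa>_def .
qed

text \<open>The posterior loss is a quadratic polynomial in \<eta> with leading coefficient
  \<open>G0 * H\<close> and vertex at the posterior mean, and this is its completed square.
  Comparing Bayes risks becomes comparing weighted distances to the Bayes estimator.\<close>

lemma posterior_loss_decomposition:
  fixes x \<eta> :: "'a::euclidean_space"
  assumes ab: "a < -1" "b > -1" and n: "n \<ge> 1" and G: "G0 \<ge> 0" "G2 \<ge> 0"
  shows "(\<integral>\<^sup>+ g. ennreal ((log_cutoff n g)\<^sup>2) * ennreal (loss_kernel G0 G2 \<eta> x g) \<partial>mixing_measure a b c ((norm x)\<^sup>2))
   = ennreal (G0 * (cutoff_mass a b c n ((norm x)\<^sup>2) * (norm (\<eta> - cutoff_shrinkage a b c n x))\<^sup>2))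
    + (\<integral>\<^sup>+ g. ennreal ((log_cutoff n g)\<^sup>2) * ennreal (loss_kernel G0 G2 (cutoff_shrinkage a b c n x) x g) \<partial>mixing_measure a b c ((norm x)\<^sup>2))"
proof -
  define t where "t = (norm x)\<^sup>2"
  define N where "N = mixing_measure a b c t"
  define H where "H = cutoff_mass a b c n t"
  define P where "P = cutoff_moment a b c n t"
  define w where "w g = g / (g + 1)" for g :: real
  define k where "k g = (log_cutoff n g)\<^sup>2" for g
  define J2 where "J2 = (\<integral>g. k g * (w g)\<^sup>2 \<partial>N)"
  define \<delta> where "\<delta> = cutoff_shrinkage a b c n x"
  have aeN: "AE g in N. g > 0" unfolding N_def by (rule AE_mixing_measure)
  have H: "H > 0" unfolding H_def using ab n by (rule cutoff_mass_pos)
  have [measurable]: "k \<in> borel_measurable borel" "w \<in> borel_measurable borel"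
    unfolding k_def[abs_def] w_def[abs_def] by measurable
  have k01: "0 \<le> k g" "k g \<le> 1" if "g > 0" for g
    using that n log_cutoff_square_le_one[of g n] by (auto simp: k_def)
  have w01: "0 \<le> w g" "w g \<le> 1" if "g > 0" for g using that by (auto simp: w_def)
  have sets_N[measurable_cong]: "sets N = sets borel" by (simp add: N_def)
  have hH: "has_bochner_integral N k H"
    unfolding H_def cutoff_mass_def N_def k_def[symmetric] using ab k01
    by (intro has_bochner_integral_integrable integrable_mixing_measure_bounded[where B=1]) auto
  have hP: "has_bochner_integral N (\<lambda>g. 1 / (g + 1) * k g) P"
    unfolding P_def cutoff_moment_def N_def k_def[symmetric] using ab k01
    by (intro has_bochner_integral_integrable integrable_mixing_measure_bounded[where B=1])
      (auto simp: abs_mult divide_le_eq intro: order_trans[of _ 1])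
  have hJ1: "has_bochner_integral N (\<lambda>g. k g * w g) (H - P)"
  proof -
    have "has_bochner_integral N (\<lambda>g. k g - 1 / (g + 1) * k g) (H - P)"
      by (intro has_bochner_integral_diff hH hP)
    moreover have "AE g in N. k g - 1 / (g + 1) * k g = k g * w g"
      using aeN by eventually_elim (simp add: w_def field_simps)
    ultimately show ?thesis by (subst (asm) has_bochner_integral_cong_AE[of _ _ "\<lambda>g. k g * w g"]) auto
  qed
  have hJ2: "has_bochner_integral N (\<lambda>g. k g * (w g)\<^sup>2) J2"
    unfolding J2_def N_def using ab k01 w01
    by (intro has_bochner_integral_integrable integrable_mixing_measure_bounded[where B=1])
      (auto simp: abs_mult intro!: mult_le_one power_le_one)
  define Q where "Q \<eta> = G0 * ((norm \<eta>)\<^sup>2 * H - 2 * inner \<eta> x * (H - P) + t * J2) + G2 * (H - P)" for \<eta>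
  have hQ: "has_bochner_integral N (\<lambda>g. k g * ((norm (\<eta> - w g *\<^sub>R x))\<^sup>2 * G0 + w g * G2)) (Q \<eta>)" for \<eta>
  proof -
    have "has_bochner_integral N (\<lambda>g. G0 * (norm \<eta>)\<^sup>2 * k g - 2 * G0 * inner \<eta> x * (k g * w g) + G0 * t * (k g * (w g)\<^sup>2) + G2 * (k g * w g))
       (G0 * (norm \<eta>)\<^sup>2 * H - 2 * G0 * inner \<eta> x * (H - P) + G0 * t * J2 + G2 * (H - P))"
      by (intro has_bochner_integral_add has_bochner_integral_diff has_bochner_integral_mult_right hH hJ1 hJ2)
    moreover have "k g * ((norm (\<eta> - w g *\<^sub>R x))\<^sup>2 * G0 + w g * G2)
      = G0 * (norm \<eta>)\<^sup>2 * k g - 2 * G0 * inner \<eta> x * (k g * w g) + G0 * t * (k g * (w g)\<^sup>2) + G2 * (k g * w g)" for g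
    proof -
      have "(norm (\<eta> - v *\<^sub>R x))\<^sup>2 = (norm \<eta>)\<^sup>2 - 2 * inner \<eta> x * v + t * v\<^sup>2" for v
        unfolding t_def power2_norm_eq_inner by (simp add: algebra_simps inner_commute power2_eq_square)
      note sq = this[of "w g"]
      show ?thesis unfolding sq by (simp only: algebra_simps)
    qed
    moreover have "Q \<eta> = G0 * (norm \<eta>)\<^sup>2 * H - 2 * G0 * inner \<eta> x * (H - P) + G0 * t * J2 + G2 * (H - P)"
      by (simp add: Q_def algebra_simps)
    ultimately show ?thesis by (simp only:)
  qed
  have nonneg: "AE g in N. 0 \<le> k g * ((norm (\<eta> - w g *\<^sub>R x))\<^sup>2 * G0 + w g * G2)" for \<eta>
    using aeN by eventually_elim (use k01 w01 G in \<open>auto intro!: mult_nonneg_nonneg add_nonneg_nonneg\<close>)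
  have Q0: "Q \<eta> \<ge> 0" for \<eta>
    using hQ[of \<eta>] integral_nonneg_AE[OF nonneg[of \<eta>]] by (simp add: has_bochner_integral_iff)
  have nn: "(\<integral>\<^sup>+ g. ennreal (k g) * ennreal ((norm (\<eta> - w g *\<^sub>R x))\<^sup>2 * G0 + w g * G2) \<partial>N) = ennreal (Q \<eta>)" for \<eta>
  proof -
    have "(\<integral>\<^sup>+ g. ennreal (k g) * ennreal ((norm (\<eta> - w g *\<^sub>R x))\<^sup>2 * G0 + w g * G2) \<partial>N)
      = (\<integral>\<^sup>+ g. ennreal (k g * ((norm (\<eta> - w g *\<^sub>R x))\<^sup>2 * G0 + w g * G2)) \<partial>N)"
      by (intro nn_integral_cong) (simp add: ennreal_mult' k_def)
    also have "\<dots> = ennreal (\<integral>g. k g * ((norm (\<eta> - w g *\<^sub>R x))\<^sup>2 * G0 + w g * G2) \<partial>N)"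
      using hQ[of \<eta>] nonneg by (intro nn_integral_eq_integral) (auto simp: has_bochner_integral_iff)
    also have "(\<integral>g. k g * ((norm (\<eta> - w g *\<^sub>R x))\<^sup>2 * G0 + w g * G2) \<partial>N) = Q \<eta>"
      using hQ[of \<eta>] by (simp add: has_bochner_integral_iff)
    finally show ?thesis .
  qed
  have "Q \<eta> = G0 * (H * (norm (\<eta> - \<delta>))\<^sup>2) + Q \<delta>"
  proof -
    have d: "\<delta> = ((H - P) / H) *\<^sub>R x"
      using H by (simp add: \<delta>_def cutoff_shrinkage_def t_def[symmetric] H_def[symmetric] P_def[symmetric] diff_divide_distrib)
    define r where "r = (H - P) / H"
    have r: "H - P = r * H" using H by (simp add: r_def)
    have e: "(norm (\<eta> - \<delta>))\<^sup>2 = (norm \<eta>)\<^sup>2 - 2 * r * inner \<eta> x + r * r * t" "(norm \<delta>)\<^sup>2 = r * r * t" "inner \<delta> x = r * t"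
      unfolding d r_def[symmetric] t_def power2_norm_eq_inner by (simp_all add: algebra_simps inner_commute)
    show ?thesis unfolding Q_def e r by (simp add: algebra_simps)
  qed
  then have "ennreal (Q \<eta>) = ennreal (G0 * (H * (norm (\<eta> - \<delta>))\<^sup>2)) + ennreal (Q \<delta>)"
    using Q0[of \<delta>] G(1) H by (simp add: ennreal_plus)
  then show ?thesis
    unfolding nn[symmetric] by (simp only: k_def w_def N_def t_def H_def \<delta>_def)
qed

text \<open>The minimal Bayes risk has to be finite to be cancelled from an inequality in
  \<open>ennreal\<close>. It is bounded through the zero estimator: the cutoff confines
  \<open>g\<close> to a bounded interval, where \<open>tilt\<close> is dominated by a fixed Gaussian
  in \<open>x\<close>, and quadratic loss is integrable against it.\<close>

lemma nn_integral_posterior_loss_finite: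
  assumes ab: "a < -1" "b > -1" and n: "n \<ge> 1" and G: "G0 \<ge> 0" "G2 \<ge> 0"
  shows "(\<integral>\<^sup>+ x. (\<integral>\<^sup>+ g. ennreal ((log_cutoff n g)\<^sup>2) * ennreal (loss_kernel G0 G2 0 x g) \<partial>mixing_measure a b c ((norm x)\<^sup>2)) \<partial>(lborel :: 'a::euclidean_space measure)) < \<infinity>"
proof -
  let ?S = "\<lambda>x. (\<integral>\<^sup>+ g. ennreal ((log_cutoff n g)\<^sup>2) * ennreal (loss_kernel G0 G2 0 x g) \<partial>mixing_measure a b c ((norm x)\<^sup>2))"
  \<comment> \<open>The Gaussian rate of \<open>tilt\<close> at
    \<open>g = exp (exp n - 1) - 1\<close>, the point where the cutoff reaches 0.\<close>
  define s where "s = 1 / (2 * (exp (exp n - 1) - 1 + 1))"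
  have s: "s > 0" by (simp add: s_def)
  let ?P = "\<lambda>x. ((1 + (norm x)\<^sup>2) ^ 1 * exp (- s * (norm x)\<^sup>2))"
  have pt: "(?S x)
     \<le> ennreal (mixing_mass a b c 0 * (G0 + G2)) * ennreal (?P x)" for x :: 'a
  proof -
    define q where "q = (G0 + G2) * (?P x)"
    have q: "q \<ge> 0" using G by (simp add: q_def)
    have "(?S x)
      \<le> (\<integral>\<^sup>+ g. ennreal q * ennreal (mixing_kernel a b c 0 g) \<partial>lborel)"
      unfolding nn_integral_mixing_measure[of "\<lambda>g. ennreal ((log_cutoff n g)\<^sup>2) * ennreal (loss_kernel G0 G2 0 x g)" for x, measurable]
    proof (subst nn_integral_mixing_measure, measurable, rule nn_integral_mono)
      fix g :: real
      show "ennreal (mixing_kernel a b c ((norm x)\<^sup>2) g) *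
          (ennreal ((log_cutoff n g)\<^sup>2) * ennreal (loss_kernel G0 G2 0 x g))
        \<le> ennreal q * ennreal (mixing_kernel a b c 0 g)"
      proof (cases "0 < g \<and> iterated_log g < n")
        case False
        then show ?thesis using n by (auto simp: log_cutoff_eq_0)
      next
        case True
        define w where "w = g / (g + 1)"
        have w: "0 \<le> w" "w \<le> 1" using True by (auto simp: w_def)
        have "g \<le> exp (exp n - 1) - 1" using True n by (intro iterated_log_less_imp_le) auto
        then have "s \<le> 1 / (2 * (g + 1))"
          unfolding s_def using True by (intro divide_left_mono mult_left_mono add_right_mono) auto
        then have "s * (norm x)\<^sup>2 \<le> 1 / (2 * (g + 1)) * (norm x)\<^sup>2" by (rule mult_right_mono) auto
        then have e: "tilt ((norm x)\<^sup>2) g \<le> exp (- s * (norm x)\<^sup>2)" by simp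
        have "(norm (0 - w *\<^sub>R x))\<^sup>2 = w\<^sup>2 * (norm x)\<^sup>2" by (simp add: power_mult_distrib)
        also have "\<dots> \<le> 1 * (norm x)\<^sup>2" using w by (intro mult_right_mono power_le_one) auto
        finally have "(norm (0 - w *\<^sub>R x))\<^sup>2 * G0 + w * G2 \<le> (norm x)\<^sup>2 * G0 + 1 * G2"
          using G w by (intro add_mono mult_right_mono) auto
        also have "\<dots> \<le> (G0 + G2) * (1 + (norm x)\<^sup>2) ^ 1" using G by (simp add: algebra_simps)
        finally have l: "(norm (0 - w *\<^sub>R x))\<^sup>2 * G0 + w * G2 \<le> (G0 + G2) * (1 + (norm x)\<^sup>2) ^ 1" .
        have l0: "0 \<le> (norm (0 - w *\<^sub>R x))\<^sup>2 * G0 + w * G2" using G w by simp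
        have k: "(log_cutoff n g)\<^sup>2 \<le> 1" using True n by (intro log_cutoff_square_le_one) auto
        have "tilt ((norm x)\<^sup>2) g * mixing_density a b c g * ((log_cutoff n g)\<^sup>2 * ((norm (0 - w *\<^sub>R x))\<^sup>2 * G0 + w * G2))
          \<le> exp (- s * (norm x)\<^sup>2) * mixing_density a b c g * (1 * ((G0 + G2) * (1 + (norm x)\<^sup>2) ^ 1))"
          using e k l l0 by (intro mult_mono mult_nonneg_nonneg) auto
        also have "\<dots> = q * mixing_density a b c g" by (simp add: q_def)
        finally have "ennreal (tilt ((norm x)\<^sup>2) g * mixing_density a b c g * ((log_cutoff n g)\<^sup>2 * ((norm (0 - w *\<^sub>R x))\<^sup>2 * G0 + w * G2)))
          \<le> ennreal (q * mixing_density a b c g)" by (rule ennreal_leI)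
        then show ?thesis using True q l0
          by (simp add: w_def[symmetric] ennreal_mult)
      qed
    qed
    also have "\<dots> = ennreal q * emeasure (mixing_measure a b c 0) UNIV"
      unfolding emeasure_mixing_measure by (rule nn_integral_cmult) measurable
    also have "\<dots> = ennreal (mixing_mass a b c 0 * (G0 + G2)) * ennreal (?P x)"
      unfolding emeasure_mixing_measure_eq[OF ab] q_def using G
      by (simp only: ennreal_mult[symmetric] add_nonneg_nonneg mixing_mass_nonneg mult_nonneg_nonneg zero_le_power
          zero_le_power2 zero_le_one exp_ge_zero mult_ac)
    finally show ?thesis .
  qed
  have "(\<integral>\<^sup>+ x. (?S x) \<partial>(lborel :: 'a measure))
    \<le> (\<integral>\<^sup>+ x. ennreal (mixing_mass a b c 0 * (G0 + G2)) * ennreal (?P x) \<partial>(lborel :: 'a measure))"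
    by (rule nn_integral_mono) (rule pt)
  also have "\<dots> = ennreal (mixing_mass a b c 0 * (G0 + G2)) * (\<integral>\<^sup>+ x. ennreal (?P x) \<partial>(lborel :: 'a measure))"
    by (rule nn_integral_cmult) measurable
  also have "\<dots> < \<infinity>"
  proof -
    have "(\<integral>\<^sup>+ x. ennreal (norm (?P x)) \<partial>(lborel :: 'a measure)) < \<infinity>"
      using integrable_polynomial_gaussian[OF s, of 1, where 'a='a] unfolding integrable_iff_bounded by blast
    then show ?thesis by (simp add: abs_mult ennreal_mult_less_top)
  qed
  finally show ?thesis .
qed

text \<open>Scaling by \<open>sqrt (g + 1)\<close> contributes \<open>(g + 1) powr (d / 2)\<close>
  as Jacobian and \<open>(g + 1) powr e\<close> through
  \<open>1 + (g + 1) * y \<le> (g + 1) * (1 + y)\<close>. For \<open>e \<le> 2\<close> the remaining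
  power is dominated by a square, which gives a constant independent of \<open>g\<close> and
  \<open>e\<close>.\<close>

lemma nn_integral_powr_gaussian_le:
  fixes e g :: real
  assumes g: "g > 0" and e: "0 \<le> e" "e \<le> 2"
  shows "(\<integral>\<^sup>+ x. ennreal ((1 + (norm x)\<^sup>2) powr e * tilt ((norm x)\<^sup>2) g) \<partial>(lborel :: 'a::euclidean_space measure))
    \<le> ennreal ((g + 1) powr (DIM('a) / 2 + e)) * ennreal (\<integral>z. (1 + (norm z)\<^sup>2) ^ 2 * exp (- (1/2) * (norm z)\<^sup>2) \<partial>(lborel :: 'a measure))"
proof -
  define r where "r = sqrt (g + 1)"
  have r: "r > 0" "r\<^sup>2 = g + 1" using g by (auto simp: r_def)
  have rd: "\<bar>r\<bar> ^ DIM('a) = (g + 1) powr (DIM('a) / 2)"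
    using g by (simp add: r_def powr_half_sqrt[symmetric] powr_realpow[symmetric] powr_powr)
  have "(\<integral>\<^sup>+ x. ennreal ((1 + (norm x)\<^sup>2) powr e * tilt ((norm x)\<^sup>2) g) \<partial>(lborel :: 'a measure))
    = ennreal (\<bar>r\<bar> ^ DIM('a)) * (\<integral>\<^sup>+ z. ennreal ((1 + (norm (0 + r *\<^sub>R z))\<^sup>2) powr e * exp (- (norm (0 + r *\<^sub>R z))\<^sup>2 / (2 * (g + 1)))) \<partial>(lborel :: 'a measure))"
    using r(1) by (intro nn_integral_lborel_affine) auto
  also have "\<dots> \<le> ennreal (\<bar>r\<bar> ^ DIM('a)) * (\<integral>\<^sup>+ z. ennreal ((g + 1) powr e) * ennreal ((1 + (norm z)\<^sup>2) ^ 2 * exp (- (1/2) * (norm z)\<^sup>2)) \<partial>(lborel :: 'a measure))"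
  proof (intro mult_left_mono nn_integral_mono)
    fix z :: 'a
    have nz: "(norm (0 + r *\<^sub>R z))\<^sup>2 = (g + 1) * (norm z)\<^sup>2" by (simp add: power_mult_distrib r(2))
    have ex: "exp (- ((g + 1) * (norm z)\<^sup>2) / (2 * (g + 1))) = exp (- (1/2) * (norm z)\<^sup>2)"
    proof -
      have "- ((g + 1) * (norm z)\<^sup>2) / (2 * (g + 1)) = - (1/2) * (norm z)\<^sup>2" using g by (simp add: field_simps)
      then show ?thesis by (simp only:)
    qed
    have "1 + (g + 1) * (norm z)\<^sup>2 \<le> (g + 1) * (1 + (norm z)\<^sup>2)" using g by (simp add: algebra_simps)
    then have "(1 + (g + 1) * (norm z)\<^sup>2) powr e \<le> ((g + 1) * (1 + (norm z)\<^sup>2)) powr e"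
      using e g by (intro powr_mono2) auto
    also have "\<dots> = (g + 1) powr e * (1 + (norm z)\<^sup>2) powr e" by (rule powr_mult)
    also have "\<dots> \<le> (g + 1) powr e * (1 + (norm z)\<^sup>2) powr 2" using e by (intro mult_left_mono powr_mono) auto
    also have "(1 + (norm z)\<^sup>2) powr 2 = (1 + (norm z)\<^sup>2) ^ 2"
      using powr_realpow[of "1 + (norm z)\<^sup>2" 2] by (simp add: add_pos_nonneg)
    finally have "(1 + (g + 1) * (norm z)\<^sup>2) powr e * exp (- (1/2) * (norm z)\<^sup>2)
      \<le> (g + 1) powr e * (1 + (norm z)\<^sup>2) ^ 2 * exp (- (1/2) * (norm z)\<^sup>2)" by (rule mult_right_mono) auto
    then show "ennreal ((1 + (norm (0 + r *\<^sub>R z))\<^sup>2) powr e * exp (- (norm (0 + r *\<^sub>R z))\<^sup>2 / (2 * (g + 1))))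
      \<le> ennreal ((g + 1) powr e) * ennreal ((1 + (norm z)\<^sup>2) ^ 2 * exp (- (1/2) * (norm z)\<^sup>2))"
      unfolding nz ex by (subst ennreal_mult[symmetric]) (auto intro!: ennreal_leI simp: mult.assoc)
  qed auto
  also have "\<dots> = ennreal (\<bar>r\<bar> ^ DIM('a)) * (ennreal ((g + 1) powr e) * (\<integral>\<^sup>+ z. ennreal ((1 + (norm z)\<^sup>2) ^ 2 * exp (- (1/2) * (norm z)\<^sup>2)) \<partial>(lborel :: 'a measure)))"
    by (subst nn_integral_cmult) auto
  also have "(\<integral>\<^sup>+ z. ennreal ((1 + (norm z)\<^sup>2) ^ 2 * exp (- (1/2) * (norm z)\<^sup>2)) \<partial>(lborel :: 'a measure))
    = ennreal (\<integral>z. (1 + (norm z)\<^sup>2) ^ 2 * exp (- (1/2) * (norm z)\<^sup>2) \<partial>(lborel :: 'a measure))"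
    by (rule nn_integral_eq_integral[OF integrable_polynomial_gaussian]) auto
  also have "ennreal (\<bar>r\<bar> ^ DIM('a)) * (ennreal ((g + 1) powr e) * X) = ennreal ((g + 1) powr (DIM('a) / 2 + e)) * X" for X
    unfolding rd powr_add by (simp add: ennreal_mult mult.assoc)
  finally show ?thesis .
qed

text \<open>The powers of \<open>g + 1\<close> balance: \<open>- 2 - \<epsilon>\<close> from the
  energy and \<open>1 + \<epsilon>\<close> from the weight in \<open>x\<close> leave
  \<open>1 / (g + 1)\<close>, and the Jacobian power \<open>d / 2\<close> restores
  \<open>mixing_density a b c\<close>. The growth hypothesis cancels one of the two logarithms in
  the energy. What remains integrates to at most \<open>n\<close> plus a constant for the part near
  \<open>g = 0\<close>, against a factor of order \<open>1 / n\<^sup>2\<close>.\<close>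

lemma cutoff_shrinkage_distance:
  fixes a b c K \<epsilon> :: real
  defines "A \<equiv> a - DIM('a::euclidean_space) / 2"
  assumes b: "b > -1" and \<epsilon>: "0 < \<epsilon>" "\<epsilon> \<le> 1" "A + \<epsilon> < -1"
    and K: "K > 0" "\<And>g. g > 0 \<Longrightarrow> mixing_density a b c g \<le> K * ((g / (g + 1)) powr b * slow_log g)"
  obtains C where "C > 0" "\<And>n. n \<ge> 1 \<Longrightarrow>
    (\<integral>\<^sup>+ x. ennreal (cutoff_mass A b c n ((norm x)\<^sup>2) * (norm (shrinkage A b c x - cutoff_shrinkage A b c n x))\<^sup>2)
      \<partial>(lborel :: 'a measure)) \<le> ennreal (C / n)"
proof -
  have A: "A < -1" using \<epsilon> by simp
  obtain C1 where C1: "C1 > 0" "\<And>t. 0 \<le> t \<Longrightarrow>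
    C1 * ((t + 1) powr (A + 1) * slow_log t powr c) \<le> mixing_mass A b c t"
    using mixing_mass_ge[OF A b] by metis
  obtain C2 where C2: "C2 > 0" "\<And>t. 0 \<le> t \<Longrightarrow>
    mixing_mass (A + \<epsilon>) b c t \<le> C2 * ((t + 1) powr (A + \<epsilon> + 1) * slow_log t powr c)"
    using mixing_mass_le[OF \<epsilon>(3) b] by metis
  define R where "R = C2 / C1"
  have R: "R > 0" using C1(1) C2(1) by (simp add: R_def)
  \<comment> \<open>The logarithms in the two bounds are the same and cancel, so raising
    \<open>a\<close> by \<epsilon> costs only the power \<epsilon>.\<close>
  have ratio: "mixing_mass (A + \<epsilon>) b c t / mixing_mass A b c t \<le> R * (1 + t) powr \<epsilon>" if t: "0 \<le> t" for t
  proof -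
    define u where "u = (t + 1) powr (A + 1) * slow_log t powr c"
    have l: "0 < slow_log t" using t by (intro add_nonneg_pos) auto
    have u: "u > 0" using t l by (simp add: u_def)
    have "mixing_mass (A + \<epsilon>) b c t \<le> C2 * ((t + 1) powr \<epsilon> * u)"
      using C2(2)[OF t] by (simp add: u_def powr_add mult_ac)
    moreover have "C1 * u \<le> mixing_mass A b c t" using C1(2)[OF t] by (simp add: u_def)
    ultimately have "mixing_mass (A + \<epsilon>) b c t / mixing_mass A b c t \<le> C2 * ((t + 1) powr \<epsilon> * u) / (C1 * u)"
      using u C1(1) C2(1) by (intro frac_le) auto
    also have "\<dots> = R * (1 + t) powr \<epsilon>" using u C1(1) by (simp add: R_def add.commute)
    finally show ?thesis .
  qed
  define M where "M = (\<integral>z. (1 + (norm z)\<^sup>2) ^ 2 * exp (- (1/2) * (norm z)\<^sup>2) \<partial>(lborel :: 'a measure))"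
  have M0: "M \<ge> 0" unfolding M_def by (rule integral_nonneg_AE) auto
  \<comment> \<open>\<open>M + 1\<close> in place of \<open>M\<close> makes positivity immediate.
    The last factor adds the contribution \<open>1 / (b + 1)\<close> of the singularity at
    \<open>g = 0\<close>, which is at most \<open>n / (b + 1)\<close>.\<close>
  define C where "C = 2 * R * (M + 1) * (4 / \<epsilon>\<^sup>2) * K * 2 powr \<bar>b\<bar> * (1 + 1 / (b + 1))"
  have "1 / (b + 1) > 0" using b by simp
  then have "M + 1 > 0" "1 + 1 / (b + 1) > 0" using M0 by linarith+
  then have C: "C > 0" unfolding C_def using R \<epsilon>(1) K(1) by (intro mult_pos_pos) auto
  have bound: "(\<integral>\<^sup>+ x. ennreal (cutoff_mass A b c n ((norm x)\<^sup>2) * (norm (shrinkage A b c x - cutoff_shrinkage A b c n x))\<^sup>2)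
      \<partial>(lborel :: 'a measure)) \<le> ennreal (C / n)" if n: "n \<ge> 1" for n
  proof -
    define k where "k g = indicator {0<..} g * mixing_density A b c g * cutoff_energy \<epsilon> n g" for g
    have k0: "k g \<ge> 0" for g by (simp add: k_def)
    have [measurable]: "k \<in> borel_measurable borel" unfolding k_def[abs_def] by measurable
    let ?c = "2 * R * (M + 1) * (4 / \<epsilon>\<^sup>2) * K * 2 powr \<bar>b\<bar> / n\<^sup>2"
    let ?k = "(4 / \<epsilon>\<^sup>2) * K * 2 powr \<bar>b\<bar> / n\<^sup>2"
    let ?F = "\<lambda>g x. ennreal (2 * R) * (ennreal (k g) * ennreal ((1 + (norm x)\<^sup>2) powr (1 + \<epsilon>) * tilt ((norm x)\<^sup>2) g))"
    let ?m = "\<lambda>g. ennreal (1 / ((g + 1) * slow_log g)) * indicator {g. 0 \<le> g \<and> iterated_log g < n} g + ennreal (g powr b) * indicator {0..1} g"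
    let ?e = "DIM('a) / 2 + (1 + \<epsilon>)"
    have "(\<integral>\<^sup>+ x. ennreal (cutoff_mass A b c n ((norm x)\<^sup>2) * (norm (shrinkage A b c x - cutoff_shrinkage A b c n x))\<^sup>2) \<partial>(lborel :: 'a measure))
      \<le> (\<integral>\<^sup>+ x. (\<integral>\<^sup>+ g. (?F g x) \<partial>lborel) \<partial>(lborel :: 'a measure))"
    proof (rule nn_integral_mono)
      fix x :: 'a
      define t where "t = (norm x)\<^sup>2"
      have t: "t \<ge> 0" by (simp add: t_def)
      define T where "T = (\<integral>g. cutoff_energy \<epsilon> n g \<partial>mixing_measure A b c t)"
      let ?E = "(\<integral>\<^sup>+ g. ennreal (cutoff_energy \<epsilon> n g) \<partial>mixing_measure A b c t)"
      have T0: "T \<ge> 0" unfolding T_def by (rule integral_nonneg_AE) auto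
      have "cutoff_mass A b c n t * (norm (shrinkage A b c x - cutoff_shrinkage A b c n x))\<^sup>2
        \<le> 2 * t * (mixing_mass (A + \<epsilon>) b c t / mixing_mass A b c t) * T"
        unfolding t_def T_def using A b n \<epsilon>(1,3) by (rule cutoff_shrinkage_difference)
      also have "\<dots> \<le> 2 * (1 + t) * (R * (1 + t) powr \<epsilon>) * T"
        using ratio[OF t] T0 t R by (intro mult_right_mono mult_mono) auto
      also have "\<dots> = 2 * R * ((1 + t) powr (1 + \<epsilon>) * T)" using t by (simp add: powr_add)
      finally have "ennreal (cutoff_mass A b c n t * (norm (shrinkage A b c x - cutoff_shrinkage A b c n x))\<^sup>2)
        \<le> ennreal (2 * R * ((1 + t) powr (1 + \<epsilon>) * T))" by (rule ennreal_leI)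
      also have "\<dots> = ennreal (2 * R) * (ennreal ((1 + t) powr (1 + \<epsilon>)) * ennreal T)"
        using R T0 by (simp add: ennreal_mult)
      also have "\<dots> \<le> ennreal (2 * R) * (ennreal ((1 + t) powr (1 + \<epsilon>)) * ?E)"
      proof (intro mult_left_mono)
        \<comment> \<open>Only an inequality is drawn from this: for a nonnegative function the real
          integral never exceeds the extended one, even if the latter is infinite.\<close>
        have "T = enn2real ?E"
          unfolding T_def by (rule integral_eq_nn_integral) auto
        moreover have "ennreal (enn2real X) \<le> X" for X by (cases X) auto
        ultimately show "ennreal T \<le> ?E" by simp
      qed auto
      also have "?E
        = (\<integral>\<^sup>+ g. ennreal (k g) * ennreal (tilt t g) \<partial>lborel)"
        by (subst nn_integral_mixing_measure, measurable, intro nn_integral_cong)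
          (simp add: k_def ennreal_mult[symmetric] mult_ac)
      also have "ennreal (2 * R) * (ennreal ((1 + t) powr (1 + \<epsilon>)) * \<dots>)
        = (\<integral>\<^sup>+ g. ennreal (2 * R) * (ennreal ((1 + t) powr (1 + \<epsilon>)) * (ennreal (k g) * ennreal (tilt t g))) \<partial>lborel)"
        by (simp add: nn_integral_cmult)
      also have "\<dots> = (\<integral>\<^sup>+ g. ennreal (2 * R) * (ennreal (k g) * ennreal ((1 + t) powr (1 + \<epsilon>) * tilt t g)) \<partial>lborel)"
        by (intro nn_integral_cong) (simp add: ennreal_mult mult_ac)
      finally show "ennreal (cutoff_mass A b c n ((norm x)\<^sup>2) * (norm (shrinkage A b c x - cutoff_shrinkage A b c n x))\<^sup>2)
        \<le> (\<integral>\<^sup>+ g. (?F g x) \<partial>lborel)"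
        by (simp only: t_def)
    qed
    also have "\<dots> = (\<integral>\<^sup>+ g. (\<integral>\<^sup>+ x. (?F g x) \<partial>(lborel :: 'a measure)) \<partial>lborel)"
      by (rule lborel_pair.Fubini') measurable
    also have "\<dots> \<le> (\<integral>\<^sup>+ g. ennreal (?c) *
        (?m g) \<partial>lborel)"
    proof (rule nn_integral_mono)
      fix g :: real
      show "(\<integral>\<^sup>+ x. (?F g x) \<partial>(lborel :: 'a measure))
        \<le> ennreal (?c) *
        (?m g)"
      proof (cases "0 < g \<and> iterated_log g < n")
        case False
        then have "k g = 0" by (auto simp: k_def cutoff_energy_def)
        then show ?thesis by simp
      next
        case True
        then have g: "g > 0" and il: "iterated_log g < n" by auto
        define l where "l = slow_log g"
        have l: "l \<ge> 1" using g by (simp add: l_def)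
        define B where "B = g powr b * indicator {..1} g"
        have B0: "B \<ge> 0" by (simp add: B_def)
        have "(\<integral>\<^sup>+ x. (?F g x) \<partial>(lborel :: 'a measure))
          = ennreal (2 * R) * (ennreal (k g) * (\<integral>\<^sup>+ x. ennreal ((1 + (norm x)\<^sup>2) powr (1 + \<epsilon>) * tilt ((norm x)\<^sup>2) g) \<partial>(lborel :: 'a measure)))"
          by (simp add: nn_integral_cmult)
        also have "\<dots> \<le> ennreal (2 * R) * (ennreal (k g) * (ennreal ((g + 1) powr (?e)) * ennreal M))"
          unfolding M_def using g \<epsilon> by (intro mult_left_mono nn_integral_powr_gaussian_le) auto
        also have "\<dots> = ennreal (2 * R * M * (k g * (g + 1) powr (?e)))"
          using R M0 k0[of g] by (simp add: ennreal_mult mult_ac)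
        also have "\<dots> \<le> ennreal ((?c) * (1 / ((g + 1) * l) + B))"
        proof (rule ennreal_leI)
          have "k g * (g + 1) powr (?e)
            = ((g + 1) powr (DIM('a) / 2) * mixing_density A b c g) * (4 / \<epsilon>\<^sup>2 / n\<^sup>2) * ((g + 1) powr (- 2 - \<epsilon>) * (g + 1) powr (1 + \<epsilon>)) * (1 / l\<^sup>2)"
            using g il by (simp add: k_def cutoff_energy_def l_def powr_add)
          also have "(g + 1) powr (DIM('a) / 2) * mixing_density A b c g = mixing_density a b c g"
            by (simp add: powr_mult_mixing_density A_def)
          also have "(g + 1) powr (- 2 - \<epsilon>) * (g + 1) powr (1 + \<epsilon>) = 1 / (g + 1)"
            using g by (simp add: powr_minus_divide flip: powr_add)
          also have "mixing_density a b c g * (4 / \<epsilon>\<^sup>2 / n\<^sup>2) * (1 / (g + 1)) * (1 / l\<^sup>2)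
            \<le> K * ((2 powr \<bar>b\<bar> * (1 + B)) * l) * (4 / \<epsilon>\<^sup>2 / n\<^sup>2) * (1 / (g + 1)) * (1 / l\<^sup>2)"
          proof (intro mult_right_mono)
            have "mixing_density a b c g \<le> K * ((g / (g + 1)) powr b * l)" using K(2)[OF g] by (simp add: l_def)
            also have "\<dots> \<le> K * ((2 powr \<bar>b\<bar> * (1 + B)) * l)"
              using logistic_powr_le[OF g, of b] K(1) l by (intro mult_left_mono mult_right_mono) (auto simp: B_def)
            finally show "mixing_density a b c g \<le> K * ((2 powr \<bar>b\<bar> * (1 + B)) * l)" .
          qed (use g in auto)
          also have "\<dots> = ?k * (1 / ((g + 1) * l) + B * (1 / ((g + 1) * l)))"
          proof -
            have "l * (1 / (g + 1)) * (1 / l\<^sup>2) = 1 / ((g + 1) * l)" using l g by (simp add: power2_eq_square)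
            moreover have "K * ((2 powr \<bar>b\<bar> * (1 + B)) * l) * (4 / \<epsilon>\<^sup>2 / n\<^sup>2) * (1 / (g + 1)) * (1 / l\<^sup>2)
              = ?k * ((1 + B) * (l * (1 / (g + 1)) * (1 / l\<^sup>2)))" by (simp add: mult_ac)
            ultimately show ?thesis by (simp only: distrib_right mult_1)
          qed
          also have "\<dots> \<le> ?k * (1 / ((g + 1) * l) + B * 1)"
          proof -
            have "1 * 1 \<le> (g + 1) * l" using l g by (intro mult_mono) auto
            then have "1 / ((g + 1) * l) \<le> 1" by (simp add: divide_le_eq)
            then show ?thesis using B0 K(1) by (intro mult_left_mono add_left_mono) auto
          qed
          finally have kb: "k g * (g + 1) powr (?e) \<le> ?k * (1 / ((g + 1) * l) + B)"
            by simp
          have "2 * R * M * (k g * (g + 1) powr (?e))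
            \<le> 2 * R * (M + 1) * (?k * (1 / ((g + 1) * l) + B))"
            using R M0 k0[of g] by (intro mult_mono[OF _ kb]) auto
          then show "2 * R * M * (k g * (g + 1) powr (?e))
            \<le> (?c) * (1 / ((g + 1) * l) + B)"
            by (simp only: mult_ac times_divide_eq_right times_divide_eq_left)
        qed
        also have "\<dots> = ennreal (?c) *
          (?m g)"
        proof -
          have "ennreal (1 / ((g + 1) * l) + B) = (?m g)"
            using g il l by (auto simp: B_def l_def[symmetric] indicator_def)
          then show ?thesis using R M0 K(1) by (subst ennreal_mult') auto
        qed
        finally show ?thesis .
      qed
    qed
    also have "\<dots> = ennreal (?c) *
        ((\<integral>\<^sup>+ g. ennreal (1 / ((g + 1) * slow_log g)) * indicator {g. 0 \<le> g \<and> iterated_log g < n} g \<partial>lborel)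
          + (\<integral>\<^sup>+ g. ennreal (g powr b) * indicator {0..1} g \<partial>lborel))"
      by (subst nn_integral_cmult, measurable, subst nn_integral_add) auto
    also have "\<dots> \<le> ennreal (?c) * (ennreal n + ennreal (1 / (b + 1)))"
      unfolding nn_integral_powr_unit_interval[OF b]
      using n by (intro mult_left_mono add_right_mono nn_integral_log_density_le) auto
    also have "\<dots> \<le> ennreal (C / n)"
    proof -
      have sum: "ennreal n + ennreal (1 / (b + 1)) = ennreal (n + 1 / (b + 1))" using n b by (subst ennreal_plus) auto
      have "n + 1 / (b + 1) \<le> n * (1 + 1 / (b + 1))"
        using n b mult_right_mono[of 1 n "1 / (b + 1)"] by (simp add: distrib_left)
      then have "(?c) * (n + 1 / (b + 1))
        \<le> (?c) * (n * (1 + 1 / (b + 1)))"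
        using R M0 K(1) by (intro mult_left_mono) auto
      also have "\<dots> = C / n" using n by (simp add: C_def power2_eq_square)
      finally have le: "ennreal ((?c) * (n + 1 / (b + 1))) \<le> ennreal (C / n)"
        by (rule ennreal_leI)
      have "ennreal ((?c) * (n + 1 / (b + 1)))
        = ennreal (?c) * ennreal (n + 1 / (b + 1))"
        using R M0 K(1) by (intro ennreal_mult') auto
      then show ?thesis using le unfolding sum by simp
    qed
    finally show ?thesis .
  qed
  show ?thesis using C bound by (rule that)
qed

text \<open>An estimator that is nowhere worse has no larger Bayes risk under each cutoff prior,
  hence is no farther from its Bayes estimator than \<delta> is, and that distance is of order
  \<open>1 / n\<close>. By the triangle inequality it is within order \<open>1 / n\<close> of
  \<delta> itself, in a weight that does not depend on \<open>n\<close>. The normal law has a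
  density, so equality almost everywhere makes the risks equal at every parameter.\<close>

lemma admissible_of_growth:
  fixes a b c K :: real and \<delta> :: "real ^ 'n \<Rightarrow> real ^ 'n"
  assumes a: "a < real CARD('n) / 2 - 1" and b: "b > -1"
    and \<delta>: "\<delta> = shrinkage (a - real CARD('n) / 2) b c"
    and K: "K > 0" "\<And>g. g > 0 \<Longrightarrow> mixing_density a b c g \<le> K * ((g / (g + 1)) powr b * slow_log g)"
  shows "admissible \<delta>"
proof -
  define A where "A = a - real CARD('n) / 2"
  have A: "A < -1" using a by (simp add: A_def)
  have \<delta>m[measurable]: "\<delta> \<in> borel_measurable borel" unfolding \<delta> A_def[symmetric] using A b by (rule shrinkage_measurable)
  have est: "estimator \<delta>" by (simp add: estimator_def)
  \<comment> \<open>Capped at 1 so that \<open>1 + \<epsilon>\<close> stays in the range up to 2 of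
    the Gaussian moment bound.\<close>
  define \<epsilon> where "\<epsilon> = min 1 ((- A - 1) / 2)"
  have \<epsilon>: "0 < \<epsilon>" "\<epsilon> \<le> 1" "A + \<epsilon> < -1" using A by (auto simp: \<epsilon>_def min_def field_simps)
  define G0 where "G0 = gaussian_mass TYPE(real ^ 'n)"
  define G2 where "G2 = gaussian_moment2 TYPE(real ^ 'n)"
  have G: "G0 > 0" "G2 \<ge> 0" unfolding G0_def G2_def by (rule gaussian_mass_pos gaussian_moment2_nonneg)+
  obtain C where C: "C > 0" and J: "\<And>n. n \<ge> 1 \<Longrightarrow>
    (\<integral>\<^sup>+ x. ennreal (cutoff_mass A b c n ((norm x)\<^sup>2) * (norm (\<delta> x - cutoff_shrinkage A b c n x))\<^sup>2)
      \<partial>(lborel :: (real ^ 'n) measure)) \<le> ennreal (C / n)"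
    using cutoff_shrinkage_distance[of b \<epsilon> a K c, where 'a="real ^ 'n"] b \<epsilon> K unfolding A_def \<delta> by auto
  have "False" if est': "estimator \<delta>'" and le: "\<And>\<mu>. risk \<mu> \<delta>' \<le> risk \<mu> \<delta>" and less: "risk \<mu>0 \<delta>' < risk \<mu>0 \<delta>" for \<delta>' \<mu>0
  proof -
    have \<delta>'m[measurable]: "\<delta>' \<in> borel_measurable borel" using est' by (simp add: estimator_def)
    let ?D = "\<lambda>x. G0 * (cutoff_mass A b c 1 ((norm x)\<^sup>2) * (norm (\<delta>' x - \<delta> x))\<^sup>2)"
    have close: "(\<integral>\<^sup>+ x. ennreal (?D x) \<partial>lborel) \<le> ennreal (4 * G0 * C / n)"
      if n: "n \<ge> 1" for n :: real
    proof -
      define \<delta>n where "\<delta>n = (cutoff_shrinkage A b c n :: real ^ 'n \<Rightarrow> real ^ 'n)"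
      define H where "H x = cutoff_mass A b c n ((norm x)\<^sup>2)" for x :: "real ^ 'n"
      have [measurable]: "\<delta>n \<in> borel_measurable borel" "H \<in> borel_measurable borel"
        unfolding \<delta>n_def H_def[abs_def] by measurable
      have H0: "H x \<ge> 0" for x unfolding H_def by (rule cutoff_mass_nonneg)
      let ?d = "\<lambda>x. G0 * (H x * (norm (\<delta> x - \<delta>n x))\<^sup>2)"
      let ?e = "\<lambda>x. G0 * (H x * (norm (\<delta>' x - \<delta>n x))\<^sup>2)"
      define S where "S \<eta> x = (\<integral>\<^sup>+ g. ennreal ((log_cutoff n g)\<^sup>2) * ennreal (loss_kernel G0 G2 \<eta> x g) \<partial>mixing_measure A b c ((norm x)\<^sup>2))" for \<eta> x :: "real ^ 'n"
      have dec: "S \<eta> x = ennreal (G0 * (H x * (norm (\<eta> - \<delta>n x))\<^sup>2)) + S (\<delta>n x) x" for \<eta> x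
        unfolding S_def H_def \<delta>n_def using A b n less_imp_le[OF G(1)] G(2) by (rule posterior_loss_decomposition)
      have Sm[measurable]: "(\<lambda>x. S (\<delta>n x) x) \<in> borel_measurable borel"
      proof -
        have "S (\<delta>n x) x = (\<integral>\<^sup>+ g. ennreal (mixing_kernel A b c ((norm x)\<^sup>2) g) *
          (ennreal ((log_cutoff n g)\<^sup>2) * ennreal (loss_kernel G0 G2 (\<delta>n x) x g)) \<partial>lborel)" for x
          unfolding S_def by (rule nn_integral_mixing_measure) measurable
        then show ?thesis by simp
      qed
      \<comment> \<open>The Bayes risk of the optimal rule up to the normalising constant; being
        finite, it cancels from both sides of the comparison.\<close>
      define V where "V = (\<integral>\<^sup>+ x. S (\<delta>n x) x \<partial>lborel)"
      have V: "V < \<infinity>"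
      proof -
        have "V \<le> (\<integral>\<^sup>+ x. S 0 x \<partial>lborel)" unfolding V_def
          by (rule nn_integral_mono) (subst (2) dec, simp)
        also have "\<dots> < \<infinity>"
          unfolding S_def using A b n less_imp_le[OF G(1)] G(2) by (rule nn_integral_posterior_loss_finite)
        finally show ?thesis .
      qed
      define \<kappa> where "\<kappa> = (2 * pi) powr (- real CARD('n) / 2)"
      have br: "(\<integral>\<^sup>+ \<mu>. weighted_prior a b c (\<lambda>g. (log_cutoff n g)\<^sup>2) \<mu> * risk \<mu> \<eta> \<partial>lborel)
        = ennreal \<kappa> * ((\<integral>\<^sup>+ x. ennreal (G0 * (H x * (norm (\<eta> x - \<delta>n x))\<^sup>2)) \<partial>lborel) + V)"
        if [measurable]: "\<eta> \<in> borel_measurable borel" for \<eta> :: "real ^ 'n \<Rightarrow> real ^ 'n"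
      proof -
        have "(\<integral>\<^sup>+ \<mu>. weighted_prior a b c (\<lambda>g. (log_cutoff n g)\<^sup>2) \<mu> * risk \<mu> \<eta> \<partial>lborel) = ennreal \<kappa> * (\<integral>\<^sup>+ x. S (\<eta> x) x \<partial>lborel)"
          unfolding S_def \<kappa>_def G0_def G2_def A_def by (rule bayes_risk_eq) measurable
        also have "(\<integral>\<^sup>+ x. S (\<eta> x) x \<partial>lborel) = (\<integral>\<^sup>+ x. ennreal (G0 * (H x * (norm (\<eta> x - \<delta>n x))\<^sup>2)) \<partial>lborel) + V"
          unfolding V_def by (subst dec, rule nn_integral_add) measurable
        finally show ?thesis .
      qed
      have "ennreal \<kappa> * ((\<integral>\<^sup>+ x. ennreal (?e x) \<partial>lborel) + V)
        \<le> ennreal \<kappa> * ((\<integral>\<^sup>+ x. ennreal (?d x) \<partial>lborel) + V)"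
        unfolding br[OF \<delta>'m, symmetric] br[OF \<delta>m, symmetric] by (intro nn_integral_mono mult_left_mono le) auto
      moreover have "\<kappa> > 0" by (simp add: \<kappa>_def)
      ultimately have "(\<integral>\<^sup>+ x. ennreal (?e x) \<partial>lborel) + V
        \<le> (\<integral>\<^sup>+ x. ennreal (?d x) \<partial>lborel) + V"
        by (subst (asm) ennreal_mult_le_mult_iff) auto
      then have d': "(\<integral>\<^sup>+ x. ennreal (?e x) \<partial>lborel)
        \<le> (\<integral>\<^sup>+ x. ennreal (?d x) \<partial>lborel)"
        using V by (auto simp: add.commute[of _ V] ennreal_add_left_cancel_le)
      have d: "(\<integral>\<^sup>+ x. ennreal (?d x) \<partial>lborel) \<le> ennreal (G0 * (C / n))"
      proof -
        have "(\<integral>\<^sup>+ x. ennreal (?d x) \<partial>lborel)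
          = ennreal G0 * (\<integral>\<^sup>+ x. ennreal (H x * (norm (\<delta> x - \<delta>n x))\<^sup>2) \<partial>lborel)"
          using G(1) by (simp add: ennreal_mult' nn_integral_cmult)
        also have "\<dots> \<le> ennreal G0 * ennreal (C / n)"
          unfolding H_def \<delta>n_def by (intro mult_left_mono J n) auto
        also have "\<dots> = ennreal (G0 * (C / n))" using G(1) by (intro ennreal_mult'[symmetric]) simp
        finally show ?thesis .
      qed
      have "(\<integral>\<^sup>+ x. ennreal (?D x) \<partial>lborel)
        \<le> (\<integral>\<^sup>+ x. 2 * ennreal (?e x) + 2 * ennreal (?d x) \<partial>lborel)"
      proof (rule nn_integral_mono)
        fix x :: "real ^ 'n"
        have "cutoff_mass A b c 1 ((norm x)\<^sup>2) \<le> H x" unfolding H_def using A b n by (intro cutoff_mass_mono) auto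
        moreover have "(norm (\<delta>' x - \<delta> x))\<^sup>2 \<le> 2 * (norm (\<delta>' x - \<delta>n x))\<^sup>2 + 2 * (norm (\<delta> x - \<delta>n x))\<^sup>2"
        proof -
          have "norm (\<delta>' x - \<delta> x) \<le> norm (\<delta>' x - \<delta>n x) + norm (\<delta> x - \<delta>n x)"
            using norm_triangle_ineq4[of "\<delta>' x - \<delta>n x" "\<delta> x - \<delta>n x"] by simp
          then have "(norm (\<delta>' x - \<delta> x))\<^sup>2 \<le> (norm (\<delta>' x - \<delta>n x) + norm (\<delta> x - \<delta>n x))\<^sup>2" by (intro power_mono) auto
          also have "\<dots> \<le> 2 * (norm (\<delta>' x - \<delta>n x))\<^sup>2 + 2 * (norm (\<delta> x - \<delta>n x))\<^sup>2"
            using zero_le_power2[of "norm (\<delta>' x - \<delta>n x) - norm (\<delta> x - \<delta>n x)"] by (simp add: power2_eq_square algebra_simps)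
          finally show ?thesis .
        qed
        ultimately have "cutoff_mass A b c 1 ((norm x)\<^sup>2) * (norm (\<delta>' x - \<delta> x))\<^sup>2
          \<le> H x * (2 * (norm (\<delta>' x - \<delta>n x))\<^sup>2 + 2 * (norm (\<delta> x - \<delta>n x))\<^sup>2)"
          using H0[of x] by (intro mult_mono) auto
        then have "(?D x)
          \<le> G0 * (H x * (2 * (norm (\<delta>' x - \<delta>n x))\<^sup>2 + 2 * (norm (\<delta> x - \<delta>n x))\<^sup>2))"
          using G(1) by (intro mult_left_mono) auto
        also have "\<dots> = 2 * (?e x) + 2 * (?d x)"
          by (simp add: algebra_simps)
        finally have "ennreal (?D x)
          \<le> ennreal (2 * (?e x) + 2 * (?d x))"
          by (rule ennreal_leI)
        also have "\<dots> = ennreal (2 * (?e x)) + ennreal (2 * (?d x))"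
          using G(1) H0[of x] by (intro ennreal_plus) auto
        finally show "ennreal (?D x)
          \<le> 2 * ennreal (?e x) + 2 * ennreal (?d x)"
          by (simp only: ennreal_mult'[OF zero_le_numeral] ennreal_numeral)
      qed
      also have "\<dots> = 2 * (\<integral>\<^sup>+ x. ennreal (?e x) \<partial>lborel) + 2 * (\<integral>\<^sup>+ x. ennreal (?d x) \<partial>lborel)"
        by (subst nn_integral_add) (auto simp: nn_integral_cmult)
      also have "\<dots> \<le> 2 * ennreal (G0 * (C / n)) + 2 * ennreal (G0 * (C / n))"
        by (intro add_mono mult_left_mono order_trans[OF d' d] d) auto
      also have "\<dots> = ennreal (2 * (G0 * (C / n)) + 2 * (G0 * (C / n)))"
      proof -
        have "0 \<le> 2 * (G0 * (C / n))" using G(1) C n by simp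
        moreover have "2 * ennreal X = ennreal (2 * X)" for X
          by (simp only: ennreal_mult'[OF zero_le_numeral] ennreal_numeral)
        ultimately show ?thesis by (simp only: ennreal_plus)
      qed
      also have "2 * (G0 * (C / n)) + 2 * (G0 * (C / n)) = 4 * G0 * C / n" by simp
      finally show ?thesis .
    qed
    define I where "I = (\<integral>\<^sup>+ x. ennreal (?D x) \<partial>lborel)"
    have "I \<le> 0"
    proof (rule LIMSEQ_le_const[of "\<lambda>i. ennreal (4 * G0 * C / real (Suc i))"])
      have "(\<lambda>i. 4 * G0 * C / real (Suc i)) \<longlonglongrightarrow> 0" by real_asymp
      then have "(\<lambda>i. ennreal (4 * G0 * C / real (Suc i))) \<longlonglongrightarrow> ennreal 0" by (rule tendsto_ennrealI)
      then show "(\<lambda>i. ennreal (4 * G0 * C / real (Suc i))) \<longlonglongrightarrow> 0" by simp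
      show "\<exists>N. \<forall>i\<ge>N. I \<le> ennreal (4 * G0 * C / real (Suc i))"
        unfolding I_def by (intro exI[of _ 0] allI impI close) auto
    qed
    then have "AE x in lborel. ennreal (?D x) = 0"
      unfolding I_def by (subst (asm) le_zero_eq, subst (asm) nn_integral_0_iff_AE) auto
    then have ae: "AE x in lborel. \<delta>' x = \<delta> x"
    proof eventually_elim
      fix x :: "real ^ 'n"
      assume "ennreal (?D x) = 0"
      moreover have "cutoff_mass A b c 1 ((norm x)\<^sup>2) > 0" using A b by (rule cutoff_mass_pos) simp
      ultimately show "\<delta>' x = \<delta> x" using G(1)
        by (auto simp: ennreal_eq_0_iff mult_le_0_iff)
    qed
    have "risk \<mu>0 \<delta>' = risk \<mu>0 \<delta>"
      unfolding risk_eq_nn_integral[OF \<delta>'m] risk_eq_nn_integral[OF \<delta>m]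
      by (rule arg_cong[where f="\<lambda>X. _ * X"], rule nn_integral_cong_AE) (use ae in eventually_elim, simp)
    with less show False by simp
  qed
  then show ?thesis using est unfolding admissible_def inadmissible_def by blast
qed

section \<open>Stein's identity for radial fields by dilation\<close>

lemma integral_lborel_scale:
  fixes F :: "'a::euclidean_space \<Rightarrow> real"
  assumes F: "integrable lborel F" and r: "r > 0"
  shows "integrable lborel (\<lambda>x. r ^ DIM('a) * F (r *\<^sub>R x))"
    and "(\<integral>x. r ^ DIM('a) * F (r *\<^sub>R x) \<partial>lborel) = (\<integral>x. F x \<partial>lborel)"
proof -
  have [measurable]: "F \<in> borel_measurable borel" using F by auto
  let ?M = "distr lborel borel (\<lambda>x. (0::'a) + r *\<^sub>R x)"
  let ?D = "density ?M (\<lambda>_. ennreal (\<bar>r\<bar> ^ DIM('a)))"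
  have eq: "(lborel :: 'a measure) = ?D" using r by (intro lborel_affine) auto
  have "integrable ?D F" using F arg_cong[OF eq, of "\<lambda>M. integrable M F"] by simp
  then have i: "integrable ?M (\<lambda>x. (\<bar>r\<bar> ^ DIM('a)) *\<^sub>R F x)"
    by (subst (asm) integrable_density) auto
  then have "integrable lborel (\<lambda>x. (\<bar>r\<bar> ^ DIM('a)) *\<^sub>R F (0 + r *\<^sub>R x))"
    by (subst (asm) integrable_distr_eq) auto
  then show "integrable lborel (\<lambda>x. r ^ DIM('a) * F (r *\<^sub>R x))" using r by simp
  have "(\<integral>x. F x \<partial>lborel) = (\<integral>x. F x \<partial>?D)" using arg_cong[OF eq, of "\<lambda>M. integral\<^sup>L M F"] .
  also have "\<dots> = (\<integral>x. (\<bar>r\<bar> ^ DIM('a)) *\<^sub>R F x \<partial>?M)" by (rule integral_density) auto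
  also have "\<dots> = (\<integral>x. (\<bar>r\<bar> ^ DIM('a)) *\<^sub>R F (0 + r *\<^sub>R x) \<partial>lborel)" by (rule integral_distr) auto
  finally show "(\<integral>x. r ^ DIM('a) * F (r *\<^sub>R x) \<partial>lborel) = (\<integral>x. F x \<partial>lborel)" using r by simp
qed

text \<open>The integral of \<open>F\<close> is invariant under dilation; differentiating at the
  identity replaces the divergence theorem for the radial field \<open>F x *\<^sub>R x\<close>.\<close>

lemma integral_dilation_derivative:
  fixes F :: "'a::euclidean_space \<Rightarrow> real" and G :: "real \<Rightarrow> 'a \<Rightarrow> real"
  assumes F: "integrable lborel F"
    and deriv: "\<And>r x. 1 \<le> r \<Longrightarrow> r \<le> 2 \<Longrightarrow> ((\<lambda>r. r ^ DIM('a) * F (r *\<^sub>R x)) has_real_derivative G r x) (at r)"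
    and bound: "\<And>r x. 1 \<le> r \<Longrightarrow> r \<le> 2 \<Longrightarrow> \<bar>G r x\<bar> \<le> w x"
    and w: "integrable lborel w" and G1: "G 1 \<in> borel_measurable borel"
  shows "(\<integral>x. G 1 x \<partial>lborel) = 0"
proof -
  define f where "f r x = r ^ DIM('a) * F (r *\<^sub>R x)" for r x
  \<comment> \<open>Difference quotients at \<open>r = 1 + 1 / (j + 1)\<close>, a point of the
    interval where the derivative is bounded. Each has integral 0 by dilation invariance, and the
    mean value theorem dominates it by \<open>w\<close>.\<close>
  define s where "s j x = real (Suc j) * (f (1 + 1 / real (Suc j)) x - f 1 x)" for j x
  have fi: "integrable lborel (f r)" "integral\<^sup>L lborel (f r) = integral\<^sup>L lborel F" if "r > 0" for r
    unfolding f_def using integral_lborel_scale[OF F that] by auto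
  have r: "1 + 1 / real (Suc j) > 0" "1 + 1 / real (Suc j) \<le> 2" "1 < 1 + 1 / real (Suc j)" for j
    by (auto simp: add_pos_pos divide_le_eq)
  have s0: "integral\<^sup>L lborel (s j) = 0" for j
    unfolding s_def using fi[OF r(1)[of j]] fi[of 1] by simp
  have sm: "s j \<in> borel_measurable lborel" for j
    unfolding s_def using fi(1)[OF r(1)[of j]] fi(1)[of 1] by (auto intro!: borel_measurable_times borel_measurable_diff)
  have sb: "\<bar>s j x\<bar> \<le> w x" for j x
  proof -
    have "\<exists>z. 1 < z \<and> z < 1 + 1 / real (Suc j) \<and> f (1 + 1 / real (Suc j)) x - f 1 x = (1 + 1 / real (Suc j) - 1) * G z x"
    proof (rule MVT2[OF r(3)])
      fix z assume "1 \<le> z" "z \<le> 1 + 1 / real (Suc j)"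
      with r(2)[of j] have "z \<le> 2" by linarith
      then show "((\<lambda>r. f r x) has_real_derivative G z x) (at z)"
        unfolding f_def using \<open>1 \<le> z\<close> by (intro deriv)
    qed
    then obtain z where z: "1 < z" "z < 1 + 1 / real (Suc j)" "f (1 + 1 / real (Suc j)) x - f 1 x = (1 + 1 / real (Suc j) - 1) * G z x"
      by blast
    have "s j x = G z x" unfolding s_def z(3) by simp
    then show ?thesis using bound[of z x] z(1,2) r(2)[of j] by auto
  qed
  have sl: "(\<lambda>j. s j x) \<longlonglongrightarrow> G 1 x" for x
  proof -
    have "((\<lambda>h. (f (1 + h) x - f 1 x) / h) \<longlongrightarrow> G 1 x) (at 0)"
      using deriv[of 1 x] unfolding f_def DERIV_def by simp
    moreover have "filterlim (\<lambda>j. 1 / real (Suc j)) (at 0) sequentially"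
      unfolding filterlim_at by (auto intro!: LIMSEQ_Suc[OF lim_1_over_n] simp del: of_nat_Suc)
    ultimately have "(\<lambda>j. (f (1 + 1 / real (Suc j)) x - f 1 x) / (1 / real (Suc j))) \<longlonglongrightarrow> G 1 x"
      by (rule filterlim_compose)
    then show ?thesis by (simp add: s_def mult.commute)
  qed
  have "(\<lambda>j. integral\<^sup>L lborel (s j)) \<longlonglongrightarrow> integral\<^sup>L lborel (G 1)"
    by (rule integral_dominated_convergence[where w=w]) (use G1 sm w sl sb in auto)
  then show ?thesis unfolding s0 using LIMSEQ_unique[OF tendsto_const] by metis
qed

text \<open>Half of the quadratic form is spent on the cross term with \<mu>; the other half leaves
  one Gaussian that dominates simultaneously for all \<open>r \<ge> 1\<close>.\<close>

lemma exp_neg_square_dist_le: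
  fixes x \<mu> :: "'a::real_inner" and r :: real
  assumes "1 \<le> r"
  shows "gauss_kernel (r *\<^sub>R x - \<mu>) \<le> exp ((norm \<mu>)\<^sup>2 / 2) * exp (- (1 / 4) * (norm x)\<^sup>2)"
proof -
  \<comment> \<open>Nonnegativity of this square is \<open>2 * inner u \<mu> \<le> inner u u / 2 + 2
    * inner \<mu> \<mu>\<close> for \<open>u = r *\<^sub>R x\<close>.\<close>
  have "0 \<le> (norm ((1 / sqrt 2) *\<^sub>R (r *\<^sub>R x) - sqrt 2 *\<^sub>R \<mu>))\<^sup>2" by simp
  also have "\<dots> = r\<^sup>2 * inner x x / 2 - 2 * r * inner x \<mu> + 2 * inner \<mu> \<mu>"
    unfolding power2_norm_eq_inner by (simp add: algebra_simps inner_commute power2_eq_square)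
  finally have "r\<^sup>2 * inner x x / 2 - inner \<mu> \<mu> \<le> r\<^sup>2 * inner x x - 2 * r * inner x \<mu> + inner \<mu> \<mu>" by linarith
  also have "\<dots> = (norm (r *\<^sub>R x - \<mu>))\<^sup>2"
    unfolding power2_norm_eq_inner by (simp add: algebra_simps inner_commute power2_eq_square)
  finally have "r\<^sup>2 * inner x x / 2 - inner \<mu> \<mu> \<le> (norm (r *\<^sub>R x - \<mu>))\<^sup>2" .
  moreover have "1 * inner x x \<le> r\<^sup>2 * inner x x" using assms by (intro mult_right_mono) auto
  ultimately have "- (norm (r *\<^sub>R x - \<mu>))\<^sup>2 / 2 \<le> inner \<mu> \<mu> / 2 + - (1/4) * inner x x" by linarith
  then show ?thesis unfolding exp_add[symmetric] power2_norm_eq_inner[of x] power2_norm_eq_inner[of \<mu>] by simp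
qed

lemma integrable_times_gaussian:
  fixes g :: "'a::euclidean_space \<Rightarrow> real"
  assumes [measurable]: "g \<in> borel_measurable borel" and g: "\<And>x. \<bar>g x\<bar> \<le> C * (1 + (norm x)\<^sup>2) ^ N"
  shows "integrable lborel (\<lambda>x. g x * gauss_kernel (x - \<mu>))"
proof (rule Bochner_Integration.integrable_bound)
  let ?w = "\<lambda>x. (C * exp ((norm \<mu>)\<^sup>2 / 2)) * ((1 + (norm x)\<^sup>2) ^ N * exp (- (1/4) * (norm x)\<^sup>2))"
  show "integrable lborel (\<lambda>x::'a. (?w x))"
    by (intro integrable_mult_right integrable_polynomial_gaussian) simp
  show "AE x in lborel. norm (g x * gauss_kernel (x - \<mu>))
    \<le> norm (?w x)"
  proof (rule AE_I2)
    fix x :: 'a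
    have "norm (g x * gauss_kernel (x - \<mu>)) = \<bar>g x\<bar> * gauss_kernel (1 *\<^sub>R x - \<mu>)" by (simp add: abs_mult)
    also have "\<dots> \<le> (C * (1 + (norm x)\<^sup>2) ^ N) * (exp ((norm \<mu>)\<^sup>2 / 2) * exp (- (1 / 4) * (norm x)\<^sup>2))"
      using order_trans[OF abs_ge_zero g] by (intro mult_mono g exp_neg_square_dist_le) auto
    also have "\<dots> \<le> norm (?w x)"
      by (simp add: mult_ac)
    finally show "norm (g x * gauss_kernel (x - \<mu>))
    \<le> norm (?w x)" .
  qed
qed measurable

text \<open>Integration by parts against the Gaussian centred at \<mu> for the field
  \<open>k ((norm x)\<^sup>2) *\<^sub>R x\<close>, whose divergence is given by the first two
  summands. It is the dilation lemma for \<open>k\<close> times the Gaussian; the polynomial bounds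
  supply the dominating function.\<close>

lemma stein_identity_radial:
  fixes \<mu> :: "'a::euclidean_space" and k k' :: "real \<Rightarrow> real"
  assumes k: "\<And>t. (k has_real_derivative k' t) (at t)"
    and k'[measurable]: "k' \<in> borel_measurable borel"
    and bd: "\<And>t. 0 \<le> t \<Longrightarrow> \<bar>k t\<bar> \<le> C * (1 + t) ^ N" "\<And>t. 0 \<le> t \<Longrightarrow> \<bar>k' t\<bar> \<le> C * (1 + t) ^ N"
  shows "(\<integral>x. (DIM('a) * k ((norm x)\<^sup>2) + 2 * (norm x)\<^sup>2 * k' ((norm x)\<^sup>2) - k ((norm x)\<^sup>2) * inner x (x - \<mu>))
    * gauss_kernel (x - \<mu>) \<partial>lborel) = 0"
proof -
  have km[measurable]: "k \<in> borel_measurable borel"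
    using k by (intro borel_measurable_continuous_onI) (meson DERIV_isCont continuous_at_imp_continuous_on)
  have C0: "C \<ge> 0" using bd(1)[of 0] by simp
  define d where "d = DIM('a)"
  define F where "F x = k ((norm x)\<^sup>2) * gauss_kernel (x - \<mu>)" for x
  \<comment> \<open>The derivative in \<open>r\<close> with \<open>r ^ (d - 1)\<close> factored out,
    so that \<open>r = 1\<close> yields the integrand of the claim and every other factor is
    evaluated at the dilated point.\<close>
  define G where "G r x = r ^ (d - 1) * ((d * k (r\<^sup>2 * (norm x)\<^sup>2) + 2 * (r\<^sup>2 * (norm x)\<^sup>2) * k' (r\<^sup>2 * (norm x)\<^sup>2)
     - k (r\<^sup>2 * (norm x)\<^sup>2) * inner (r *\<^sub>R x) (r *\<^sub>R x - \<mu>)) * gauss_kernel (r *\<^sub>R x - \<mu>))" for r x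
  \<comment> \<open>For \<open>r \<le> 2\<close> the square of \<open>r\<close> is at most 4, which
    produces \<open>4 ^ N\<close>; the 16 is 8 from the term with \<open>k'\<close> plus 8 from the
    bound on the inner product.\<close>
  define w where "w x = (2 ^ d * exp ((norm \<mu>)\<^sup>2 / 2) * (d + 16 + (norm \<mu>)\<^sup>2) * (C * 4 ^ N)) * ((1 + (norm x)\<^sup>2) ^ (N + 1) * exp (- (1/4) * (norm x)\<^sup>2))" for x :: 'a
  have "(\<integral>x. G 1 x \<partial>lborel) = 0"
  proof (rule integral_dilation_derivative)
    show "integrable lborel F" unfolding F_def
      by (rule integrable_times_gaussian[where C=C and N=N]) (use bd(1) in auto)
    show "integrable lborel w" unfolding w_def
      by (intro integrable_mult_right integrable_polynomial_gaussian) simp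
    show "G 1 \<in> borel_measurable borel" unfolding G_def[abs_def] by measurable
  next
    fix r :: real and x :: 'a
    assume r: "1 \<le> r" "r \<le> 2"
    define t where "t = (norm x)\<^sup>2"
    define e where "e = inner x \<mu>"
    define q where "q = (norm \<mu>)\<^sup>2"
    let ?E = "\<lambda>r. exp (- (r\<^sup>2 * t - 2 * r * e + q) / 2)"
    have nr: "(norm (r *\<^sub>R x))\<^sup>2 = r\<^sup>2 * t" for r by (simp add: t_def power_mult_distrib)
    have ne: "- (norm (r *\<^sub>R x - \<mu>))\<^sup>2 / 2 = - (r\<^sup>2 * t - 2 * r * e + q) / 2" for r
      unfolding t_def e_def q_def power2_norm_eq_inner by (simp add: algebra_simps inner_commute power2_eq_square)
    have ni: "inner (r *\<^sub>R x) (r *\<^sub>R x - \<mu>) = r\<^sup>2 * t - r * e" for r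
      unfolding t_def e_def power2_norm_eq_inner by (simp add: algebra_simps inner_commute power2_eq_square)
    have dp: "d > 0" by (simp add: d_def)
    have Fr: "F (r *\<^sub>R x) = k (r\<^sup>2 * t) * (?E r)" for r
      unfolding F_def nr ne ..
    have dk: "((\<lambda>r. k (r\<^sup>2 * t)) has_real_derivative k' (r\<^sup>2 * t) * (2 * r * t)) (at r)"
      by (rule DERIV_chain2[OF k]) (auto intro!: derivative_eq_intros)
    have de: "((\<lambda>r. (?E r)) has_real_derivative
       (?E r) * (- (r * t - e))) (at r)"
      by (auto intro!: derivative_eq_intros simp: field_simps)
    have dr: "((\<lambda>r. r ^ d) has_real_derivative real d * r ^ (d - 1)) (at r)"
      by (auto intro!: derivative_eq_intros)
    have "((\<lambda>r. r ^ d * F (r *\<^sub>R x)) has_real_derivative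
      (real d * r ^ (d - 1)) * (k (r\<^sup>2 * t) * (?E r))
      + (k' (r\<^sup>2 * t) * (2 * r * t) * (?E r) + (?E r) * (- (r * t - e)) * k (r\<^sup>2 * t)) * r ^ d) (at r)"
      unfolding Fr by (intro DERIV_mult dr dk de)
    moreover have "(real d * r ^ (d - 1)) * (k (r\<^sup>2 * t) * (?E r))
      + (k' (r\<^sup>2 * t) * (2 * r * t) * (?E r) + (?E r) * (- (r * t - e)) * k (r\<^sup>2 * t)) * r ^ d = G r x"
    proof -
      have rd: "r ^ d = r ^ (d - 1) * r" using dp by (cases d) auto
      show ?thesis unfolding G_def ni ne t_def[symmetric] rd by (simp add: algebra_simps power2_eq_square)
    qed
    ultimately show "((\<lambda>r. r ^ DIM('a) * F (r *\<^sub>R x)) has_real_derivative G r x) (at r)" by (simp only: d_def)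
    have t0: "t \<ge> 0" by (simp add: t_def)
    define E where "E = C * (4 ^ N * (1 + t) ^ N)"
    have r2: "0 \<le> r\<^sup>2" "r\<^sup>2 \<le> 4" using power_mono[OF r(2), of 2] r(1) by auto
    then have rt: "r\<^sup>2 * t \<le> 4 * t" "0 \<le> r\<^sup>2 * t" using t0 by (auto intro: mult_right_mono)
    have "(1 + r\<^sup>2 * t) ^ N \<le> (4 * (1 + t)) ^ N" using rt t0 by (intro power_mono) auto
    then have "C * (1 + r\<^sup>2 * t) ^ N \<le> E" unfolding E_def power_mult_distrib[symmetric] using C0 by (rule mult_left_mono)
    then have kE: "\<bar>k (r\<^sup>2 * t)\<bar> \<le> E" "\<bar>k' (r\<^sup>2 * t)\<bar> \<le> E" using bd[OF rt(2)] by auto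
    have E0: "E \<ge> 0" using C0 t0 by (simp add: E_def)
    have ie: "\<bar>r\<^sup>2 * t - r * e\<bar> \<le> (8 + q) * (1 + t)"
    proof -
      have "\<bar>e\<bar> \<le> norm x * norm \<mu>" unfolding e_def by (rule Cauchy_Schwarz_ineq2)
      then have "\<bar>r * e\<bar> \<le> 2 * (norm x * norm \<mu>)" unfolding abs_mult using r by (intro mult_mono) auto
      also have "\<dots> \<le> t + q"
        using sum_squares_bound[of "norm x" "norm \<mu>"] by (simp add: t_def q_def)
      finally have "\<bar>r\<^sup>2 * t - r * e\<bar> \<le> 4 * t + (t + q)" using rt by linarith
      also have "\<dots> \<le> (8 + q) * (1 + t)" using t0 by (simp add: algebra_simps q_def)
      finally show ?thesis .
    qed
    have "\<bar>d * k (r\<^sup>2 * t) + 2 * (r\<^sup>2 * t) * k' (r\<^sup>2 * t) - k (r\<^sup>2 * t) * (r\<^sup>2 * t - r * e)\<bar>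
       \<le> \<bar>d * k (r\<^sup>2 * t)\<bar> + \<bar>2 * (r\<^sup>2 * t) * k' (r\<^sup>2 * t)\<bar> + \<bar>k (r\<^sup>2 * t) * (r\<^sup>2 * t - r * e)\<bar>" by linarith
    also have "\<dots> \<le> d * (1 + t) * E + 8 * (1 + t) * E + E * ((8 + q) * (1 + t))"
    proof (intro add_mono)
      have "\<bar>d * k (r\<^sup>2 * t)\<bar> \<le> d * E" using kE(1) by (simp add: abs_mult mult_left_mono)
      also have "\<dots> \<le> d * (1 + t) * E" using E0 t0 by (intro mult_right_mono) (auto simp: algebra_simps)
      finally show "\<bar>d * k (r\<^sup>2 * t)\<bar> \<le> d * (1 + t) * E" .
      show "\<bar>2 * (r\<^sup>2 * t) * k' (r\<^sup>2 * t)\<bar> \<le> 8 * (1 + t) * E"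
        unfolding abs_mult[of "2 * (r\<^sup>2 * t)"]
      proof (rule mult_mono)
        have "\<bar>2 * y\<bar> \<le> 8 * (1 + t)" if "y \<le> 4 * t" "0 \<le> y" for y using that by simp
        then show "\<bar>2 * (r\<^sup>2 * t)\<bar> \<le> 8 * (1 + t)" using rt .
      qed (use kE(2) t0 in auto)
      show "\<bar>k (r\<^sup>2 * t) * (r\<^sup>2 * t - r * e)\<bar> \<le> E * ((8 + q) * (1 + t))"
        unfolding abs_mult using kE(1) ie E0 by (intro mult_mono) auto
    qed
    also have "\<dots> = (d + 16 + q) * (C * 4 ^ N) * (1 + t) ^ (N + 1)" by (simp add: E_def algebra_simps)
    finally have p: "\<bar>d * k (r\<^sup>2 * t) + 2 * (r\<^sup>2 * t) * k' (r\<^sup>2 * t) - k (r\<^sup>2 * t) * (r\<^sup>2 * t - r * e)\<bar>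
      \<le> (d + 16 + q) * (C * 4 ^ N) * (1 + t) ^ (N + 1)" .
    have rd: "\<bar>r ^ (d - 1)\<bar> \<le> 2 ^ d"
    proof -
      have "r ^ (d - 1) \<le> 2 ^ (d - 1)" using r by (intro power_mono) auto
      also have "\<dots> \<le> 2 ^ d" by (intro power_increasing) auto
      finally show ?thesis using r by simp
    qed
    have ex: "\<bar>gauss_kernel (r *\<^sub>R x - \<mu>)\<bar> \<le> exp (q / 2) * exp (- (1/4) * t)"
      using exp_neg_square_dist_le[OF r(1), of x \<mu>] by (simp add: t_def q_def)
    have "\<bar>G r x\<bar> = \<bar>r ^ (d - 1)\<bar> * (\<bar>d * k (r\<^sup>2 * t) + 2 * (r\<^sup>2 * t) * k' (r\<^sup>2 * t) - k (r\<^sup>2 * t) * (r\<^sup>2 * t - r * e)\<bar>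
       * \<bar>gauss_kernel (r *\<^sub>R x - \<mu>)\<bar>)"
      unfolding G_def ni t_def[symmetric] by (simp only: abs_mult)
    also have "\<dots> \<le> 2 ^ d * (((d + 16 + q) * (C * 4 ^ N) * (1 + t) ^ (N + 1)) * (exp (q / 2) * exp (- (1/4) * t)))"
      by (intro mult_mono rd p ex mult_nonneg_nonneg) (use C0 t0 in \<open>auto simp: q_def intro!: mult_nonneg_nonneg add_nonneg_nonneg\<close>)
    also have "\<dots> = w x" unfolding w_def t_def q_def by (simp only: mult_ac)
    finally show "\<bar>G r x\<bar> \<le> w x" .
  qed
  then show ?thesis by (simp add: G_def d_def)
qed

section \<open>The improving correction and inadmissibility\<close>

text \<open>The correction contains the reciprocal of the marginal as a factor; polynomial growth of
  it is what brings the correction within the scope of Stein's identity.\<close>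

lemma inverse_mixing_mass_le:
  assumes "a < -1" "b > -1"
  obtains C N where "C > 0" "\<And>t. 0 \<le> t \<Longrightarrow> 1 / mixing_mass a b c t \<le> C * (1 + t) ^ N"
proof -
  obtain C1 where C1: "C1 > 0" "\<And>t. 0 \<le> t \<Longrightarrow>
    C1 * ((t + 1) powr (a + 1) * slow_log t powr c) \<le> mixing_mass a b c t"
    using mixing_mass_ge[OF assms] by metis
  obtain C2 where C2: "C2 > 0" "\<And>t g. 0 \<le> t \<Longrightarrow> t \<le> g \<Longrightarrow>
       slow_log g powr (- c) \<le> C2 * ((g + 1) / (t + 1)) powr 1 * slow_log t powr (- c)"
    using slow_log_powr_potter[of 1 "- c"] by (metis zero_less_one)
  obtain N :: nat where N: "- a \<le> real N" using real_arch_simple by blast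
  have "1 / mixing_mass a b c t \<le> C2 / C1 * (1 + t) ^ N" if t: "0 \<le> t" for t
  proof -
    define l where "l = slow_log t"
    have l: "l > 0" using t by (auto simp: l_def intro!: add_nonneg_pos)
    have lc: "l powr (- c) \<le> C2 * (t + 1)" using C2(2)[of 0 t] t by (simp add: l_def)
    have "1 / mixing_mass a b c t \<le> 1 / (C1 * ((t + 1) powr (a + 1) * l powr c))"
      using C1 t l mixing_mass_pos[OF assms] by (intro divide_left_mono) (auto simp: l_def)
    also have "\<dots> = 1 / C1 * ((t + 1) powr (- a - 1) * l powr (- c))"
      by (simp add: powr_minus powr_diff powr_add divide_inverse)
    also have "\<dots> \<le> 1 / C1 * ((t + 1) powr (- a - 1) * (C2 * (t + 1)))"
      using lc C1(1) by (intro mult_left_mono) auto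
    also have "\<dots> = C2 / C1 * (t + 1) powr (- a)" using t by (simp add: powr_diff)
    also have "\<dots> \<le> C2 / C1 * (t + 1) powr (real N)"
      using N t C1(1) C2(1) by (intro mult_left_mono powr_mono) auto
    also have "\<dots> = C2 / C1 * (1 + t) ^ N" using t by (simp add: powr_realpow add.commute)
    finally show ?thesis .
  qed
  then show ?thesis using that[of "C2 / C1" N] C1(1) C2(1) by simp
qed

text \<open>Squaring removes the kink of the positive part at \<open>t = 1\<close>, so that the
  correction can vanish for \<open>t \<le> 1\<close> and still be differentiable on the whole
  line.\<close>

lemma positive_part_square_derivative:
  "((\<lambda>t::real. (max 0 (t - 1))\<^sup>2) has_real_derivative 2 * max 0 (t - 1)) (at t)"
proof -
  consider "t < 1" | "t > 1" | "t = 1" by linarith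
  then show ?thesis
  proof cases
    case 1
    have "((\<lambda>_. 0) has_real_derivative 0) (at t)" by simp
    then have "((\<lambda>t. (max 0 (t - 1))\<^sup>2) has_real_derivative 0) (at t)"
      by (rule has_field_derivative_transform_within_open[of _ _ _ "{..<1}"]) (use 1 in auto)
    then show ?thesis using 1 by simp
  next
    case 2
    have "((\<lambda>t. (t - 1)\<^sup>2) has_real_derivative 2 * (t - 1)) (at t)" by (auto intro!: derivative_eq_intros)
    then have "((\<lambda>t. (max 0 (t - 1))\<^sup>2) has_real_derivative 2 * (t - 1)) (at t)"
      by (rule has_field_derivative_transform_within_open[of _ _ _ "{1<..}"]) (use 2 in auto)
    then show ?thesis using 2 by simp
  next
    case 3
    have "((\<lambda>h::real. (max 0 h)\<^sup>2 / h) \<longlongrightarrow> 0) (at 0)"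
    proof (rule Lim_null_comparison)
      show "\<forall>\<^sub>F h in at 0. norm ((max 0 h)\<^sup>2 / h) \<le> \<bar>h\<bar>"
        by (intro always_eventually allI) (auto simp: max_def power2_eq_square)
      show "((\<lambda>h::real. \<bar>h\<bar>) \<longlongrightarrow> 0) (at 0)" by (auto intro!: tendsto_eq_intros)
    qed
    then show ?thesis using 3 by (simp add: DERIV_def)
  qed
qed

text \<open>The correction \<open>k\<close> solves the differential inequality obtained from Stein's unbiased
  estimate of the risk difference. With \<open>u = 1 / (t powr D * m t)\<close> and \<open>k = f * u\<close> it reads
  \<open>4 * f' / f\<^sup>2 \<ge> u\<close>; here \<open>1 / f = 1 / p + K / 4\<close> with \<open>K' = - u\<close>, which stays positive
  because \<open>u\<close> is integrable at infinity, and the term \<open>1 / p\<close> switches \<open>k\<close> off near the origin.\<close>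

lemma stein_correction_exists:
  fixes a b c D :: real
  assumes ab: "a < -1" "b > -1" and D: "D \<ge> 0"
    and fin: "(\<integral>\<^sup>+ t\<in>{1..}. ennreal (1 / (t powr D * mixing_mass a b c t)) \<partial>lborel) < \<infinity>"
  obtains k k' :: "real \<Rightarrow> real" and C N where
    "\<And>t. (k has_real_derivative k' t) (at t)" "k' \<in> borel_measurable borel"
    "\<And>t. 0 \<le> t \<Longrightarrow> \<bar>k t\<bar> \<le> C * (1 + t) ^ N" "\<And>t. 0 \<le> t \<Longrightarrow> \<bar>k' t\<bar> \<le> C * (1 + t) ^ N"
    "\<And>t. 0 \<le> t \<Longrightarrow> 0 \<le> 4 * D * k t + 4 * t * k' t - 2 * t * k t * (mixing_mass (a - 1) b c t / mixing_mass a b c t) - t * (k t)\<^sup>2"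
    "\<And>t. 1 < t \<Longrightarrow> 0 < 4 * D * k t + 4 * t * k' t - 2 * t * k t * (mixing_mass (a - 1) b c t / mixing_mass a b c t) - t * (k t)\<^sup>2"
proof -
  define m where "m = mixing_mass a b c"
  define m1 where "m1 = mixing_mass (a - 1) b c"
  have m: "m t > 0" for t unfolding m_def using ab by (rule mixing_mass_pos)
  have m1: "0 \<le> m1 t" "m1 t \<le> m t" for t
    unfolding m_def m1_def using mixing_mass_minus_one_le[OF ab] by auto
  have dm: "(m has_real_derivative - m1 t / 2) (at t)" for t
    unfolding m_def m1_def using ab by (rule mixing_mass_has_derivative)
  have cm: "isCont m t" for t using dm by (rule DERIV_isCont)
  have [measurable]: "m \<in> borel_measurable borel" "m1 \<in> borel_measurable borel"
    unfolding m_def m1_def using ab by (auto intro!: mixing_mass_measurable)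
  \<comment> \<open>\<open>max 1 t\<close> extends the function \<open>u\<close> continuously from
    \<open>t \<ge> 1\<close> to the whole line, where an antiderivative then exists.\<close>
  define q where "q t = 1 / (max 1 t powr D * m t)" for t
  have q0: "q t > 0" for t using m[of t] by (simp add: q_def)
  have cq: "isCont q t" for t
    unfolding q_def using cm m[of t] by (intro continuous_intros) auto
  have [measurable]: "q \<in> borel_measurable borel"
    using cq by (intro borel_measurable_continuous_onI continuous_at_imp_continuous_on) auto
  obtain Q where Q: "\<And>t. (Q has_real_derivative q t) (at t)"
    using einterval_antiderivative[of "-\<infinity>" "\<infinity>" q] cq
    by (auto simp: has_real_derivative_iff_has_vector_derivative)
  define I where "I = (\<integral>\<^sup>+ t\<in>{1..}. ennreal (1 / (t powr D * m t)) \<partial>lborel)"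
  define B where "B = enn2real I"
  have IB: "I = ennreal B" using fin unfolding B_def I_def m_def by (simp add: less_top)
  have QB: "Q t - Q 1 \<le> B" if t: "1 \<le> t" for t
  proof -
    have "(q has_integral (Q t - Q 1)) {1..t}"
      using Q t by (intro fundamental_theorem_of_calculus)
        (auto simp flip: has_real_derivative_iff_has_vector_derivative intro: has_field_derivative_at_within)
    then have "(\<integral>\<^sup>+ s. ennreal (q s) * indicator {1..t} s \<partial>lborel) = ennreal (Q t - Q 1)"
      using q0 by (intro nn_integral_has_integral_lebesgue') (auto intro: less_imp_le)
    moreover have "(\<integral>\<^sup>+ s. ennreal (q s) * indicator {1..t} s \<partial>lborel) \<le> I"
      unfolding I_def by (intro nn_integral_mono) (auto simp: indicator_def q_def max_def)
    ultimately have "ennreal (Q t - Q 1) \<le> ennreal B" by (simp add: IB)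
    then show ?thesis by (simp add: B_def)
  qed
  \<comment> \<open>The tail integral of \<open>q\<close> beyond \<open>t\<close>, for
    \<open>t \<ge> 1\<close>. Its nonnegativity is where the finiteness of the integral
    enters.\<close>
  define K where "K t = B + Q 1 - Q t" for t
  have K0: "0 \<le> K t" if "1 \<le> t" for t using QB[OF that] by (simp add: K_def)
  have dK: "(K has_real_derivative - q t) (at t)" for t
    unfolding K_def using Q by (auto intro!: derivative_eq_intros)
  define p where "p t = (max 0 (t - 1))\<^sup>2" for t :: real
  define p' where "p' t = 2 * max 0 (t - 1)" for t :: real
  have dp: "(p has_real_derivative p' t) (at t)" for t
    unfolding p_def p'_def by (rule positive_part_square_derivative)
  \<comment> \<open>This stands for \<open>p / f\<close>, so that
    \<open>1 / f = 1 / p + K / 4\<close> is realised without dividing by \<open>p\<close> where it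
    vanishes; \<open>w \<ge> 1\<close> also gives \<open>f \<le> p\<close>.\<close>
  define w where "w t = 1 + p t * K t / 4" for t
  have w1: "w t \<ge> 1" for t using K0[of t] by (cases "1 \<le> t") (auto simp: w_def p_def)
  define f where "f t = p t / w t" for t
  define f' where "f' t = (p' t + (p t)\<^sup>2 * q t / 4) / (w t)\<^sup>2" for t
  have df: "(f has_real_derivative f' t) (at t)" for t
  proof -
    have dw: "(w has_real_derivative (p' t * K t - p t * q t) / 4) (at t)"
      unfolding w_def using dp dK by (auto intro!: derivative_eq_intros)
    have "((\<lambda>t. p t / w t) has_real_derivative (p' t * w t - p t * ((p' t * K t - p t * q t) / 4)) / (w t * w t)) (at t)"
      using w1[of t] by (intro DERIV_divide dp dw) auto
    \<comment> \<open>The terms with \<open>K\<close> cancel in the quotient rule.\<close>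
    moreover have "p' t * w t - p t * ((p' t * K t - p t * q t) / 4) = p' t + (p t)\<^sup>2 * q t / 4"
      by (simp add: w_def field_simps power2_eq_square)
    ultimately show ?thesis unfolding f_def f'_def by (simp add: power2_eq_square)
  qed
  have pz: "p t = 0" "p' t = 0" if "t \<le> 1" for t using that by (auto simp: p_def p'_def)
  have fz: "f t = 0" "f' t = 0" if "t \<le> 1" for t using pz[OF that] by (auto simp: f_def f'_def)
  define u where "u t = t powr (- D) / m t" for t
  define u' where "u' t = u t * (m1 t / (2 * m t) - D / t)" for t
  have du: "(u has_real_derivative u' t) (at t)" if t: "t > 0" for t
  proof -
    have d1: "((\<lambda>t. t powr (- D)) has_real_derivative - D * t powr (- D - 1)) (at t)"
      using t by (auto intro!: derivative_eq_intros)
    have "((\<lambda>t. t powr (- D) / m t) has_real_derivative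
        (- D * t powr (- D - 1) * m t - t powr (- D) * (- m1 t / 2)) / (m t * m t)) (at t)"
      using m[of t] by (intro DERIV_divide d1 dm) auto
    moreover have "(- D * t powr (- D - 1) * m t - t powr (- D) * (- m1 t / 2)) / (m t * m t) = u' t"
      using t m[of t] by (simp add: u'_def u_def powr_diff field_simps)
    ultimately show ?thesis unfolding u_def by simp
  qed
  define k where "k t = f t * u t" for t
  define k' where "k' t = f' t * u t + u' t * f t" for t
  have kz: "k t = 0" "k' t = 0" if "t \<le> 1" for t using fz[OF that] by (auto simp: k_def k'_def)
  have dk: "(k has_real_derivative k' t) (at t)" for t
  proof (cases "t > 0")
    case True
    then show ?thesis unfolding k_def k'_def using df du by (intro DERIV_mult) auto
  next
    case False
    have "((\<lambda>_. 0) has_real_derivative 0) (at t)" by simp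
    then have "(k has_real_derivative 0) (at t)"
      by (rule has_field_derivative_transform_within_open[of _ _ _ "{..<1}"]) (use False kz in auto)
    then show ?thesis using kz[of t] False by simp
  qed
  have [measurable]: "K \<in> borel_measurable borel"
    by (intro borel_measurable_continuous_onI continuous_at_imp_continuous_on ballI DERIV_isCont[OF dK])
  have mk': "k' \<in> borel_measurable borel"
    unfolding k'_def[abs_def] f'_def f_def u'_def u_def w_def p_def p'_def by measurable
  obtain C0 N0 where C0: "C0 > 0" "\<And>t. 0 \<le> t \<Longrightarrow> 1 / m t \<le> C0 * (1 + t) ^ N0"
    unfolding m_def using inverse_mixing_mass_le[OF ab, of c] by metis
  \<comment> \<open>The 4 comes from the square of \<open>p\<close>, itself of degree 2, and each of
    the factors \<open>q\<close> and \<open>u\<close> adds \<open>N0\<close>. The three summands of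
    \<open>C\<close> belong to \<open>k\<close> and to the two products in
    \<open>k'\<close>.\<close>
  define N where "N = 4 + N0 + N0"
  define C where "C = C0 + (2 + C0) * C0 + C0 * (1 + D)"
  have bounds: "\<bar>k t\<bar> \<le> C * (1 + t) ^ N \<and> \<bar>k' t\<bar> \<le> C * (1 + t) ^ N" if t: "0 \<le> t" for t
  proof (cases "t \<le> 1")
    case True
    have "0 \<le> C * (1 + t) ^ N" using C0(1) D t by (simp add: C_def)
    then show ?thesis using kz[OF True] by simp
  next
    case False
    define s where "s = 1 + t"
    have s: "s \<ge> 1" "t \<ge> 1" using False t by (auto simp: s_def)
    have u0: "0 \<le> u t" using m[of t] by (simp add: u_def)
    have "t powr (- D) \<le> 1" using s(2) D powr_mono[of "- D" 0 t] by simp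
    then have "u t \<le> 1 / m t" unfolding u_def using m[of t] by (intro divide_right_mono) auto
    then have uC: "u t \<le> C0 * s ^ N0" using C0(2)[OF t] by (simp add: s_def)
    have qu: "q t = u t" using s(2) m[of t] by (simp add: q_def u_def powr_minus max_def divide_inverse)
    have p0: "0 \<le> p t" "p t \<le> s ^ 2" "0 \<le> p' t" "p' t \<le> 2 * s"
      using s by (auto simp: p_def p'_def s_def intro!: power_mono)
    have f0: "0 \<le> f t" unfolding f_def using p0 w1[of t] by simp
    have "f t \<le> p t / 1" unfolding f_def using p0 w1[of t] by (intro divide_left_mono) auto
    then have f1: "f t \<le> s ^ 2" using p0 by simp
    have "f' t \<le> (p' t + (p t)\<^sup>2 * q t / 4) / 1"
      unfolding f'_def using p0 w1[of t] q0[of t] by (intro divide_left_mono) (auto simp: one_le_power)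
    also have "\<dots> \<le> 2 * s + (s ^ 2)\<^sup>2 * (C0 * s ^ N0)"
    proof -
      have "(p t)\<^sup>2 * q t \<le> (s ^ 2)\<^sup>2 * (C0 * s ^ N0)"
        unfolding qu using p0 uC u0 by (intro mult_mono power_mono) auto
      moreover have "0 \<le> (p t)\<^sup>2 * q t" using q0[of t] by simp
      ultimately show ?thesis using p0(4) by simp
    qed
    also have "\<dots> \<le> 2 * s ^ (4 + N0) + C0 * s ^ (4 + N0)"
    proof -
      have "s \<le> s ^ (4 + N0)" using power_increasing[of 1 "4 + N0" s] s(1) by simp
      moreover have e: "(s ^ 2)\<^sup>2 * (C0 * s ^ N0) = C0 * s ^ (4 + N0)" by (simp add: power_add flip: power_mult)
      ultimately show ?thesis unfolding e by simp
    qed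
    finally have f'1: "f' t \<le> (2 + C0) * s ^ (4 + N0)" by (simp add: algebra_simps)
    have f'0: "0 \<le> f' t" unfolding f'_def using p0 q0[of t] by (intro divide_nonneg_nonneg) auto
    have v: "\<bar>m1 t / (2 * m t) - D / t\<bar> \<le> 1 + D"
    proof -
      have "0 \<le> m1 t / (2 * m t)" "m1 t / (2 * m t) \<le> 1" using m1[of t] m[of t] by (auto simp: divide_le_eq)
      moreover have "0 \<le> D / t" "D / t \<le> D" using D s(2) by (auto simp: divide_le_eq mult_le_cancel_left1)
      ultimately show ?thesis by linarith
    qed
    have "\<bar>u' t\<bar> = u t * \<bar>m1 t / (2 * m t) - D / t\<bar>" unfolding u'_def using u0 by (simp add: abs_mult)
    also have "\<dots> \<le> (C0 * s ^ N0) * (1 + D)" using uC v u0 by (intro mult_mono) auto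
    finally have u'1: "\<bar>u' t\<bar> \<le> C0 * (1 + D) * s ^ N0" by (simp add: mult_ac)
    have "k t \<le> s ^ 2 * (C0 * s ^ N0)" unfolding k_def using f0 f1 u0 uC by (intro mult_mono) auto
    also have "\<dots> = C0 * s ^ (2 + N0)" by (simp add: power_add power2_eq_square)
    also have "\<dots> \<le> C0 * s ^ N" using s(1) C0(1) by (intro mult_left_mono power_increasing) (auto simp: N_def)
    finally have k1: "k t \<le> C0 * s ^ N" .
    have k0: "0 \<le> k t" unfolding k_def using f0 u0 by simp
    have "\<bar>k' t\<bar> \<le> \<bar>f' t * u t\<bar> + \<bar>u' t * f t\<bar>" unfolding k'_def by (rule abs_triangle_ineq)
    also have "\<dots> \<le> ((2 + C0) * s ^ (4 + N0)) * (C0 * s ^ N0) + (C0 * (1 + D) * s ^ N0) * s ^ 2"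
      unfolding abs_mult using f'0 f'1 u0 uC u'1 f0 f1 C0(1) s(1) by (intro add_mono mult_mono) auto
    also have "\<dots> = (2 + C0) * C0 * s ^ N + C0 * (1 + D) * s ^ (2 + N0)"
    proof -
      have e1: "s ^ N = s ^ (4 + N0) * s ^ N0" by (simp only: N_def power_add)
      have e2: "s ^ (2 + N0) = s ^ N0 * s ^ 2" by (simp only: power_add mult.commute)
      show ?thesis unfolding e1 e2 by (simp only: mult_ac)
    qed
    also have "\<dots> \<le> (2 + C0) * C0 * s ^ N + C0 * (1 + D) * s ^ N"
      using s(1) C0(1) D by (intro add_left_mono mult_left_mono power_increasing) (auto simp: N_def)
    finally have k'1: "\<bar>k' t\<bar> \<le> (2 + C0) * C0 * s ^ N + C0 * (1 + D) * s ^ N" .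
    have sN: "s ^ N \<ge> 0" using s(1) by simp
    have nn: "0 \<le> C0 * s ^ N" "0 \<le> (2 + C0) * C0 * s ^ N" "0 \<le> C0 * (1 + D) * s ^ N"
      using sN C0(1) D by (auto intro!: mult_nonneg_nonneg)
    have "C * s ^ N = C0 * s ^ N + (2 + C0) * C0 * s ^ N + C0 * (1 + D) * s ^ N"
      unfolding C_def by (simp only: distrib_right)
    then show ?thesis unfolding s_def[symmetric] using k0 k1 k'1 nn by linarith
  qed
  \<comment> \<open>The factor \<open>u\<close> solves the linear part: \<open>u'\<close> cancels
    both \<open>4 * D * k\<close> and the term with \<open>m1 / m\<close>. What remains is
    \<open>t * u\<close> times the bracket \<open>4 * f' - f\<^sup>2 * u\<close>, and the choice of
    \<open>f\<close> turns that bracket into \<open>4 * p' / w\<^sup>2\<close>.\<close>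
  have S: "4 * D * k t + 4 * t * k' t - 2 * t * k t * (m1 t / m t) - t * (k t)\<^sup>2 = 4 * t * u t * p' t / (w t)\<^sup>2" if t: "1 \<le> t" for t
  proof -
    have qu: "q t = u t" using t m[of t] by (simp add: q_def u_def powr_minus max_def divide_inverse)
    have ff: "4 * f' t - (f t)\<^sup>2 * u t = 4 * p' t / (w t)\<^sup>2"
      unfolding f'_def f_def qu power_divide by (simp add: diff_divide_distrib[symmetric] add_divide_distrib[symmetric])
    have "4 * D * k t + 4 * t * k' t - 2 * t * k t * (m1 t / m t) - t * (k t)\<^sup>2
      = 4 * t * u t * f' t - t * (f t * u t)\<^sup>2"
    proof -
      have e: "4 * t * (u' t * f t) = 2 * t * (f t * u t) * (m1 t / m t) - 4 * D * (f t * u t)"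
        unfolding u'_def using t by (simp add: field_simps)
      show ?thesis unfolding k_def k'_def distrib_left e by (simp add: algebra_simps)
    qed
    also have "\<dots> = t * u t * (4 * f' t - (f t)\<^sup>2 * u t)" by (simp add: algebra_simps power2_eq_square)
    finally show ?thesis unfolding ff by simp
  qed
  show ?thesis
  proof (rule that[of k k' C N])
    show "(k has_real_derivative k' t) (at t)" for t by (rule dk)
    show "k' \<in> borel_measurable borel" by (rule mk')
    show "\<bar>k t\<bar> \<le> C * (1 + t) ^ N" "\<bar>k' t\<bar> \<le> C * (1 + t) ^ N" if "0 \<le> t" for t
      using bounds[OF that] by auto
    show "0 \<le> 4 * D * k t + 4 * t * k' t - 2 * t * k t * (mixing_mass (a - 1) b c t / mixing_mass a b c t) - t * (k t)\<^sup>2" if "0 \<le> t" for t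
    proof (cases "t \<le> 1")
      case True
      then show ?thesis by (simp add: kz)
    next
      case False
      then have "0 \<le> 4 * t * u t * p' t / (w t)\<^sup>2" using m[of t] by (simp add: u_def p'_def)
      then show ?thesis using S[of t] False by (simp add: m_def m1_def)
    qed
    show "0 < 4 * D * k t + 4 * t * k' t - 2 * t * k t * (mixing_mass (a - 1) b c t / mixing_mass a b c t) - t * (k t)\<^sup>2" if "1 < t" for t
    proof -
      have "0 < u t" "0 < p' t" "0 < (w t)\<^sup>2" using that m[of t] w1[of t] by (auto simp: u_def p'_def)
      then have "0 < 4 * t * u t * p' t / (w t)\<^sup>2" using that by simp
      then show ?thesis using S[of t] that by (simp add: m_def m1_def)
    qed
  qed
qed

text \<open>The correction is used with \<open>D = d / 2\<close>. By Stein's identity the risk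
  decrease is, up to the normalising constant, the integral of \<open>S\<close> against the Gaussian
  kernel. \<open>S\<close> is nonnegative and is positive outside the unit ball, a set of positive
  measure, so the improvement is strict at every parameter.\<close>

lemma inadmissible_of_finite:
  fixes a b c :: real and \<delta> :: "real ^ 'n \<Rightarrow> real ^ 'n"
  assumes ab: "a < -1" "b > -1" and \<delta>: "\<delta> = shrinkage a b c"
    and fin: "(\<integral>\<^sup>+ t\<in>{1..}. ennreal (1 / (t powr (real CARD('n) / 2) * mixing_mass a b c t)) \<partial>lborel) < \<infinity>"
  shows "inadmissible \<delta>"
proof -
  define d where "d = real CARD('n)"
  define \<rho> where "\<rho> t = mixing_mass (a - 1) b c t / mixing_mass a b c t" for t
  have \<rho>: "0 \<le> \<rho> t" "\<rho> t \<le> 1" for t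
    unfolding \<rho>_def using mixing_mass_minus_one_le[OF ab, of c t] mixing_mass_pos[OF ab, of c t] by (auto simp: divide_le_eq)
  have [measurable]: "\<rho> \<in> borel_measurable borel"
    unfolding \<rho>_def using ab by (intro borel_measurable_divide mixing_mass_measurable) auto
  have d0: "0 \<le> real CARD('n) / 2" by simp
  obtain k k' :: "real \<Rightarrow> real" and C N where
    dk: "\<And>t. (k has_real_derivative k' t) (at t)" and k'm[measurable]: "k' \<in> borel_measurable borel" and
    bd: "\<And>t. 0 \<le> t \<Longrightarrow> \<bar>k t\<bar> \<le> C * (1 + t) ^ N" "\<And>t. 0 \<le> t \<Longrightarrow> \<bar>k' t\<bar> \<le> C * (1 + t) ^ N" and
    S0: "\<And>t. 0 \<le> t \<Longrightarrow> 0 \<le> 4 * (d / 2) * k t + 4 * t * k' t - 2 * t * k t * \<rho> t - t * (k t)\<^sup>2" and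
    S1: "\<And>t. 1 < t \<Longrightarrow> 0 < 4 * (d / 2) * k t + 4 * t * k' t - 2 * t * k t * \<rho> t - t * (k t)\<^sup>2"
    by (rule stein_correction_exists[OF ab d0 fin, folded d_def \<rho>_def]) (rule that; assumption)
  have km[measurable]: "k \<in> borel_measurable borel"
    using dk by (intro borel_measurable_continuous_onI) (meson DERIV_isCont continuous_at_imp_continuous_on)
  have C0: "C \<ge> 0" using bd(1)[of 0] by simp
  have \<delta>m[measurable]: "\<delta> \<in> borel_measurable borel" unfolding \<delta> using ab by (rule shrinkage_measurable)
  define \<delta>' where "\<delta>' x = \<delta> x - k ((norm x)\<^sup>2) *\<^sub>R x" for x
  have \<delta>'m[measurable]: "\<delta>' \<in> borel_measurable borel" unfolding \<delta>'_def[abs_def] by measurable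
  have \<delta>x: "\<delta> x = (1 - \<rho> ((norm x)\<^sup>2)) *\<^sub>R x" for x by (simp add: \<delta> shrinkage_def \<rho>_def)
  define S where "S t = 2 * d * k t + 4 * t * k' t - 2 * t * k t * \<rho> t - t * (k t)\<^sup>2" for t
  define \<kappa> where "\<kappa> = (2 * pi) powr (- real CARD('n) / 2)"
  have main: "risk \<mu> \<delta>' < risk \<mu> \<delta>" for \<mu>
  proof -
    define e where "e x = gauss_kernel (x - \<mu>)" for x
    have em[measurable]: "e \<in> borel_measurable borel" unfolding e_def[abs_def] by measurable
    have ep: "e x > 0" for x by (simp add: e_def)
    have int: "integrable lborel (\<lambda>x. g x * e x)"
      if "g \<in> borel_measurable borel" "\<And>x. \<bar>g x\<bar> \<le> C' * (1 + (norm x)\<^sup>2) ^ N'" for g C' N'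
      unfolding e_def using that by (rule integrable_times_gaussian)
    \<comment> \<open>The factor \<open>1 - \<rho>\<close> lies between 0 and 1, so \<delta> grows
      at most linearly and its risk is finite; the strict comparison can be made between real
      integrals.\<close>
    have iR: "integrable lborel (\<lambda>x. (norm (\<delta> x - \<mu>))\<^sup>2 * e x)"
    proof (rule int[of _ "2 + 2 * (norm \<mu>)\<^sup>2" 1])
      fix x :: "real ^ 'n"
      have "norm (\<delta> x) \<le> 1 * norm x" unfolding \<delta>x norm_scaleR using \<rho>[of "(norm x)\<^sup>2"] by (intro mult_right_mono) auto
      then have "norm (\<delta> x - \<mu>) \<le> norm x + norm \<mu>" using norm_triangle_ineq4[of "\<delta> x" \<mu>] by simp
      then have "(norm (\<delta> x - \<mu>))\<^sup>2 \<le> (norm x + norm \<mu>)\<^sup>2" by (intro power_mono) auto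
      also have "\<dots> \<le> 2 * (norm x)\<^sup>2 + 2 * (norm \<mu>)\<^sup>2"
        using zero_le_power2[of "norm x - norm \<mu>"] by (simp add: power2_eq_square algebra_simps)
      also have "\<dots> \<le> (2 + 2 * (norm \<mu>)\<^sup>2) * (1 + (norm x)\<^sup>2) ^ 1" by (simp add: algebra_simps)
      finally show "\<bar>(norm (\<delta> x - \<mu>))\<^sup>2\<bar> \<le> (2 + 2 * (norm \<mu>)\<^sup>2) * (1 + (norm x)\<^sup>2) ^ 1" by simp
    qed measurable
    define g1 where "g1 x = real DIM(real ^ 'n) * k ((norm x)\<^sup>2) + 2 * (norm x)\<^sup>2 * k' ((norm x)\<^sup>2) - k ((norm x)\<^sup>2) * inner x (x - \<mu>)" for x
    have z: "(\<integral>x. g1 x * e x \<partial>lborel) = 0"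
      unfolding g1_def e_def by (rule stein_identity_radial[OF dk k'm bd])
    have bk: "\<bar>k ((norm x)\<^sup>2)\<bar> \<le> C * (1 + (norm x)\<^sup>2) ^ N" "\<bar>k' ((norm x)\<^sup>2)\<bar> \<le> C * (1 + (norm x)\<^sup>2) ^ N" for x :: "real ^ 'n"
      by (auto intro!: bd)
    have i1: "integrable lborel (\<lambda>x. g1 x * e x)"
    proof (rule int[of _ "(d + 2 + (2 + (norm \<mu>)\<^sup>2)) * C" "N + 1"])
      show "g1 \<in> borel_measurable borel" unfolding g1_def[abs_def] by measurable
      fix x :: "real ^ 'n"
      define t where "t = (norm x)\<^sup>2"
      define E where "E = C * (1 + t) ^ N"
      have t: "t \<ge> 0" by (simp add: t_def)
      have E: "E \<ge> 0" using C0 t by (simp add: E_def)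
      have ie: "\<bar>inner x (x - \<mu>)\<bar> \<le> (2 + (norm \<mu>)\<^sup>2) * (1 + t)"
      proof -
        have "\<bar>inner x (x - \<mu>)\<bar> \<le> norm x * norm (x - \<mu>)" by (rule Cauchy_Schwarz_ineq2)
        also have "\<dots> \<le> norm x * (norm x + norm \<mu>)" by (intro mult_left_mono norm_triangle_ineq4) auto
        also have "\<dots> \<le> (2 + (norm \<mu>)\<^sup>2) * (1 + t)"
        proof -
          have "y * (y + z) \<le> (2 + z\<^sup>2) * (1 + y\<^sup>2)" for y z :: real
          proof -
            have "(2 + z\<^sup>2) * (1 + y\<^sup>2) - y * (y + z) = 2 + z\<^sup>2 / 2 + y\<^sup>2 / 2 + (y - z)\<^sup>2 / 2 + (y * z)\<^sup>2"
              by (simp add: power2_eq_square field_simps)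
            moreover have "\<dots> \<ge> 0" by (intro add_nonneg_nonneg) auto
            ultimately show ?thesis by linarith
          qed
          then show ?thesis by (simp add: t_def)
        qed
        finally show ?thesis .
      qed
      have "\<bar>g1 x\<bar> \<le> \<bar>d * k t\<bar> + \<bar>2 * t * k' t\<bar> + \<bar>k t * inner x (x - \<mu>)\<bar>"
        unfolding g1_def t_def[symmetric] by (simp add: d_def)
      also have "\<dots> \<le> d * (1 + t) * E + 2 * (1 + t) * E + E * ((2 + (norm \<mu>)\<^sup>2) * (1 + t))"
      proof (intro add_mono)
        have "\<bar>d * k t\<bar> \<le> d * E" using bk(1)[of x] by (simp add: abs_mult t_def E_def d_def mult_left_mono)
        also have "\<dots> \<le> d * (1 + t) * E" using E t by (intro mult_right_mono) (auto simp: d_def algebra_simps)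
        finally show "\<bar>d * k t\<bar> \<le> d * (1 + t) * E" .
        show "\<bar>2 * t * k' t\<bar> \<le> 2 * (1 + t) * E"
          unfolding abs_mult using bk(2)[of x] t E by (intro mult_mono) (auto simp: t_def E_def)
        show "\<bar>k t * inner x (x - \<mu>)\<bar> \<le> E * ((2 + (norm \<mu>)\<^sup>2) * (1 + t))"
          unfolding abs_mult using bk(1)[of x] ie E by (intro mult_mono) (auto simp: t_def E_def)
      qed
      also have "\<dots> = (d + 2 + (2 + (norm \<mu>)\<^sup>2)) * C * (1 + t) ^ (N + 1)" by (simp add: E_def algebra_simps)
      finally show "\<bar>g1 x\<bar> \<le> (d + 2 + (2 + (norm \<mu>)\<^sup>2)) * C * (1 + (norm x)\<^sup>2) ^ (N + 1)" by (simp add: t_def)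
    qed
    have iS: "integrable lborel (\<lambda>x. S ((norm x)\<^sup>2) * e x)"
    proof (rule int[of _ "(2 * d + 6) * C + C\<^sup>2" "N + N + 1"])
      show "(\<lambda>x::real^'n. S ((norm x)\<^sup>2)) \<in> borel_measurable borel" unfolding S_def by measurable
      fix x :: "real ^ 'n"
      define t where "t = (norm x)\<^sup>2"
      define P where "P = (1 + t) ^ N"
      have t: "t \<ge> 0" by (simp add: t_def)
      have P1: "P \<ge> 1" using t by (simp add: P_def)
      have kP: "\<bar>k t\<bar> \<le> C * P" "\<bar>k' t\<bar> \<le> C * P" using bd[OF t] by (auto simp: P_def)
      have CP: "0 \<le> C * P" using C0 P1 by simp
      have "\<bar>S t\<bar> \<le> \<bar>2 * d * k t\<bar> + \<bar>4 * t * k' t\<bar> + \<bar>2 * t * k t * \<rho> t\<bar> + \<bar>t * (k t)\<^sup>2\<bar>" unfolding S_def by linarith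
      also have "\<dots> \<le> 2 * d * (1 + t) * (C * P) + 4 * (1 + t) * (C * P) + 2 * (1 + t) * (C * P) * 1 + (1 + t) * (C * P)\<^sup>2"
      proof (intro add_mono)
        have "\<bar>2 * d * k t\<bar> \<le> 2 * d * (C * P)" using kP(1) by (simp add: abs_mult d_def mult_left_mono)
        also have "\<dots> \<le> 2 * d * (1 + t) * (C * P)" using CP t by (intro mult_right_mono) (auto simp: d_def algebra_simps)
        finally show "\<bar>2 * d * k t\<bar> \<le> 2 * d * (1 + t) * (C * P)" .
        show "\<bar>4 * t * k' t\<bar> \<le> 4 * (1 + t) * (C * P)"
          unfolding abs_mult using kP t CP by (intro mult_mono) auto
        show "\<bar>2 * t * k t * \<rho> t\<bar> \<le> 2 * (1 + t) * (C * P) * 1"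
          unfolding abs_mult using kP t CP \<rho>[of t] by (intro mult_mono) auto
        have "\<bar>k t\<bar>\<^sup>2 \<le> (C * P)\<^sup>2" using kP(1) by (intro power_mono) auto
        then show "\<bar>t * (k t)\<^sup>2\<bar> \<le> (1 + t) * (C * P)\<^sup>2" using t by (simp add: abs_mult mult_mono)
      qed
      also have "\<dots> = (2 * d + 6) * C * (P * (1 + t)) + C\<^sup>2 * (P * P * (1 + t))"
        by (simp add: algebra_simps power2_eq_square)
      also have "\<dots> \<le> (2 * d + 6) * C * (P * P * (1 + t)) + C\<^sup>2 * (P * P * (1 + t))"
      proof -
        have "1 * P \<le> P * P" using P1 by (intro mult_right_mono) auto
        then have "P * (1 + t) \<le> P * P * (1 + t)" using t by (intro mult_right_mono) auto
        then show ?thesis using C0 by (intro add_right_mono mult_left_mono) (auto simp: d_def)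
      qed
      also have "\<dots> = ((2 * d + 6) * C + C\<^sup>2) * (1 + t) ^ (N + N + 1)" by (simp add: P_def power_add algebra_simps)
      finally show "\<bar>S ((norm x)\<^sup>2)\<bar> \<le> ((2 * d + 6) * C + C\<^sup>2) * (1 + (norm x)\<^sup>2) ^ (N + N + 1)" by (simp add: t_def)
    qed
    \<comment> \<open>After expanding the square, \<mu> occurs in the cross term only through
      \<open>inner x (x - \<mu>)\<close>. Twice the Stein integrand \<open>g1\<close>, of integral
      0, trades this for derivatives of \<open>k\<close>, and the rest is \<open>S\<close>, which is
      free of \<mu>.\<close>
    have pt: "(norm (\<delta>' x - \<mu>))\<^sup>2 * e x = (norm (\<delta> x - \<mu>))\<^sup>2 * e x + 2 * (g1 x * e x) - S ((norm x)\<^sup>2) * e x" for x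
    proof -
      define t where "t = (norm x)\<^sup>2"
      have tt: "inner x x = t" by (simp add: t_def power2_norm_eq_inner)
      have "(norm (\<delta>' x - \<mu>))\<^sup>2 = (norm (\<delta> x - \<mu>))\<^sup>2 - 2 * k t * inner x (\<delta> x - \<mu>) + (k t)\<^sup>2 * t"
        unfolding \<delta>'_def t_def[symmetric] power2_norm_eq_inner tt[symmetric]
        by (simp add: algebra_simps inner_commute power2_eq_square)
      also have "inner x (\<delta> x - \<mu>) = inner x (x - \<mu>) - \<rho> t * t"
        unfolding \<delta>x t_def[symmetric] by (simp add: tt inner_diff_right algebra_simps)
      finally have "(norm (\<delta>' x - \<mu>))\<^sup>2 = (norm (\<delta> x - \<mu>))\<^sup>2 + 2 * g1 x - S t"
        unfolding g1_def S_def t_def[symmetric] by (simp add: d_def algebra_simps)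
      note eq = this
      show ?thesis unfolding t_def[symmetric] eq by (simp add: left_diff_distrib distrib_right)
    qed
    have iR': "integrable lborel (\<lambda>x. (norm (\<delta>' x - \<mu>))\<^sup>2 * e x)"
      unfolding pt using iR i1 iS by (intro Bochner_Integration.integrable_add Bochner_Integration.integrable_diff integrable_mult_right)
    have val: "(\<integral>x. (norm (\<delta>' x - \<mu>))\<^sup>2 * e x \<partial>lborel) = (\<integral>x. (norm (\<delta> x - \<mu>))\<^sup>2 * e x \<partial>lborel) - (\<integral>x. S ((norm x)\<^sup>2) * e x \<partial>lborel)"
      unfolding pt using iR i1 iS z by simp
    have Snn: "S t \<ge> 0" if "0 \<le> t" for t using S0[OF that] by (simp add: S_def)
    have "(\<integral>x. S ((norm x)\<^sup>2) * e x \<partial>lborel) \<noteq> 0"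
    proof
      assume "(\<integral>x. S ((norm x)\<^sup>2) * e x \<partial>lborel) = 0"
      then have "AE x in lborel. S ((norm x)\<^sup>2) * e x = 0"
        using iS Snn ep by (subst (asm) integral_nonneg_eq_0_iff_AE) (auto intro!: AE_I2 mult_nonneg_nonneg less_imp_le[OF ep])
      then have "AE x in lborel. x \<notin> - cball (0 :: real ^ 'n) 1"
      proof eventually_elim
        fix x :: "real ^ 'n" assume s: "S ((norm x)\<^sup>2) * e x = 0"
        show "x \<notin> - cball 0 1"
        proof
          assume "x \<in> - cball 0 1"
          then have "1 < norm x" by simp
          then have "1 < (norm x)\<^sup>2" by (simp add: one_less_power)
          then have "0 < S ((norm x)\<^sup>2)" using S1[of "(norm x)\<^sup>2"] by (simp add: S_def)
          with ep[of x] s show False by simp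
        qed
      qed
      \<comment> \<open>The ball has finite measure and the space infinite measure, so the
        complement cannot be null.\<close>
      then have "emeasure lborel (- cball (0 :: real ^ 'n) 1) = 0"
        by (subst (asm) AE_iff_measurable[of "- cball 0 1"]) auto
      moreover have "emeasure lborel (cball (0 :: real ^ 'n) 1 \<union> - cball 0 1)
          \<le> emeasure lborel (cball (0 :: real ^ 'n) 1) + emeasure lborel (- cball (0 :: real ^ 'n) 1)"
        by (rule emeasure_subadditive) auto
      ultimately have "emeasure lborel (UNIV :: (real ^ 'n) set) \<le> emeasure lborel (cball (0 :: real ^ 'n) 1)" by simp
      also have "\<dots> < \<infinity>" by (rule emeasure_lborel_cball_finite)
      finally show False by simp
    qed
    moreover have "(\<integral>x. S ((norm x)\<^sup>2) * e x \<partial>lborel) \<ge> 0"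
      using Snn ep by (intro integral_nonneg_AE AE_I2 mult_nonneg_nonneg) (auto intro: less_imp_le)
    ultimately have less: "(\<integral>x. (norm (\<delta>' x - \<mu>))\<^sup>2 * e x \<partial>lborel) < (\<integral>x. (norm (\<delta> x - \<mu>))\<^sup>2 * e x \<partial>lborel)"
      unfolding val by linarith
    have \<kappa>: "\<kappa> > 0" by (simp add: \<kappa>_def)
    have r: "risk \<mu> \<eta> = ennreal (\<kappa> * (\<integral>x. (norm (\<eta> x - \<mu>))\<^sup>2 * e x \<partial>lborel))"
      if m: "\<eta> \<in> borel_measurable borel" and i: "integrable lborel (\<lambda>x. (norm (\<eta> x - \<mu>))\<^sup>2 * e x)" for \<eta>
    proof -
      have "(\<integral>\<^sup>+ x. ennreal ((norm (\<eta> x - \<mu>))\<^sup>2 * e x) \<partial>lborel) = ennreal (\<integral>x. (norm (\<eta> x - \<mu>))\<^sup>2 * e x \<partial>lborel)"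
        using i by (rule nn_integral_eq_integral) (auto intro!: AE_I2 mult_nonneg_nonneg less_imp_le[OF ep])
      then show ?thesis
        unfolding risk_eq_nn_integral[OF m] \<kappa>_def[symmetric] e_def[symmetric] using \<kappa> by (simp add: ennreal_mult')
    qed
    have nn: "0 \<le> (\<integral>x. (norm (\<delta>' x - \<mu>))\<^sup>2 * e x \<partial>lborel)"
      by (intro integral_nonneg_AE AE_I2 mult_nonneg_nonneg) (auto intro: less_imp_le[OF ep])
    show ?thesis
      unfolding r[OF \<delta>'m iR'] r[OF \<delta>m iR] using less \<kappa> nn by (intro ennreal_lessI) auto
  qed
  show ?thesis unfolding inadmissible_def estimator_def
    using \<delta>m \<delta>'m main less_imp_le by blast
qed

text \<open>The estimator enters as a posterior mean, so the gradient formula is among the claims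
  and not a definition. Both regimes are tested by nonnegative extended integrals, for which
  divergence means the value infinity.\<close>

theorem theorem1p1:
  fixes a b c :: real and \<delta> :: "real ^ 'n \<Rightarrow> real ^ 'n"
  assumes "a < real CARD('n) / 2 - 1" and "b > -1"
    and "\<delta> = generalized_bayes (prior_density a b c)"
  shows "(\<forall>x. GDERIV (\<lambda>y. ln (marginal CARD('n) a b c ((norm y)\<^sup>2))) x :> (\<delta> x - x)) \<and>
    ((\<integral>\<^sup>+ g\<in>{1..}. ennreal (1 / (g * mixing_density a b c g)) \<partial>lborel) = \<infinity> \<longrightarrow> admissible \<delta>) \<and>
    ((\<integral>\<^sup>+ g\<in>{1..}. ennreal (1 / (g * mixing_density a b c g)) \<partial>lborel) < \<infinity> \<longrightarrow> inadmissible \<delta>) \<and>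
    ((\<integral>\<^sup>+ g\<in>{1..}. ennreal (1 / (g * mixing_density a b c g)) \<partial>lborel) < \<infinity> \<longleftrightarrow>
     (\<integral>\<^sup>+ t\<in>{1..}. ennreal (1 / (t powr (real CARD('n) / 2) * marginal CARD('n) a b c t)) \<partial>lborel) < \<infinity>)"
proof -
  define A where "A = a - real CARD('n) / 2"
  have A: "A < -1" using assms(1) by (simp add: A_def)
  have \<delta>: "\<delta> = shrinkage A b c"
    unfolding assms(3) A_def
    by (rule ext) (simp only: generalized_bayes_prior_density[OF assms(1,2)] shrinkage_def)
  have m: "marginal CARD('n) a b c = mixing_mass A b c"
    unfolding A_def by (rule ext) (rule marginal_eq_mixing_mass)
  have gradient: "GDERIV (\<lambda>y. ln (marginal CARD('n) a b c ((norm y)\<^sup>2))) x :> (\<delta> x - x)" for x :: "real ^ 'n"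
    unfolding m
    by (rule GDERIV_subst[OF gderiv_ln_mixing_mass[OF A assms(2)]]) (simp add: \<delta> shrinkage_def scaleR_diff_left)
  have equiv: "(\<integral>\<^sup>+ g\<in>{1..}. ennreal (1 / (g * mixing_density a b c g)) \<partial>lborel) < \<infinity> \<longleftrightarrow>
     (\<integral>\<^sup>+ t\<in>{1..}. ennreal (1 / (t powr (real CARD('n) / 2) * mixing_mass A b c t)) \<partial>lborel) < \<infinity>"
    using A assms(2) unfolding A_def by (rule mixing_integral_finite_iff_marginal)
  have "admissible \<delta>" if "(\<integral>\<^sup>+ g\<in>{1..}. ennreal (1 / (g * mixing_density a b c g)) \<partial>lborel) = \<infinity>"
    using mixing_density_growth[OF that] admissible_of_growth[OF assms(1,2) \<delta>[unfolded A_def]] by metis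
  moreover have "inadmissible \<delta>" if "(\<integral>\<^sup>+ g\<in>{1..}. ennreal (1 / (g * mixing_density a b c g)) \<partial>lborel) < \<infinity>"
    using A assms(2) \<delta> that unfolding equiv by (rule inadmissible_of_finite)
  ultimately show ?thesis using gradient equiv unfolding m by blast
qed

end
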